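(* The bipartite incidence map $\mathsf{B}$ induces functors $\mathsf{B}:\mathcal{H}_{\mathrm{m}}\to\mathcal{B}_{\mathrm{m}}$ and $\mathsf{B}:\mathcal{H}_{\mathrm{c}}\to\mathcal{B}_{\mathrm{c}}$, and is an isometry from $(\mathcal{H},d_{\mathcal{H},p})$ to $(\mathcal{B},2^{1/p}\cdot d_{\mathcal{B},p})$ for $p\in[1,\infty)$ and from $(\mathcal{H},d_{\mathcal{H},\infty})$ to $(\mathcal{B},d_{\mathcal{B},\infty})$ for $p=\infty$.
   Context: Measure networks and hypernetworks. A measure network is a triple $N=(X,\mu,\omega)$ with $X$ a Polish space, $\mu$ a fully supported Borel probability measure on $X$ and $\omega:X\times X\to\mathbb{R}$ measurable, bounded and non-negative. A measure hypernetwork is a quintuple $H=(X,\mu,Y,\nu,\omega)$ with $X,Y$ Polish spaces, $\mu,\nu$ fully supported Borel probability measures on $X,Y$, and $\omega:X\times Y\to\mathbb{R}$ measurable, bounded and non-negative; $\mathcal{H}$ is the collection of all of them. These are called compact if the underlying space (resp. both underlying spaces) is compact. $\mathcal{C}(\mu,\mu')$ is the set of couplings of $\mu,\mu'$ (probability measures on the product with these marginals). Distances. $d_{\mathcal{H},p}(H,H')=\inf_{\pi\in\mathcal{C}(\mu,\mu'),\,\xi\in\mathcal{C}(\nu,\nu')}\|\omega(x,y)-\omega'(x',y')\|_{L^p(\pi\otimes\xi)}$. For a coupling $\pi\in\mathcal{C}(\mu,\mu')$ of measure networks, $\mathrm{dis}^{\mathcal{N}}_p(\pi)=\|\omega(x,y)-\omega'(x',y')\|_{L^p(\pi\otimes\pi)}$,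 where $\pi\otimes\pi$ is a measure in the variables $((x,x'),(y,y'))$. Composition of couplings. For $\pi\in\mathcal{C}(\mu,\mu')$, $\pi'\in\mathcal{C}(\mu',\mu'')$ with disintegrations $\pi_{x'}$ on $X$ and $\pi'_{x'}$ on $X''$ with respect to $\mu'$, the gluing is $\pi'\boxtimes\pi(dx\times dx'\times dx'')=\pi'_{x'}(dx'')\pi_{x'}(dx)\mu'(dx')$, and $\pi'\bullet\pi$ is the $X\times X''$ marginal of $\pi'\boxtimes\pi$. Categories. $\mathcal{H}_{\mathrm{m}}$: objects are measure hypernetworks; morphisms $H\to H'$ are expansive maps, i.e. pairs of functions $(\phi:X\to X',\psi:Y\to Y')$ with $\omega(x,y)\le\omega'(\phi(x),\psi(y))$ for all $(x,y)$; composition is componentwise. $\mathcal{H}_{\mathrm{c}}$: objects are compact measure hypernetworks; morphisms are expansive couplings, i.e. pairs $(\pi,\xi)\in\mathcal{C}(\mu,\mu')\times\mathcal{C}(\nu,\nu')$ with $\omega(x,y)\le\omega'(x',y')$ for $\pi\otimes\xi$-almost every $((x,x'),(y,y'))$; composition is $(\pi',\xi')\bullet(\pi,\xi)=(\pi'\bullet\pi,\xi'\bullet\xi)$, identities are the pairs of diagonal couplings. Bipartite networks. A measure network $(Z,\mu,\omega)$ is bipartite if there is a topological disconnection $Z=X\cup Y$ such that $\mu(X)=\mu(Y)=\tfrac12$ and for all $x_1,x_2\in X$, $y_1,y_2\in Y$: $\omega(x_1,x_2)=\omega(y_1,y_2)=0$ and $\omega(x_1,y_1)=\omega(y_1,x_1)$.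 A labeled bipartite network is a bipartite network with a fixed such decomposition, written $(X,Y,\mu,\omega)$; $\mathcal{B}$ is the collection of these. A labeled coupling of $(X,Y,\mu)$ and $(X',Y',\mu')$ is a coupling $\pi\in\mathcal{C}(\mu,\mu')$ with $\mathrm{supp}(\pi)\subset(X\times X')\cup(Y\times Y')$. The labeled Gromov-Wasserstein distance is $d_{\mathcal{B},p}(N,N')=\inf\mathrm{dis}^{\mathcal{N}}_p(\pi)$ over labeled couplings $\pi$. $\mathcal{B}_{\mathrm{m}}$: objects are labeled bipartite networks; morphisms are maps $f:X\cup Y\to X'\cup Y'$ with $f(X)\subset X'$, $f(Y)\subset Y'$ and $\omega(w,z)\le\omega'(f(w),f(z))$ for all $w,z$. $\mathcal{B}_{\mathrm{c}}$: objects are compact labeled bipartite networks; morphisms are labeled couplings $\pi$ with $\omega(w,z)\le\omega'(w',z')$ for $\pi\otimes\pi$-almost every $((w,w'),(z,z'))$, composed by $\bullet$. Bipartite incidence map. $\mathsf{B}(X,\mu,Y,\nu,\omega)=(Z,\mu_{\mathsf{B}},\omega_{\mathsf{B}})$, where $Z=X\sqcup Y$ has the disjoint union topology, $\mu_{\mathsf{B}}=\frac12((i_X)_\#\mu+(i_Y)_\#\nu)$ with $i_X,i_Y$ the inclusions, and $\omega_{\mathsf{B}}(w,z)=\omega(w,z)$ if $w\in X,z\in Y$; $\omega_{\mathsf{B}}(w,z)=\omega(z,w)$ if $w\in Y,z\in X$; and $0$ otherwise. It is labeled by the decomposition $(X,Y)$. On morphisms: $\mathsf{B}(\phi,\psi)$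 equals $\phi$ on $X$ and $\psi$ on $Y$; $\mathsf{B}(\pi,\xi)=\frac12((i_{X\times X'})_\#\pi+(i_{Y\times Y'})_\#\xi)$ with $i_{X\times X'},i_{Y\times Y'}$ the inclusions into $Z\times Z'$. *)

theory Defs
  imports "HOL-Probability.Probability"
begin

section \<open>Categories and functors\<close>

text \<open>
  Categories are given by hom-sets indexed by pairs of objects;
  \<open>Comp C a b c g f\<close> is the composite of \<open>f : a \<rightarrow> b\<close> followed by \<open>g : b \<rightarrow> c\<close>.
\<close>

record ('o, 'm) category =
  Ob :: "'o set"
  Hom :: "'o \<Rightarrow> 'o \<Rightarrow> 'm set"
  Id :: "'o \<Rightarrow> 'm"
  Comp :: "'o \<Rightarrow> 'o \<Rightarrow> 'o \<Rightarrow> 'm \<Rightarrow> 'm \<Rightarrow> 'm"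

definition is_category :: "('o, 'm) category \<Rightarrow> bool" where
  "is_category C \<longleftrightarrow>
     (\<forall>a\<in>Ob C. Id C a \<in> Hom C a a) \<and>
     (\<forall>a\<in>Ob C. \<forall>b\<in>Ob C. \<forall>c\<in>Ob C. \<forall>f\<in>Hom C a b. \<forall>g\<in>Hom C b c.
        Comp C a b c g f \<in> Hom C a c) \<and>
     (\<forall>a\<in>Ob C. \<forall>b\<in>Ob C. \<forall>f\<in>Hom C a b.
        Comp C a a b f (Id C a) = f \<and> Comp C a b b (Id C b) f = f) \<and>
     (\<forall>a\<in>Ob C. \<forall>b\<in>Ob C. \<forall>c\<in>Ob C. \<forall>d\<in>Ob C.
        \<forall>f\<in>Hom C a b. \<forall>g\<in>Hom C b c. \<forall>h\<in>Hom C c d.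
        Comp C a c d h (Comp C a b c g f) = Comp C a b d (Comp C b c d h g) f)"

definition is_functor ::
  "('o, 'm) category \<Rightarrow> ('o2, 'm2) category \<Rightarrow>
   ('o \<Rightarrow> 'o2) \<Rightarrow> ('o \<Rightarrow> 'o \<Rightarrow> 'm \<Rightarrow> 'm2) \<Rightarrow> bool" where
  "is_functor C D F G \<longleftrightarrow>
     is_category C \<and> is_category D \<and>
     (\<forall>a\<in>Ob C. F a \<in> Ob D) \<and>
     (\<forall>a\<in>Ob C. \<forall>b\<in>Ob C. \<forall>f\<in>Hom C a b. G a b f \<in> Hom D (F a) (F b)) \<and>
     (\<forall>a\<in>Ob C. G a a (Id C a) = Id D (F a)) \<and>
     (\<forall>a\<in>Ob C. \<forall>b\<in>Ob C. \<forall>c\<in>Ob C. \<forall>f\<in>Hom C a b. \<forall>g\<in>Hom C b c.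
        G a c (Comp C a b c g f) = Comp D (F a) (F b) (F c) (G b c g) (G a b f))"


section \<open>Polish spaces and Borel probability measures\<close>

text \<open>
  Spaces are topologies on an arbitrary carrier \<open>topspace X\<close> inside a type, so that
  one type hosts many spaces.
\<close>

definition polish :: "'a topology \<Rightarrow> bool" where
  "polish X \<longleftrightarrow> completely_metrizable_space X \<and> second_countable X"

definition borel_of :: "'a topology \<Rightarrow> 'a measure" where
  "borel_of X = sigma (topspace X) {U. openin X U}"

definition measure_support :: "'a topology \<Rightarrow> 'a measure \<Rightarrow> 'a set" where
  "measure_support X \<mu> = {x \<in> topspace X. \<forall>U. openin X U \<and> x \<in> U \<longrightarrow> emeasure \<mu> U > 0}"

definition full_borel_prob :: "'a topology \<Rightarrow> 'a measure \<Rightarrow> bool" where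
  "full_borel_prob X \<mu> \<longleftrightarrow>
     prob_space \<mu> \<and> sets \<mu> = sets (borel_of X) \<and> measure_support X \<mu> = topspace X"

definition disjoint_union_topology :: "'a topology \<Rightarrow> 'b topology \<Rightarrow> ('a + 'b) topology" where
  "disjoint_union_topology X Y =
     topology (\<lambda>U. openin X (Inl -` U) \<and> openin Y (Inr -` U))"

lemma openin_disjoint_union_topology:
  "openin (disjoint_union_topology X Y) U \<longleftrightarrow> openin X (Inl -` U) \<and> openin Y (Inr -` U)"
proof -
  have "istopology (\<lambda>U. openin X (Inl -` U) \<and> openin Y (Inr -` U))"
    unfolding istopology_def by (auto simp: vimage_Union)
  then show ?thesis
    by (simp add: disjoint_union_topology_def)
qed

lemma topspace_disjoint_union_topology:
  "topspace (disjoint_union_topology X Y) = topspace X <+> topspace Y"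
proof
  show "topspace (disjoint_union_topology X Y) \<subseteq> topspace X <+> topspace Y"
  proof
    fix z assume "z \<in> topspace (disjoint_union_topology X Y)"
    then obtain U where U: "openin X (Inl -` U)" "openin Y (Inr -` U)" "z \<in> U"
      by (auto simp: topspace_def openin_disjoint_union_topology)
    with openin_subset[OF U(1)] openin_subset[OF U(2)]
    show "z \<in> topspace X <+> topspace Y" by (cases z) auto
  qed
  have "Inl -` (topspace X <+> topspace Y) = topspace X"
    "Inr -` (topspace X <+> topspace Y) = topspace Y" by auto
  then have "openin (disjoint_union_topology X Y) (topspace X <+> topspace Y)"
    by (simp add: openin_disjoint_union_topology)
  then show "topspace X <+> topspace Y \<subseteq> topspace (disjoint_union_topology X Y)"
    by (rule openin_subset)
qed

text \<open>The measure \<open>(P + Q) / 2\<close> on the measurable space underlying \<open>M\<close>.\<close>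

definition average_measure :: "'a measure \<Rightarrow> 'a measure \<Rightarrow> 'a measure \<Rightarrow> 'a measure" where
  "average_measure M P Q =
     measure_of (space M) (sets M) (\<lambda>A. (emeasure P A + emeasure Q A) / 2)"

definition Lp_norm :: "ereal \<Rightarrow> 'a measure \<Rightarrow> ('a \<Rightarrow> real) \<Rightarrow> real" where
  "Lp_norm p M f =
     (if p = \<infinity> then real_of_ereal (esssup M (\<lambda>x. ereal \<bar>f x\<bar>))
      else (\<integral>x. \<bar>f x\<bar> powr real_of_ereal p \<partial>M) powr (1 / real_of_ereal p))"


section \<open>Couplings and their composition\<close>

text \<open>
  On second countable spaces the product \<open>\<sigma>\<close>-algebra of the Borel \<open>\<sigma>\<close>-algebras is the
  Borel \<open>\<sigma>\<close>-algebra of the product, so couplings live on \<open>\<mu> \<Otimes>\<^sub>M \<mu>'\<close>.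
\<close>

definition couplings :: "'a measure \<Rightarrow> 'b measure \<Rightarrow> ('a \<times> 'b) measure set" where
  "couplings \<mu> \<mu>' =
     {\<pi>. prob_space \<pi> \<and> sets \<pi> = sets (\<mu> \<Otimes>\<^sub>M \<mu>') \<and>
         distr \<pi> \<mu> fst = \<mu> \<and> distr \<pi> \<mu>' snd = \<mu>'}"

definition diagonal_coupling :: "'a measure \<Rightarrow> ('a \<times> 'a) measure" where
  "diagonal_coupling \<mu> = distr \<mu> (\<mu> \<Otimes>\<^sub>M \<mu>) (\<lambda>x. (x, x))"

definition is_disintegration_fst ::
  "'a measure \<Rightarrow> 'b measure \<Rightarrow> ('a \<times> 'b) measure \<Rightarrow> ('a \<Rightarrow> 'b measure) \<Rightarrow> bool" where
  "is_disintegration_fst \<mu> \<nu> \<pi> k \<longleftrightarrow>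
     k \<in> \<mu> \<rightarrow>\<^sub>M prob_algebra \<nu> \<and>
     (\<forall>A\<in>sets \<mu>. \<forall>B\<in>sets \<nu>. emeasure \<pi> (A \<times> B) = (\<integral>\<^sup>+x\<in>A. emeasure (k x) B \<partial>\<mu>))"

definition is_disintegration_snd ::
  "'a measure \<Rightarrow> 'b measure \<Rightarrow> ('a \<times> 'b) measure \<Rightarrow> ('b \<Rightarrow> 'a measure) \<Rightarrow> bool" where
  "is_disintegration_snd \<mu> \<nu> \<pi> k \<longleftrightarrow>
     k \<in> \<nu> \<rightarrow>\<^sub>M prob_algebra \<mu> \<and>
     (\<forall>A\<in>sets \<mu>. \<forall>B\<in>sets \<nu>. emeasure \<pi> (A \<times> B) = (\<integral>\<^sup>+y\<in>B. emeasure (k y) A \<partial>\<nu>))"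

text \<open>
  The gluing of \<open>\<pi>\<close> (a coupling of \<open>\<mu>, \<mu>'\<close>) and \<open>\<pi>'\<close> (a coupling of \<open>\<mu>', \<mu>''\<close>) integrates
  the products of the conditional measures over \<open>\<mu>'\<close>.  Disintegrations are unique almost
  everywhere, so the choices do not affect the result.
\<close>

definition gluing ::
  "'a measure \<Rightarrow> 'b measure \<Rightarrow> 'c measure \<Rightarrow> ('b \<times> 'c) measure \<Rightarrow> ('a \<times> 'b) measure \<Rightarrow>
   ('a \<times> 'b \<times> 'c) measure" where
  "gluing \<mu> \<mu>' \<mu>'' \<pi>' \<pi> =
     (let k = (SOME k. is_disintegration_snd \<mu> \<mu>' \<pi> k);
          k' = (SOME k'. is_disintegration_fst \<mu>' \<mu>'' \<pi>' k')
      in \<mu>' \<bind> (\<lambda>x'. distr (k x' \<Otimes>\<^sub>M k' x') (\<mu> \<Otimes>\<^sub>M (\<mu>' \<Otimes>\<^sub>M \<mu>'')) (\<lambda>(x, x''). (x, x', x''))))"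

definition coupling_comp ::
  "'a measure \<Rightarrow> 'b measure \<Rightarrow> 'c measure \<Rightarrow> ('b \<times> 'c) measure \<Rightarrow> ('a \<times> 'b) measure \<Rightarrow>
   ('a \<times> 'c) measure" where
  "coupling_comp \<mu> \<mu>' \<mu>'' \<pi>' \<pi> =
     distr (gluing \<mu> \<mu>' \<mu>'' \<pi>' \<pi>) (\<mu> \<Otimes>\<^sub>M \<mu>'') (\<lambda>(x, x', x''). (x, x''))"


section \<open>Measure hypernetworks\<close>

record ('a, 'b) hypernetwork =
  hspace1 :: "'a topology"
  hmeas1 :: "'a measure"
  hspace2 :: "'b topology"
  hmeas2 :: "'b measure"
  hweight :: "'a \<times> 'b \<Rightarrow> real"

text \<open>
  Weights and maps are extensional (\<open>\<rightarrow>\<^sub>E\<close>), so that equality in HOL is equality of functions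
  on the carriers.
\<close>

definition measure_hypernetwork :: "('a, 'b) hypernetwork \<Rightarrow> bool" where
  "measure_hypernetwork H \<longleftrightarrow>
     polish (hspace1 H) \<and> full_borel_prob (hspace1 H) (hmeas1 H) \<and>
     polish (hspace2 H) \<and> full_borel_prob (hspace2 H) (hmeas2 H) \<and>
     hweight H \<in> topspace (hspace1 H) \<times> topspace (hspace2 H) \<rightarrow>\<^sub>E {0..} \<and>
     hweight H \<in> borel_measurable (hmeas1 H \<Otimes>\<^sub>M hmeas2 H) \<and>
     bounded (hweight H ` (topspace (hspace1 H) \<times> topspace (hspace2 H)))"

definition compact_hypernetwork :: "('a, 'b) hypernetwork \<Rightarrow> bool" where
  "compact_hypernetwork H \<longleftrightarrow>
     measure_hypernetwork H \<and> compact_space (hspace1 H) \<and> compact_space (hspace2 H)"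

definition dist_H :: "ereal \<Rightarrow> ('a, 'b) hypernetwork \<Rightarrow> ('c, 'd) hypernetwork \<Rightarrow> real" where
  "dist_H p H H' =
     (INF (\<pi>, \<xi>) \<in> couplings (hmeas1 H) (hmeas1 H') \<times> couplings (hmeas2 H) (hmeas2 H').
        Lp_norm p (\<pi> \<Otimes>\<^sub>M \<xi>) (\<lambda>((x, x'), (y, y')). hweight H (x, y) - hweight H' (x', y')))"

definition expansive_maps ::
  "('a, 'b) hypernetwork \<Rightarrow> ('c, 'd) hypernetwork \<Rightarrow> (('a \<Rightarrow> 'c) \<times> ('b \<Rightarrow> 'd)) set" where
  "expansive_maps H H' =
     {(\<phi>, \<psi>). \<phi> \<in> topspace (hspace1 H) \<rightarrow>\<^sub>E topspace (hspace1 H') \<and>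
              \<psi> \<in> topspace (hspace2 H) \<rightarrow>\<^sub>E topspace (hspace2 H') \<and>
              (\<forall>x\<in>topspace (hspace1 H). \<forall>y\<in>topspace (hspace2 H).
                 hweight H (x, y) \<le> hweight H' (\<phi> x, \<psi> y))}"

definition expansive_couplings ::
  "('a, 'b) hypernetwork \<Rightarrow> ('c, 'd) hypernetwork \<Rightarrow>
   (('a \<times> 'c) measure \<times> ('b \<times> 'd) measure) set" where
  "expansive_couplings H H' =
     {(\<pi>, \<xi>). \<pi> \<in> couplings (hmeas1 H) (hmeas1 H') \<and>
              \<xi> \<in> couplings (hmeas2 H) (hmeas2 H') \<and>
              (AE ((x, x'), (y, y')) in \<pi> \<Otimes>\<^sub>M \<xi>. hweight H (x, y) \<le> hweight H' (x', y'))}"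

definition cat_Hm :: "(('a, 'b) hypernetwork, ('a \<Rightarrow> 'a) \<times> ('b \<Rightarrow> 'b)) category" where
  "cat_Hm =
     \<lparr> Ob = {H. measure_hypernetwork H},
       Hom = expansive_maps,
       Id = (\<lambda>H. (\<lambda>x\<in>topspace (hspace1 H). x, \<lambda>y\<in>topspace (hspace2 H). y)),
       Comp = (\<lambda>H H' H'' (\<phi>', \<psi>') (\<phi>, \<psi>).
         (compose (topspace (hspace1 H)) \<phi>' \<phi>, compose (topspace (hspace2 H)) \<psi>' \<psi>)) \<rparr>"

definition cat_Hc ::
  "(('a, 'b) hypernetwork, ('a \<times> 'a) measure \<times> ('b \<times> 'b) measure) category" where
  "cat_Hc =
     \<lparr> Ob = {H. compact_hypernetwork H},
       Hom = expansive_couplings,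
       Id = (\<lambda>H. (diagonal_coupling (hmeas1 H), diagonal_coupling (hmeas2 H))),
       Comp = (\<lambda>H H' H'' (\<pi>', \<xi>') (\<pi>, \<xi>).
         (coupling_comp (hmeas1 H) (hmeas1 H') (hmeas1 H'') \<pi>' \<pi>,
          coupling_comp (hmeas2 H) (hmeas2 H') (hmeas2 H'') \<xi>' \<xi>)) \<rparr>"


section \<open>Measure networks and labeled bipartite networks\<close>

record 'a network =
  nspace :: "'a topology"
  nmeas :: "'a measure"
  nweight :: "'a \<times> 'a \<Rightarrow> real"

record 'a labeled_network = "'a network" +
  nleft :: "'a set"
  nright :: "'a set"

definition measure_network :: "('a, 'm) network_scheme \<Rightarrow> bool" where
  "measure_network N \<longleftrightarrow>
     polish (nspace N) \<and> full_borel_prob (nspace N) (nmeas N) \<and>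
     nweight N \<in> topspace (nspace N) \<times> topspace (nspace N) \<rightarrow>\<^sub>E {0..} \<and>
     nweight N \<in> borel_measurable (nmeas N \<Otimes>\<^sub>M nmeas N) \<and>
     bounded (nweight N ` (topspace (nspace N) \<times> topspace (nspace N)))"

definition bipartite_decomposition :: "('a, 'm) network_scheme \<Rightarrow> 'a set \<Rightarrow> 'a set \<Rightarrow> bool" where
  "bipartite_decomposition N X Y \<longleftrightarrow>
     openin (nspace N) X \<and> openin (nspace N) Y \<and>
     X \<inter> Y = {} \<and> X \<union> Y = topspace (nspace N) \<and>
     measure (nmeas N) X = 1 / 2 \<and> measure (nmeas N) Y = 1 / 2 \<and>
     (\<forall>x1\<in>X. \<forall>x2\<in>X. nweight N (x1, x2) = 0) \<and>
     (\<forall>y1\<in>Y. \<forall>y2\<in>Y. nweight N (y1, y2) = 0) \<and>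
     (\<forall>x\<in>X. \<forall>y\<in>Y. nweight N (x, y) = nweight N (y, x))"

definition labeled_bipartite_network :: "'a labeled_network \<Rightarrow> bool" where
  "labeled_bipartite_network N \<longleftrightarrow>
     measure_network N \<and> bipartite_decomposition N (nleft N) (nright N)"

definition compact_labeled_bipartite_network :: "'a labeled_network \<Rightarrow> bool" where
  "compact_labeled_bipartite_network N \<longleftrightarrow>
     labeled_bipartite_network N \<and> compact_space (nspace N)"

definition labeled_couplings ::
  "'a labeled_network \<Rightarrow> 'b labeled_network \<Rightarrow> ('a \<times> 'b) measure set" where
  "labeled_couplings N N' =
     {\<pi> \<in> couplings (nmeas N) (nmeas N').
        measure_support (prod_topology (nspace N) (nspace N')) \<pi>
          \<subseteq> nleft N \<times> nleft N' \<union> nright N \<times> nright N'}"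

definition distortion ::
  "ereal \<Rightarrow> ('a, 'm) network_scheme \<Rightarrow> ('b, 'n) network_scheme \<Rightarrow> ('a \<times> 'b) measure \<Rightarrow> real" where
  "distortion p N N' \<pi> =
     Lp_norm p (\<pi> \<Otimes>\<^sub>M \<pi>) (\<lambda>((x, x'), (y, y')). nweight N (x, y) - nweight N' (x', y'))"

definition dist_B :: "ereal \<Rightarrow> 'a labeled_network \<Rightarrow> 'b labeled_network \<Rightarrow> real" where
  "dist_B p N N' = (INF \<pi> \<in> labeled_couplings N N'. distortion p N N' \<pi>)"

definition expansive_labeled_maps ::
  "'a labeled_network \<Rightarrow> 'b labeled_network \<Rightarrow> ('a \<Rightarrow> 'b) set" where
  "expansive_labeled_maps N N' =
     {f \<in> topspace (nspace N) \<rightarrow>\<^sub>E topspace (nspace N').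
        f ` nleft N \<subseteq> nleft N' \<and> f ` nright N \<subseteq> nright N' \<and>
        (\<forall>w\<in>topspace (nspace N). \<forall>z\<in>topspace (nspace N).
           nweight N (w, z) \<le> nweight N' (f w, f z))}"

definition expansive_labeled_couplings ::
  "'a labeled_network \<Rightarrow> 'b labeled_network \<Rightarrow> ('a \<times> 'b) measure set" where
  "expansive_labeled_couplings N N' =
     {\<pi> \<in> labeled_couplings N N'.
        AE ((w, w'), (z, z')) in \<pi> \<Otimes>\<^sub>M \<pi>. nweight N (w, z) \<le> nweight N' (w', z')}"

definition cat_Bm :: "('a labeled_network, 'a \<Rightarrow> 'a) category" where
  "cat_Bm =
     \<lparr> Ob = {N. labeled_bipartite_network N},
       Hom = expansive_labeled_maps,
       Id = (\<lambda>N. \<lambda>z\<in>topspace (nspace N). z),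
       Comp = (\<lambda>N N' N'' g f. compose (topspace (nspace N)) g f) \<rparr>"

definition cat_Bc :: "('a labeled_network, ('a \<times> 'a) measure) category" where
  "cat_Bc =
     \<lparr> Ob = {N. compact_labeled_bipartite_network N},
       Hom = expansive_labeled_couplings,
       Id = (\<lambda>N. diagonal_coupling (nmeas N)),
       Comp = (\<lambda>N N' N'' \<pi>' \<pi>. coupling_comp (nmeas N) (nmeas N') (nmeas N'') \<pi>' \<pi>) \<rparr>"


section \<open>The bipartite incidence map\<close>

fun incidence_weight :: "('a \<times> 'b \<Rightarrow> real) \<Rightarrow> ('a + 'b) \<times> ('a + 'b) \<Rightarrow> real" where
  "incidence_weight \<omega> (Inl x, Inr y) = \<omega> (x, y)"
| "incidence_weight \<omega> (Inr y, Inl x) = \<omega> (x, y)"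
| "incidence_weight \<omega> (Inl _, Inl _) = 0"
| "incidence_weight \<omega> (Inr _, Inr _) = 0"

definition bip :: "('a, 'b) hypernetwork \<Rightarrow> ('a + 'b) labeled_network" where
  "bip H =
     (let X = hspace1 H; Y = hspace2 H; Z = disjoint_union_topology X Y
      in \<lparr> nspace = Z,
           nmeas = average_measure (borel_of Z)
                     (distr (hmeas1 H) (borel_of Z) Inl) (distr (hmeas2 H) (borel_of Z) Inr),
           nweight = restrict (incidence_weight (hweight H)) (topspace Z \<times> topspace Z),
           nleft = Inl ` topspace X,
           nright = Inr ` topspace Y \<rparr>)"

definition bip_map ::
  "('a, 'b) hypernetwork \<Rightarrow> ('c, 'd) hypernetwork \<Rightarrow>
   ('a \<Rightarrow> 'c) \<times> ('b \<Rightarrow> 'd) \<Rightarrow> 'a + 'b \<Rightarrow> 'c + 'd" where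
  "bip_map H H' = (\<lambda>(\<phi>, \<psi>). restrict (map_sum \<phi> \<psi>) (topspace (nspace (bip H))))"

definition bip_coupling ::
  "('a, 'b) hypernetwork \<Rightarrow> ('c, 'd) hypernetwork \<Rightarrow>
   ('a \<times> 'c) measure \<times> ('b \<times> 'd) measure \<Rightarrow> (('a + 'b) \<times> ('c + 'd)) measure" where
  "bip_coupling H H' = (\<lambda>(\<pi>, \<xi>).
     let M = nmeas (bip H) \<Otimes>\<^sub>M nmeas (bip H')
     in average_measure M (distr \<pi> M (map_prod Inl Inl)) (distr \<xi> M (map_prod Inr Inr)))"

end

theory Submission imports Defs begin

text \<open>
  Let \<open>H = (X, \<mu>, Y, \<nu>, \<omega>)\<close> be a hypernetwork.  The measure of its bipartite network is the average of
  \<open>\<mu>\<close> and \<open>\<nu>\<close> on the disjoint union of \<open>X\<close> and \<open>Y\<close>.  A labeled coupling of two such networks gives no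
  mass to the mixed blocks, so it is the average of a coupling \<open>\<pi>\<close> of the left parts and a coupling \<open>\<xi>\<close>
  of the right parts, and the pair \<open>(\<pi>, \<xi>)\<close> can be prescribed (\<open>sum_coupling_surj\<close>,
  \<open>labeled_couplings_bip\<close>).  In the product of such a coupling with itself there are four blocks of
  equal weight.  In the two homogeneous ones both bipartite weights vanish; the two mixed ones are
  copies of \<open>\<pi> \<Otimes>\<^sub>M \<xi>\<close> with the weights of the hypernetworks (\<open>nn_integral_weights\<close>).  Hence the
  integral of the \<open>p\<close>-th power of the difference of the weights is halved, which accounts for the
  factor \<open>2 powr (1 / p)\<close>, while statements that hold almost everywhere, and with them essential
  suprema and expansiveness, are carried over unchanged (\<open>AE_weights_iff\<close>, \<open>expansive_iff\<close>).

  For the functor on couplings it has to be shown that composition is well behaved.  It is defined by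
  gluing along disintegrations that are picked by a choice operator.  They exist because a Borel
  probability on a compact metrizable space is, up to a null set, coded measurably by numbers in the
  unit interval (\<open>compact_polish_real_coded\<close>), where a conditional distribution function provides the
  conditional measures (\<open>disintegration_unit_interval\<close>).  They are irrelevant for the result because
  the composite has the value \<open>\<integral> f g d\<mu>'\<close> on \<open>A \<times> C\<close>, where \<open>f\<close> and \<open>g\<close> are any densities with respect
  to \<open>\<mu>'\<close> of \<open>B \<mapsto> \<pi> (A \<times> B)\<close> and \<open>B \<mapsto> \<pi>' (B \<times> C)\<close> (\<open>comp_rectangle\<close>).  The laws of a category and
  compatibility with averages (\<open>sum_coupling_comp\<close>) are then checked on rectangles.

  Conversely, the two parts of a labeled bipartite network with the measure conditioned on each of
  them form a hypernetwork.  The folding map from its bipartite network to the given one preserves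
  measures, labels and weights, so that the distance between the two is zero
  (\<open>dist_split_network\<close>).
\<close>

section \<open>Couplings and densities of their sections\<close>

text \<open>
  Couplings are compared on rectangles throughout; these form an intersection-stable generator.
\<close>

lemma measure_eqI_rectangles:
  assumes P: "prob_space P" "sets P = sets (M \<Otimes>\<^sub>M N)" and Q: "sets Q = sets (M \<Otimes>\<^sub>M N)"
    and eq: "\<And>A B. A \<in> sets M \<Longrightarrow> B \<in> sets N \<Longrightarrow> emeasure P (A \<times> B) = emeasure Q (A \<times> B)"
  shows "P = Q"
proof (rule measure_eqI_generator_eq[where A="\<lambda>_. space M \<times> space N"
      and E="{a \<times> b | a b. a \<in> sets M \<and> b \<in> sets N}" and \<Omega>="space M \<times> space N"])
  show "Int_stable {a \<times> b | a b. a \<in> sets M \<and> b \<in> sets N}" by (rule Int_stable_pair_measure_generator)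
  show "{a \<times> b | a b. a \<in> sets M \<and> b \<in> sets N} \<subseteq> Pow (space M \<times> space N)"
    by (rule pair_measure_closed)
  show "sets P = sigma_sets (space M \<times> space N) {a \<times> b | a b. a \<in> sets M \<and> b \<in> sets N}"
    "sets Q = sigma_sets (space M \<times> space N) {a \<times> b | a b. a \<in> sets M \<and> b \<in> sets N}"
    using P Q by (auto simp: sets_pair_measure)
  show "emeasure P (space M \<times> space N) \<noteq> \<infinity>" for i
    using P(1) by (simp add: prob_space.finite_measure finite_measure.emeasure_finite)
qed (use eq in auto)

text \<open>
  Testing the hypothesis on the set where \<open>g < f\<close> forces that set to be null.
\<close>

lemma AE_le_if_set_nn_integral_le:
  assumes [measurable]: "f \<in> borel_measurable M" "g \<in> borel_measurable M"
    and fin: "(\<integral>\<^sup>+x. g x \<partial>M) \<noteq> \<infinity>"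
    and le: "\<And>B. B \<in> sets M \<Longrightarrow> (\<integral>\<^sup>+x\<in>B. f x \<partial>M) \<le> (\<integral>\<^sup>+x\<in>B. g x \<partial>M)"
  shows "AE x in M. f x \<le> g x"
proof -
  let ?N = "{x\<in>space M. g x < f x}"
  have N[measurable]: "?N \<in> sets M" by simp
  have "(\<integral>\<^sup>+x\<in>?N. g x \<partial>M) \<le> (\<integral>\<^sup>+x. g x \<partial>M)"
    by (intro nn_integral_mono) (auto split: split_indicator)
  then have fin': "(\<integral>\<^sup>+x\<in>?N. g x \<partial>M) \<noteq> \<infinity>" using fin by (auto simp: top_unique)
  have "(\<integral>\<^sup>+x\<in>?N. (f x - g x) \<partial>M) = (\<integral>\<^sup>+x. f x * indicator ?N x - g x * indicator ?N x \<partial>M)"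
    by (auto intro!: nn_integral_cong simp: indicator_def)
  also have "\<dots> = (\<integral>\<^sup>+x\<in>?N. f x \<partial>M) - (\<integral>\<^sup>+x\<in>?N. g x \<partial>M)"
    using fin' by (intro nn_integral_diff) (auto split: split_indicator)
  also have "\<dots> = 0"
    using le[OF N] fin' by (simp add: diff_eq_0_iff_ennreal top.not_eq_extremum)
  finally have "(\<integral>\<^sup>+x\<in>?N. (f x - g x) \<partial>M) = 0" .
  then have "AE x in M. (f x - g x) * indicator ?N x = 0"
    by (subst (asm) nn_integral_0_iff_AE) auto
  moreover have "AE x in M. g x \<noteq> \<infinity>"
    using fin by (intro nn_integral_PInf_AE) auto
  ultimately show ?thesis
    using AE_space
  proof eventually_elim
    case (elim x)
    then show ?case
      using diff_eq_0_iff_ennreal[of "f x" "g x"]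
      by (cases "f x \<le> g x") (auto simp: indicator_def ennreal_minus_eq_0 AE_space)
  qed
qed

lemma couplingsD:
  assumes "\<pi> \<in> couplings \<mu> \<nu>"
  shows "prob_space \<pi>" "sets \<pi> = sets (\<mu> \<Otimes>\<^sub>M \<nu>)" "space \<pi> = space \<mu> \<times> space \<nu>"
    "fst \<in> \<pi> \<rightarrow>\<^sub>M \<mu>" "snd \<in> \<pi> \<rightarrow>\<^sub>M \<nu>" "distr \<pi> \<mu> fst = \<mu>" "distr \<pi> \<nu> snd = \<nu>"
    "prob_space \<mu>" "prob_space \<nu>"
proof -
  show 1: "prob_space \<pi>" "sets \<pi> = sets (\<mu> \<Otimes>\<^sub>M \<nu>)" "distr \<pi> \<mu> fst = \<mu>" "distr \<pi> \<nu> snd = \<nu>"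
    using assms by (auto simp: couplings_def)
  show "space \<pi> = space \<mu> \<times> space \<nu>"
    using sets_eq_imp_space_eq[OF 1(2)] by (simp add: space_pair_measure)
  show 2: "fst \<in> \<pi> \<rightarrow>\<^sub>M \<mu>" "snd \<in> \<pi> \<rightarrow>\<^sub>M \<nu>"
    using 1(2) by (simp_all cong: measurable_cong_sets)
  show "prob_space \<mu>" "prob_space \<nu>"
    using prob_space.prob_space_distr[OF 1(1) 2(1)] prob_space.prob_space_distr[OF 1(1) 2(2)]
    by (simp_all add: 1)
qed

lemma coupling_emeasure_fst:
  assumes \<pi>: "\<pi> \<in> couplings \<mu> \<nu>" and A: "A \<in> sets \<mu>"
  shows "emeasure \<pi> (A \<times> space \<nu>) = emeasure \<mu> A"
proof -
  have "emeasure \<mu> A = emeasure (distr \<pi> \<mu> fst) A" by (simp add: couplingsD[OF \<pi>])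
  also have "\<dots> = emeasure \<pi> (fst -` A \<inter> space \<pi>)"
    using couplingsD(4)[OF \<pi>] A by (rule emeasure_distr)
  also have "fst -` A \<inter> space \<pi> = A \<times> space \<nu>"
    using sets.sets_into_space[OF A] by (auto simp: couplingsD[OF \<pi>])
  finally show ?thesis by simp
qed

lemma coupling_emeasure_snd:
  assumes \<pi>: "\<pi> \<in> couplings \<mu> \<nu>" and B: "B \<in> sets \<nu>"
  shows "emeasure \<pi> (space \<mu> \<times> B) = emeasure \<nu> B"
proof -
  have "emeasure \<nu> B = emeasure (distr \<pi> \<nu> snd) B" by (simp add: couplingsD[OF \<pi>])
  also have "\<dots> = emeasure \<pi> (snd -` B \<inter> space \<pi>)"
    using couplingsD(5)[OF \<pi>] B by (rule emeasure_distr)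
  also have "snd -` B \<inter> space \<pi> = space \<mu> \<times> B"
    using sets.sets_into_space[OF B] by (auto simp: couplingsD[OF \<pi>])
  finally show ?thesis by simp
qed

lemma couplingsI:
  assumes P: "prob_space P" "sets P = sets (\<mu> \<Otimes>\<^sub>M \<nu>)"
    and fst: "\<And>A. A \<in> sets \<mu> \<Longrightarrow> emeasure P (A \<times> space \<nu>) = emeasure \<mu> A"
    and snd: "\<And>B. B \<in> sets \<nu> \<Longrightarrow> emeasure P (space \<mu> \<times> B) = emeasure \<nu> B"
  shows "P \<in> couplings \<mu> \<nu>"
proof -
  have m: "fst \<in> P \<rightarrow>\<^sub>M \<mu>" "snd \<in> P \<rightarrow>\<^sub>M \<nu>"
    using P by (simp_all cong: measurable_cong_sets)
  have sp: "space P = space \<mu> \<times> space \<nu>"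
    using sets_eq_imp_space_eq[OF P(2)] by (simp add: space_pair_measure)
  have "distr P \<mu> fst = \<mu>"
  proof (rule measure_eqI)
    fix A assume "A \<in> sets (distr P \<mu> fst)"
    then have A: "A \<in> sets \<mu>" by simp
    have "fst -` A \<inter> space P = A \<times> space \<nu>"
      using sets.sets_into_space[OF A] by (auto simp: sp)
    then show "emeasure (distr P \<mu> fst) A = emeasure \<mu> A"
      using A fst by (simp add: emeasure_distr[OF m(1)])
  qed simp
  moreover have "distr P \<nu> snd = \<nu>"
  proof (rule measure_eqI)
    fix A assume "A \<in> sets (distr P \<nu> snd)"
    then have A: "A \<in> sets \<nu>" by simp
    have "snd -` A \<inter> space P = space \<mu> \<times> A"
      using sets.sets_into_space[OF A] by (auto simp: sp)
    then show "emeasure (distr P \<nu> snd) A = emeasure \<nu> A"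
      using A snd by (simp add: emeasure_distr[OF m(2)])
  qed simp
  ultimately show ?thesis using P by (simp add: couplings_def)
qed

text \<open>
  The function \<open>f\<close> is the density of \<open>B \<mapsto> \<pi> (A \<times> B)\<close> with respect to \<open>\<nu>\<close>; for a disintegration
  \<open>k\<close> of \<open>\<pi>\<close> it is \<open>y \<mapsto> k y A\<close>.  Unlike a disintegration it exists for every coupling of arbitrary
  probability spaces and is unique almost everywhere, so it is the handle by which composites are
  computed independently of the disintegrations that define them.
\<close>

definition section_density ::
  "'b measure \<Rightarrow> ('a \<times> 'b) measure \<Rightarrow> 'a set \<Rightarrow> ('b \<Rightarrow> ennreal) \<Rightarrow> bool" where
  "section_density \<nu> \<pi> A f \<longleftrightarrow> f \<in> borel_measurable \<nu> \<and>
     (\<forall>B\<in>sets \<nu>. emeasure \<pi> (A \<times> B) = (\<integral>\<^sup>+y\<in>B. f y \<partial>\<nu>))"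

lemma section_density_mono:
  assumes \<pi>: "\<pi> \<in> couplings \<mu> \<nu>" and A: "A \<subseteq> A'" "A' \<in> sets \<mu>"
    and f: "section_density \<nu> \<pi> A f" and g: "section_density \<nu> \<pi> A' g"
  shows "AE y in \<nu>. f y \<le> g y"
proof (rule AE_le_if_set_nn_integral_le)
  interpret prob_space \<pi> by (rule couplingsD[OF \<pi>])
  show "f \<in> borel_measurable \<nu>" "g \<in> borel_measurable \<nu>"
    using f g by (auto simp: section_density_def)
  have "(\<integral>\<^sup>+y. g y \<partial>\<nu>) = (\<integral>\<^sup>+y\<in>space \<nu>. g y \<partial>\<nu>)"
    by (intro nn_integral_cong) auto
  also have "\<dots> = emeasure \<pi> (A' \<times> space \<nu>)"
    using g by (auto simp: section_density_def)
  finally show "(\<integral>\<^sup>+y. g y \<partial>\<nu>) \<noteq> \<infinity>" by simp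
  fix B assume B: "B \<in> sets \<nu>"
  have "emeasure \<pi> (A \<times> B) \<le> emeasure \<pi> (A' \<times> B)"
    using A B by (intro emeasure_mono) (auto simp: couplingsD[OF \<pi>])
  then show "(\<integral>\<^sup>+y\<in>B. f y \<partial>\<nu>) \<le> (\<integral>\<^sup>+y\<in>B. g y \<partial>\<nu>)"
    using f g B by (auto simp: section_density_def)
qed

lemma section_density_unique:
  assumes \<pi>: "\<pi> \<in> couplings \<mu> \<nu>" and A: "A \<in> sets \<mu>"
    and f: "section_density \<nu> \<pi> A f" and g: "section_density \<nu> \<pi> A g"
  shows "AE y in \<nu>. f y = g y"
  using section_density_mono[OF \<pi> order_refl A f g] section_density_mono[OF \<pi> order_refl A g f]
  by eventually_elim simp

lemma section_density_one:
  assumes \<pi>: "\<pi> \<in> couplings \<mu> \<nu>"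
  shows "section_density \<nu> \<pi> (space \<mu>) (\<lambda>_. 1)"
  using coupling_emeasure_snd[OF \<pi>] by (auto simp: section_density_def)

lemma section_density_cong_AE:
  assumes f: "section_density \<nu> \<pi> A f" and g: "g \<in> borel_measurable \<nu>" "AE y in \<nu>. f y = g y"
  shows "section_density \<nu> \<pi> A g"
proof -
  have "(\<integral>\<^sup>+y\<in>B. f y \<partial>\<nu>) = (\<integral>\<^sup>+y\<in>B. g y \<partial>\<nu>)" for B
    by (rule nn_integral_cong_AE) (use g(2) in eventually_elim, auto)
  then show ?thesis using f g(1) by (auto simp: section_density_def)
qed

text \<open>
  Radon--Nikodym applies because \<open>\<pi> (A \<times> B) \<le> \<nu> B\<close>; the same inequality bounds the density by \<open>1\<close>
  almost everywhere, and cutting it off there changes it on a null set only.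
\<close>

lemma section_density_exists:
  assumes \<pi>: "\<pi> \<in> couplings \<mu> \<nu>" and A: "A \<in> sets \<mu>"
  obtains f where "section_density \<nu> \<pi> A f" "\<And>y. f y \<le> 1"
proof -
  interpret P: prob_space \<pi> by (rule couplingsD[OF \<pi>])
  interpret N: prob_space \<nu> by (rule couplingsD[OF \<pi>])
  note [measurable] = couplingsD(4,5)[OF \<pi>]
  have S[measurable]: "A \<times> space \<nu> \<in> sets \<pi>"
    using A by (simp add: couplingsD[OF \<pi>])
  define \<eta> where "\<eta> = distr (density \<pi> (indicator (A \<times> space \<nu>))) \<nu> snd"
  have \<eta>: "emeasure \<eta> B = emeasure \<pi> (A \<times> B)" if B: "B \<in> sets \<nu>" for B
  proof -
    have eq: "(A \<times> space \<nu>) \<inter> (snd -` B \<inter> space \<pi>) = A \<times> B"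
      using sets.sets_into_space[OF A] sets.sets_into_space[OF B] by (auto simp: couplingsD[OF \<pi>])
    have "snd -` B \<inter> space \<pi> \<in> sets \<pi>" using B by measurable
    moreover have "A \<times> B \<in> sets \<pi>" using A B by (simp add: couplingsD[OF \<pi>])
    ultimately
    show ?thesis
      using B by (simp add: \<eta>_def emeasure_distr emeasure_density eq
          flip: indicator_inter_arith)
  qed
  have "absolutely_continuous \<nu> \<eta>"
    unfolding absolutely_continuous_def
  proof
    fix B assume B: "B \<in> null_sets \<nu>"
    then have B': "B \<in> sets \<nu>" by auto
    have "emeasure \<pi> (A \<times> B) \<le> emeasure \<pi> (space \<mu> \<times> B)"
      using B' sets.sets_into_space[OF A] by (intro emeasure_mono) (auto simp: couplingsD[OF \<pi>])
    also have "\<dots> = 0" using B coupling_emeasure_snd[OF \<pi> B'] by auto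
    finally show "B \<in> null_sets \<eta>" using B' \<eta>[OF B'] by (auto simp: null_sets_def) (simp add: \<eta>_def)
  qed
  then obtain f where f[measurable]: "f \<in> borel_measurable \<nu>" and "density \<nu> f = \<eta>"
    using N.Radon_Nikodym[of \<eta>] by (auto simp: \<eta>_def)
  then have d: "section_density \<nu> \<pi> A f"
    using \<eta> by (auto simp: section_density_def simp flip: emeasure_density)
  have "AE y in \<nu>. f y = min 1 (f y)"
    using section_density_mono[OF \<pi> sets.sets_into_space[OF A] sets.top d section_density_one[OF \<pi>]]
    by eventually_elim (auto simp: min_def)
  then have "section_density \<nu> \<pi> A (\<lambda>y. min 1 (f y))"
    by (intro section_density_cong_AE[OF d]) auto
  then show thesis by (rule that) auto
qed

section \<open>Disintegration of couplings\<close>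

text \<open>
  For fixed \<open>B\<close> both sides of the disintegration identity are finite measures in \<open>A\<close>, so it is
  enough to check half-lines.
\<close>

lemma disintegration_extend:
  fixes k :: "'b \<Rightarrow> real measure"
  assumes \<pi>: "\<pi> \<in> couplings \<mu> \<nu>" and \<mu>: "sets \<mu> = sets borel"
    and k: "k \<in> \<nu> \<rightarrow>\<^sub>M prob_algebra \<mu>"
    and sd: "\<And>t. section_density \<nu> \<pi> {..t} (\<lambda>y. emeasure (k y) {..t})"
  shows "is_disintegration_snd \<mu> \<nu> \<pi> k"
  unfolding is_disintegration_snd_def
proof (intro conjI ballI k)
  interpret P: prob_space \<pi> by (rule couplingsD[OF \<pi>])
  interpret N: prob_space \<nu> by (rule couplingsD[OF \<pi>])
  note [measurable] = couplingsD(4,5)[OF \<pi>]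
  have sp\<mu>: "space \<mu> = UNIV" using sets_eq_imp_space_eq[OF \<mu>] by simp
  fix A B assume A: "A \<in> sets \<mu>" and B: "B \<in> sets \<nu>"
  define M1 where "M1 = distr (density \<pi> (indicator (space \<mu> \<times> B))) \<mu> fst"
  define M2 where "M2 = density \<nu> (indicator B) \<bind> k"
  have M1: "emeasure M1 A = emeasure \<pi> (A \<times> B)" if A: "A \<in> sets \<mu>" for A
  proof -
    have eq: "(space \<mu> \<times> B) \<inter> (fst -` A \<inter> space \<pi>) = A \<times> B"
      using sets.sets_into_space[OF A] sets.sets_into_space[OF B] by (auto simp: couplingsD[OF \<pi>])
    have "fst -` A \<inter> space \<pi> \<in> sets \<pi>" using A by measurable
    moreover have "A \<times> B \<in> sets \<pi>" "space \<mu> \<times> B \<in> sets \<pi>" using A B by (simp_all add: couplingsD[OF \<pi>])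
    ultimately show ?thesis
      using A by (simp add: M1_def emeasure_distr emeasure_density eq
          flip: indicator_inter_arith)
  qed
  have k': "k \<in> density \<nu> (indicator B) \<rightarrow>\<^sub>M subprob_algebra \<mu>"
    using measurable_prob_algebraD[OF k] by simp
  have M2: "emeasure M2 A = (\<integral>\<^sup>+y\<in>B. emeasure (k y) A \<partial>\<nu>)" if A: "A \<in> sets \<mu>" for A
  proof -
    have "(\<lambda>x. emeasure (k x) A) \<in> borel_measurable \<nu>"
      using A measurable_prob_algebraD[OF k]
      by (rule measurable_compose[rotated, OF measurable_emeasure_subprob_algebra])
    then show ?thesis
    unfolding M2_def using A B N.not_empty
    by (subst emeasure_bind[OF _ k' A]) (auto simp: nn_integral_density mult.commute)
  qed
  have "M1 = M2"
  proof (rule measure_eqI_generator_eq[where E="range atMost" and \<Omega>=UNIV and A="\<lambda>n. {..real n}"])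
    show "Int_stable (range (atMost::real \<Rightarrow> _))" by (auto simp: Int_stable_def)
    show "sets M1 = sigma_sets UNIV (range atMost)"
      unfolding M1_def by (simp add: \<mu> borel_eq_atMost)
    have "sets M2 = sets \<mu>" 
      unfolding M2_def using N.not_empty by (subst sets_bind[OF sets_kernel[OF k']]) auto
    then show "sets M2 = sigma_sets UNIV (range atMost)"
      by (simp add: \<mu> borel_eq_atMost)
    show "(\<Union>i. {..real i}) = UNIV" by (auto intro: real_arch_simple)
    show "emeasure M1 {..real i} \<noteq> \<infinity>" for i
      by (subst M1) (auto simp: \<mu>)
    fix X :: "real set" assume "X \<in> range atMost"
    then obtain t where X: "X = {..t}" by auto
    show "emeasure M1 X = emeasure M2 X"
      using sd[of t] B by (simp add: X M1 M2 \<mu> section_density_def)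
  qed auto
  then show "emeasure \<pi> (A \<times> B) = (\<integral>\<^sup>+y\<in>B. emeasure (k y) A \<partial>\<nu>)"
    using M1[OF A] M2[OF A] by simp
qed

text \<open>
  The conditional distribution function: for rational \<open>q\<close> take a density of
  \<open>B \<mapsto> \<pi> ({..q} \<times> B)\<close>.  Densities for different \<open>q\<close> are comparable only almost everywhere, but
  taking suprema over smaller rationals and then infima over larger ones produces, for every single
  \<open>y\<close>, a monotone right-continuous function of \<open>t\<close>, so that no exceptional set has to be removed;
  almost everywhere it agrees with the density it came from.  Mass in the unit interval makes the
  limits at both infinities trivial.
\<close>

lemma disintegration_unit_interval:
  fixes \<mu> :: "real measure"
  assumes \<pi>: "\<pi> \<in> couplings \<mu> \<nu>" and \<mu>: "sets \<mu> = sets borel" and supp: "emeasure \<mu> {0..1} = 1"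
  shows "\<exists>k. is_disintegration_snd \<mu> \<nu> \<pi> k"
proof -
  interpret P: prob_space \<pi> by (rule couplingsD[OF \<pi>])
  interpret N: prob_space \<nu> by (rule couplingsD[OF \<pi>])
  interpret M: prob_space \<mu> by (rule couplingsD[OF \<pi>])
  have sp\<mu>: "space \<mu> = UNIV" using sets_eq_imp_space_eq[OF \<mu>] by simp
  have rect: "A \<times> B \<in> sets \<pi>" if "A \<in> sets borel" "B \<in> sets \<nu>" for A B
    using that by (simp add: couplingsD[OF \<pi>] \<mu>)
  have "\<exists>f. section_density \<nu> \<pi> {..t} f \<and> (\<forall>y. f y \<le> 1)" for t
    using section_density_exists[OF \<pi>, of "{..t}"] atMost_borel[of t] unfolding \<mu> by metis
  then obtain D where D: "\<And>t. section_density \<nu> \<pi> {..t} (D t)" and D1: "\<And>t y. D t y \<le> 1" by metis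
  have low: "emeasure \<mu> {..q} = 0" if "q < 0" for q
  proof -
    have "M.prob {..q} + M.prob {0..1} = M.prob ({..q} \<union> {0..1})"
      using that \<mu> by (intro M.finite_measure_Union[symmetric]) auto
    also have "\<dots> \<le> 1" by (rule M.prob_le_1)
    finally have "M.prob {..q} \<le> 0" using supp by (simp add: measure_def)
    then show ?thesis by (simp add: M.emeasure_eq_measure measure_le_0_iff)
  qed
  have high: "emeasure \<mu> {..q} = 1" if "q \<ge> 1" for q
  proof -
    have "emeasure \<mu> {0..1} \<le> emeasure \<mu> {..q}"
      using that \<mu> by (intro emeasure_mono) auto
    then show ?thesis using M.measure_le_1[of "{..q}"] supp by (intro antisym) simp_all
  qed
  \<comment> \<open>Outside the unit interval the density is constant almost everywhere; fixing its value there makes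
    the final distribution function constant outside a bounded interval for every \<open>y\<close>.\<close>
  define g where "g r y = (if r < 0 then 0 else if r \<ge> 1 then 1 else D r y)" for r y
  have g[measurable]: "g r \<in> borel_measurable \<nu>" for r
    using D[of r] unfolding g_def section_density_def
    by (cases "r < 0"; cases "r \<ge> 1") simp_all
  have sdg: "section_density \<nu> \<pi> {..r} (g r)" for r
  proof -
    consider "r < 0" | "0 \<le> r" "r < 1" | "1 \<le> r" by linarith
    then show ?thesis
    proof cases
      case 1
      have "emeasure \<pi> ({..r} \<times> B) = 0" if "B \<in> sets \<nu>" for B
      proof -
        have "emeasure \<pi> ({..r} \<times> B) \<le> emeasure \<pi> ({..r} \<times> space \<nu>)"
          using sets.sets_into_space[OF that] by (intro emeasure_mono rect) auto
        also have "\<dots> = 0" using coupling_emeasure_fst[OF \<pi>, of "{..r}"] low[OF 1] \<mu> by simp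
        finally show ?thesis by simp
      qed
      then show ?thesis using 1 g[of r] by (simp add: section_density_def g_def)
    next
      case 2
      then have "g r = D r" by (simp add: g_def fun_eq_iff)
      then show ?thesis using D by simp
    next
      case 3
      have "emeasure \<pi> ({..r} \<times> B) = emeasure \<nu> B" if B: "B \<in> sets \<nu>" for B
      proof -
        have "emeasure \<pi> ({..r} \<times> space \<nu>) = 1"
          using coupling_emeasure_fst[OF \<pi>, of "{..r}"] high[OF 3] \<mu> by simp
        then have "AE x in \<pi>. x \<in> {..r} \<times> space \<nu>"
          using rect[of "{..r}" "space \<nu>"] by (intro P.AE_in_set_eq_1[THEN iffD2]) (auto simp: P.emeasure_eq_measure)
        then have "emeasure \<pi> ({..r} \<times> B) = emeasure \<pi> (space \<mu> \<times> B)"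
          using rect B by (intro emeasure_eq_AE) (auto simp: sp\<mu>)
        then show ?thesis using coupling_emeasure_snd[OF \<pi> B] by simp
      qed
      then show ?thesis using 3 g[of r] by (simp add: section_density_def g_def)
    qed
  qed
  have g1: "g r y \<le> 1" for r y using D1 by (auto simp: g_def)
  define Fm where "Fm q y = (SUP r\<in>{r\<in>\<rat>. r \<le> q}. g r y)" for q y
  define Fi where "Fi t y = (INF q\<in>{q\<in>\<rat>. t < q}. Fm q y)" for t y
  define F where "F t y = enn2real (Fi t y)" for t y
  have cQ: "countable {r::real. r \<in> \<rat> \<and> R r}" for R
    by (rule countable_subset[OF _ countable_rat]) auto
  have [measurable]: "Fm q \<in> borel_measurable \<nu>" for q
    unfolding Fm_def by (intro borel_measurable_SUP cQ) auto
  have [measurable]: "Fi t \<in> borel_measurable \<nu>" for t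
    unfolding Fi_def by (intro borel_measurable_INF cQ) auto
  have Fm_mono: "Fm q y \<le> Fm q' y" if "q \<le> q'" for q q' y
    unfolding Fm_def by (rule SUP_subset_mono) (use that in auto)
  have Fi_mono: "Fi t y \<le> Fi t' y" if "t \<le> t'" for t t' y
    unfolding Fi_def by (rule INF_superset_mono) (use that in auto)
  have Fm1: "Fm q y \<le> 1" for q y unfolding Fm_def by (rule SUP_least) (rule g1)
  have Fi_le: "Fi t y \<le> Fm q y" if tq: "t < q" for t q y
  proof -
    obtain q' where q': "q' \<in> \<rat>" "t < q'" "q' < q" using Rats_dense_in_real[OF tq] by auto
    have "Fi t y \<le> Fm q' y" unfolding Fi_def by (rule INF_lower) (use q' in auto)
    also have "\<dots> \<le> Fm q y" by (rule Fm_mono) (use q' in simp)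
    finally show ?thesis .
  qed
  have Fi1: "Fi t y \<le> 1" for t y
    using Fi_le[of t "t+1" y] Fm1[of "t+1" y] by (rule order_trans) simp
  have eF: "ennreal (F t y) = Fi t y" for t y
    unfolding F_def using Fi1[of t y] by (intro ennreal_enn2real) (rule le_less_trans, auto)
  have F_mono: "F t y \<le> F t' y" if "t \<le> t'" for t t' y
    unfolding F_def using Fi_mono[OF that, of y] Fi1[of t' y]
    by (intro enn2real_mono) (assumption, rule le_less_trans, auto)
  have F0: "F t y = 0" if "t < -1" for t y
  proof -
    have "Fm (-1) y \<le> 0" unfolding Fm_def by (rule SUP_least) (auto simp: g_def)
    then have "Fi t y \<le> 0" using Fi_le[OF that, of y] by simp
    then show ?thesis by (simp add: F_def)
  qed
  have F1: "F t y = 1" if "t \<ge> 1" for t y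
  proof -
    have "1 \<le> Fi t y" unfolding Fi_def
    proof (rule INF_greatest)
      fix q assume "q \<in> {q \<in> \<rat>. t < q}"
      then have "g 1 y \<le> Fm q y" unfolding Fm_def using that by (intro SUP_upper) auto
      then show "1 \<le> Fm q y" by (simp add: g_def)
    qed
    then have "Fi t y = 1" using Fi1[of t y] by simp
    then show ?thesis by (simp add: F_def)
  qed
  have F_rc: "continuous (at_right t) (\<lambda>t. F t y)" for t y
    unfolding continuous_within
  proof (rule order_tendstoI)
    fix a assume "a < F t y"
    then have "a < F s y" if "t < s" for s
      using F_mono[of t s y] that by simp
    then show "\<forall>\<^sub>F s in at_right t. a < F s y"
      unfolding eventually_at_right_field by (intro exI[of _ "t+1"]) simp
  next
    fix a assume a: "F t y < a"
    have "0 \<le> F t y" by (simp add: F_def)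
    then have "Fi t y < ennreal a" using a by (simp flip: eF add: ennreal_less_iff)
    then obtain q where q: "t < q" "Fm q y < ennreal a" unfolding Fi_def INF_less_iff by auto
    have "F s y < a" if "t < s" "s < q" for s
    proof -
      have "ennreal (F s y) < ennreal a" using le_less_trans[OF Fi_le[OF that(2), of y] q(2)] by (simp add: eF)
      then show ?thesis by (simp add: F_def ennreal_less_iff)
    qed
    then show "\<forall>\<^sub>F s in at_right t. F s y < a"
      unfolding eventually_at_right_field using q(1) by (intro exI[of _ q]) simp
  qed
  have F_bot: "((\<lambda>t. F t y) \<longlongrightarrow> 0) at_bot" for y
    by (rule tendsto_eventually) (use F0 in \<open>auto simp: eventually_at_bot_dense\<close>)
  have F_top: "((\<lambda>t. F t y) \<longlongrightarrow> 1) at_top" for y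
    by (rule tendsto_eventually) (use F1 in \<open>auto simp: eventually_at_top_linorder\<close>)
  define k where "k y = interval_measure (\<lambda>t. F t y)" for y
  have k_atMost: "emeasure (k y) {..t} = Fi t y" for y t
    unfolding k_def by (subst emeasure_interval_measure_Iic[OF F_mono F_rc F_bot]) (auto simp: eF)
  have k: "k \<in> \<nu> \<rightarrow>\<^sub>M prob_algebra \<mu>"
  proof (rule measurable_prob_algebra_generated[where \<Omega>=UNIV and G="range atMost"])
    show "sets \<mu> = sigma_sets UNIV (range atMost)" by (simp add: \<mu> borel_eq_atMost)
    show "Int_stable (range (atMost::real \<Rightarrow> _))" by (auto simp: Int_stable_def)
    show "prob_space (k a)" for a
      unfolding k_def using real_distribution_interval_measure[OF F_mono F_rc F_bot F_top]
      by (simp add: real_distribution_def)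
    show "sets (k a) = sets \<mu>" for a by (simp add: k_def \<mu>)
    show "(\<lambda>a. emeasure (k a) A) \<in> borel_measurable \<nu>" if "A \<in> range atMost" for A
      using that by (auto simp: k_atMost)
  qed auto
  have sdm: "AE y in \<nu>. g r y \<le> g q y" if "r \<le> q" for r q
    by (rule section_density_mono[OF \<pi> _ _ sdg sdg]) (use that in \<open>auto simp: \<mu>\<close>)
  \<comment> \<open>Both inequalities: \<open>Fi t\<close> lies above the density at \<open>t\<close> and below the densities at all rational
    \<open>q > t\<close>, whose integrals decrease to the one at \<open>t\<close>.\<close>
  have "section_density \<nu> \<pi> {..t} (Fi t)" for t
    unfolding section_density_def
  proof (intro conjI ballI antisym)
    fix B assume B: "B \<in> sets \<nu>"
    have "AE y in \<nu>. \<forall>q\<in>{q\<in>\<rat>. t < q}. g t y \<le> g q y"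
      unfolding AE_ball_countable[OF cQ] using sdm by auto
    then have "AE y in \<nu>. g t y \<le> Fi t y"
    proof eventually_elim
      case (elim y)
      show ?case unfolding Fi_def
      proof (rule INF_greatest)
        fix q assume q: "q \<in> {q \<in> \<rat>. t < q}"
        then have "g q y \<le> Fm q y" unfolding Fm_def by (intro SUP_upper) auto
        then show "g t y \<le> Fm q y" using elim q order_trans by blast
      qed
    qed
    then have "(\<integral>\<^sup>+y\<in>B. g t y \<partial>\<nu>) \<le> (\<integral>\<^sup>+y\<in>B. Fi t y \<partial>\<nu>)"
      by (intro nn_integral_mono_AE) (auto elim!: eventually_mono intro: mult_right_mono)
    then show "emeasure \<pi> ({..t} \<times> B) \<le> (\<integral>\<^sup>+y\<in>B. Fi t y \<partial>\<nu>)"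
      using sdg[of t] B by (simp add: section_density_def)
    have upper: "(\<integral>\<^sup>+y\<in>B. Fi t y \<partial>\<nu>) \<le> emeasure \<pi> ({..t'} \<times> B)" if t': "t < t'" for t'
    proof -
      obtain q where q: "q \<in> \<rat>" "t < q" "q < t'" using Rats_dense_in_real[OF t'] by auto
      have "AE y in \<nu>. \<forall>r\<in>{r\<in>\<rat>. r \<le> q}. g r y \<le> g q y"
        unfolding AE_ball_countable[OF cQ] using sdm by auto
      then have "AE y in \<nu>. Fi t y \<le> g q y"
      proof eventually_elim
        case (elim y)
        then have "Fm q y \<le> g q y" unfolding Fm_def by (intro SUP_least) auto
        then show ?case using Fi_le[OF q(2), of y] by simp
      qed
      then have "(\<integral>\<^sup>+y\<in>B. Fi t y \<partial>\<nu>) \<le> (\<integral>\<^sup>+y\<in>B. g q y \<partial>\<nu>)"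
        by (intro nn_integral_mono_AE) (auto elim!: eventually_mono intro: mult_right_mono)
      also have "\<dots> = emeasure \<pi> ({..q} \<times> B)" using sdg[of q] B by (simp add: section_density_def)
      also have "\<dots> \<le> emeasure \<pi> ({..t'} \<times> B)"
        using q B by (intro emeasure_mono rect) auto
      finally show ?thesis .
    qed
    have "(\<integral>\<^sup>+y\<in>B. Fi t y \<partial>\<nu>) \<le> (INF n. emeasure \<pi> ({..t + 1 / real (Suc n)} \<times> B))"
      by (intro INF_greatest upper) auto
    also have "\<dots> = emeasure \<pi> (\<Inter>n. {..t + 1 / real (Suc n)} \<times> B)"
    proof (rule INF_emeasure_decseq)
      show "range (\<lambda>n. {..t + 1 / real (Suc n)} \<times> B) \<subseteq> sets \<pi>" using B rect by auto
      show "decseq (\<lambda>n. {..t + 1 / real (Suc n)} \<times> B)"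
        by (intro decseq_SucI Sigma_mono) (auto simp: field_simps intro: order_trans)
    qed simp
    also have "(\<Inter>n. {..t + 1 / real (Suc n)} \<times> B) = {..t} \<times> B"
    proof -
      have "x \<le> t" if "\<And>n. x \<le> t + 1 / real (Suc n)" for x
      proof (rule field_le_epsilon)
        fix e :: real assume "0 < e"
        then obtain n where "1 / real (Suc n) < e" using nat_approx_posE by blast
        then show "x \<le> t + e" using that[of n] by simp
      qed
      then show ?thesis by (auto intro: add_increasing2)
    qed
    finally show "(\<integral>\<^sup>+y\<in>B. Fi t y \<partial>\<nu>) \<le> emeasure \<pi> ({..t} \<times> B)" .
  qed simp
  then have "is_disintegration_snd \<mu> \<nu> \<pi> k"
    by (intro disintegration_extend[OF \<pi> \<mu> k]) (simp add: k_atMost)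
  then show ?thesis by blast
qed

text \<open>
  Almost all of the space can be read off from a real number in a measurable way.  The requirement is
  on the measure and not on the space, which keeps Borel isomorphism theorems out of the picture.
\<close>

definition real_coded :: "'a measure \<Rightarrow> bool" where
  "real_coded \<mu> \<longleftrightarrow> prob_space \<mu> \<and>
     (\<exists>f g. f \<in> borel_measurable \<mu> \<and> g \<in> borel \<rightarrow>\<^sub>M \<mu> \<and> range f \<subseteq> {0..1::real} \<and> (AE x in \<mu>. g (f x) = x))"

text \<open>
  Push the coupling forward along the code, disintegrate it over the unit interval, and pull the
  conditional measures back along the decoding.
\<close>

lemma disintegration_snd_exists:
  assumes \<pi>: "\<pi> \<in> couplings \<mu> \<nu>" and \<mu>: "real_coded \<mu>"
  shows "\<exists>k. is_disintegration_snd \<mu> \<nu> \<pi> k"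
proof -
  interpret P: prob_space \<pi> by (rule couplingsD[OF \<pi>])
  interpret N: prob_space \<nu> by (rule couplingsD[OF \<pi>])
  interpret M: prob_space \<mu> by (rule couplingsD[OF \<pi>])
  note [measurable] = couplingsD(4,5)[OF \<pi>]
  from \<mu> obtain f g where f[measurable]: "f \<in> borel_measurable \<mu>" and g[measurable]: "g \<in> borel \<rightarrow>\<^sub>M \<mu>"
    and f01: "range f \<subseteq> {0..1::real}" and gf: "AE x in \<mu>. g (f x) = x"
    unfolding real_coded_def by blast
  define \<mu>' where "\<mu>' = distr \<mu> borel f"
  define \<pi>' where "\<pi>' = distr \<pi> (\<mu>' \<Otimes>\<^sub>M \<nu>) (\<lambda>(x, y). (f x, y))"
  have sets\<mu>': "sets \<mu>' = sets borel" by (simp add: \<mu>'_def)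
  have h[measurable]: "(\<lambda>(x, y). (f x, y)) \<in> \<pi> \<rightarrow>\<^sub>M \<mu>' \<Otimes>\<^sub>M \<nu>"
    by (subst measurable_cong_sets[OF couplingsD(2)[OF \<pi>] refl])
       (simp add: \<mu>'_def cong: measurable_cong_sets sets_pair_measure_cong)
  have \<pi>'_rect: "emeasure \<pi>' (A \<times> B) = emeasure \<pi> ((f -` A \<inter> space \<mu>) \<times> B)"
    if "A \<in> sets borel" "B \<in> sets \<nu>" for A B
  proof -
    have "(\<lambda>(x, y). (f x, y)) -` (A \<times> B) \<inter> space \<pi> = (f -` A \<inter> space \<mu>) \<times> B"
      using sets.sets_into_space[OF that(2)] by (auto simp: couplingsD[OF \<pi>])
    then show ?thesis unfolding \<pi>'_def using that
      by (subst emeasure_distr[OF h]) (auto simp: sets\<mu>')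
  qed
  have \<pi>': "\<pi>' \<in> couplings \<mu>' \<nu>"
  proof (rule couplingsI)
    show "prob_space \<pi>'" unfolding \<pi>'_def by (rule P.prob_space_distr[OF h])
    show "emeasure \<pi>' (A \<times> space \<nu>) = emeasure \<mu>' A" if "A \<in> sets \<mu>'" for A
      using that coupling_emeasure_fst[OF \<pi>, of "f -` A \<inter> space \<mu>"]
      by (simp add: \<pi>'_rect sets\<mu>') (simp add: \<mu>'_def emeasure_distr)
    show "emeasure \<pi>' (space \<mu>' \<times> B) = emeasure \<nu> B" if "B \<in> sets \<nu>" for B
      using that coupling_emeasure_snd[OF \<pi>, of B] \<pi>'_rect[of UNIV B]
      by (simp add: \<mu>'_def)
  qed (simp add: \<pi>'_def)
  have "emeasure \<mu>' {0..1} = 1"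
  proof -
    have "f -` {0..1} \<inter> space \<mu> = space \<mu>" using f01 by auto
    then show ?thesis by (simp add: \<mu>'_def emeasure_distr M.emeasure_space_1)
  qed
  from disintegration_unit_interval[OF \<pi>' sets\<mu>' this]
  obtain k' where k': "is_disintegration_snd \<mu>' \<nu> \<pi>' k'" by blast
  have k'_m: "k' \<in> \<nu> \<rightarrow>\<^sub>M prob_algebra \<mu>'" using k' by (simp add: is_disintegration_snd_def)
  have g': "g \<in> \<mu>' \<rightarrow>\<^sub>M \<mu>" using g by (simp add: \<mu>'_def)
  define k where "k y = distr (k' y) \<mu> g" for y
  have "is_disintegration_snd \<mu> \<nu> \<pi> k"
    unfolding is_disintegration_snd_def
  proof (intro conjI ballI)
    show "k \<in> \<nu> \<rightarrow>\<^sub>M prob_algebra \<mu>"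
      unfolding k_def by (rule measurable_compose[OF k'_m measurable_distr_prob_space[OF g']])
    fix A B assume A[measurable]: "A \<in> sets \<mu>" and B[measurable]: "B \<in> sets \<nu>"
    have gA: "g -` A \<in> sets borel" using measurable_sets[OF g A] by simp
    have "(\<integral>\<^sup>+y\<in>B. emeasure (k y) A \<partial>\<nu>) = (\<integral>\<^sup>+y\<in>B. emeasure (k' y) (g -` A) \<partial>\<nu>)"
    proof (intro nn_integral_cong arg_cong2[where f=times] refl)
      fix y assume "y \<in> space \<nu>"
      then have s: "sets (k' y) = sets \<mu>'"
        using measurable_space[OF k'_m] by (auto simp: space_prob_algebra)
      then have "g \<in> k' y \<rightarrow>\<^sub>M \<mu>" using g' by (simp cong: measurable_cong_sets)
      moreover have "space (k' y) = UNIV" using sets_eq_imp_space_eq[OF s] by (simp add: \<mu>'_def)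
      ultimately show "emeasure (k y) A = emeasure (k' y) (g -` A)"
        by (simp add: k_def emeasure_distr)
    qed
    also have "\<dots> = emeasure \<pi>' (g -` A \<times> B)"
      using k' gA B by (simp add: is_disintegration_snd_def sets\<mu>')
    also have "\<dots> = emeasure \<pi> ((f -` (g -` A) \<inter> space \<mu>) \<times> B)"
      by (rule \<pi>'_rect[OF gA B])
    also have "\<dots> = emeasure \<pi> (A \<times> B)"
    proof (rule emeasure_eq_AE)
      have "AE x in distr \<pi> \<mu> fst. g (f x) = x" unfolding couplingsD(6)[OF \<pi>] by (rule gf)
      then have "AE z in \<pi>. g (f (fst z)) = fst z" by (rule AE_distrD[rotated]) measurable
      then show "AE z in \<pi>. z \<in> (f -` (g -` A) \<inter> space \<mu>) \<times> B \<longleftrightarrow> z \<in> A \<times> B"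
        using sets.sets_into_space[OF A] by (auto elim!: eventually_mono)
      have "f -` (g -` A) \<inter> space \<mu> \<in> sets \<mu>" using gA by measurable
      then show "(f -` (g -` A) \<inter> space \<mu>) \<times> B \<in> sets \<pi>" "A \<times> B \<in> sets \<pi>"
        using A B by (auto simp: couplingsD[OF \<pi>])
    qed
    finally show "emeasure \<pi> (A \<times> B) = (\<integral>\<^sup>+y\<in>B. emeasure (k y) A \<partial>\<nu>)" by simp
  qed
  then show ?thesis by blast
qed

definition swap_measure :: "'a measure \<Rightarrow> 'b measure \<Rightarrow> ('a \<times> 'b) measure \<Rightarrow> ('b \<times> 'a) measure" where
  "swap_measure \<mu> \<nu> \<pi> = distr \<pi> (\<nu> \<Otimes>\<^sub>M \<mu>) (\<lambda>(x, y). (y, x))"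

lemma swap_coupling:
  assumes \<pi>: "\<pi> \<in> couplings \<mu> \<nu>"
  shows "swap_measure \<mu> \<nu> \<pi> \<in> couplings \<nu> \<mu>"
    and "A \<in> sets \<mu> \<Longrightarrow> B \<in> sets \<nu> \<Longrightarrow> emeasure (swap_measure \<mu> \<nu> \<pi>) (B \<times> A) = emeasure \<pi> (A \<times> B)"
proof -
  have h: "(\<lambda>(x, y). (y, x)) \<in> \<pi> \<rightarrow>\<^sub>M \<nu> \<Otimes>\<^sub>M \<mu>"
    by (subst measurable_cong_sets[OF couplingsD(2)[OF \<pi>] refl]) measurable
  show rect: "emeasure (swap_measure \<mu> \<nu> \<pi>) (B \<times> A) = emeasure \<pi> (A \<times> B)"
    if "A \<in> sets \<mu>" "B \<in> sets \<nu>" for A B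
  proof -
    have "(\<lambda>(x, y). (y, x)) -` (B \<times> A) \<inter> space \<pi> = A \<times> B"
      using that[THEN sets.sets_into_space] by (auto simp: couplingsD[OF \<pi>])
    then show ?thesis using that by (simp add: swap_measure_def emeasure_distr[OF h])
  qed
  show "swap_measure \<mu> \<nu> \<pi> \<in> couplings \<nu> \<mu>"
  proof (rule couplingsI)
    show "prob_space (swap_measure \<mu> \<nu> \<pi>)"
      unfolding swap_measure_def by (rule prob_space.prob_space_distr[OF couplingsD(1)[OF \<pi>] h])
    show "sets (swap_measure \<mu> \<nu> \<pi>) = sets (\<nu> \<Otimes>\<^sub>M \<mu>)" by (simp add: swap_measure_def)
  qed (auto simp: rect coupling_emeasure_fst[OF \<pi>] coupling_emeasure_snd[OF \<pi>])
qed

lemma disintegration_fst_exists: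
  assumes \<pi>: "\<pi> \<in> couplings \<mu> \<nu>" and \<nu>: "real_coded \<nu>"
  shows "\<exists>k. is_disintegration_fst \<mu> \<nu> \<pi> k"
  using disintegration_snd_exists[OF swap_coupling(1)[OF \<pi>] \<nu>] swap_coupling(2)[OF \<pi>]
  by (auto simp: is_disintegration_snd_def is_disintegration_fst_def)

definition ternary :: "(nat \<Rightarrow> bool) \<Rightarrow> real" where
  "ternary a = (\<Sum>n. (1/3) ^ Suc n * of_bool (a n))"

lemma ternary_summable: "summable (\<lambda>n. (1/3::real) ^ Suc n * of_bool (a n))"
proof (rule summable_comparison_test)
  show "\<exists>N. \<forall>n\<ge>N. norm ((1/3::real) ^ Suc n * of_bool (a n)) \<le> (1/3) ^ n"
    by (auto simp: of_bool_def power_mult_distrib)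
  show "summable (\<lambda>n. (1/3::real) ^ n)" by (rule summable_geometric) simp
qed

lemma ternary_Suc: "ternary a = (of_bool (a 0) + ternary (\<lambda>n. a (Suc n))) / 3"
proof -
  have "ternary a = (\<Sum>n. (1/3) ^ Suc (Suc n) * of_bool (a (Suc n))) + (1/3) * of_bool (a 0)"
    unfolding ternary_def using suminf_split_head[OF ternary_summable[of a]] by simp
  also have "(\<Sum>n. (1/3::real) ^ Suc (Suc n) * of_bool (a (Suc n))) = (1/3) * ternary (\<lambda>n. a (Suc n))"
    unfolding ternary_def by (subst suminf_mult[OF ternary_summable, symmetric]) (simp add: ac_simps)
  finally show ?thesis by simp
qed

lemma ternary_bounds: "0 \<le> ternary a" "ternary a \<le> 1/2"
proof -
  show "0 \<le> ternary a" unfolding ternary_def by (intro suminf_nonneg ternary_summable) auto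
  have "ternary a \<le> (\<Sum>n. (1/3) ^ Suc n)"
    unfolding ternary_def
    by (intro suminf_le ternary_summable) (auto intro!: summable_mult summable_geometric)
  also have "\<dots> = 1/2" using suminf_mult[of "\<lambda>n. (1/3::real) ^ n" "1/3"] suminf_geometric[of "1/3::real"] by simp
  finally show "ternary a \<le> 1/2" .
qed

text \<open>
  A leading digit \<open>1\<close> contributes \<open>1/3\<close>, while all later digits together contribute at most \<open>1/6\<close>.
\<close>

lemma ternary_inj: "ternary a = ternary b \<Longrightarrow> a n = b n"
proof (induction n arbitrary: a b)
  case 0
  show ?case
    using 0 ternary_bounds[of "\<lambda>n. a (Suc n)"] ternary_bounds[of "\<lambda>n. b (Suc n)"]
    by (cases "a 0"; cases "b 0") (auto simp: ternary_Suc[of a] ternary_Suc[of b])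
next
  case (Suc n)
  have "ternary (\<lambda>n. a (Suc n)) = ternary (\<lambda>n. b (Suc n))"
    using Suc.prems ternary_bounds[of "\<lambda>n. a (Suc n)"] ternary_bounds[of "\<lambda>n. b (Suc n)"]
    by (cases "a 0"; cases "b 0") (auto simp: ternary_Suc[of a] ternary_Suc[of b])
  from Suc.IH[OF this] show ?case .
qed

lemma ternary_close: "(\<And>k. k < n \<Longrightarrow> a k = b k) \<Longrightarrow> \<bar>ternary a - ternary b\<bar> \<le> (1/3) ^ n"
proof (induction n arbitrary: a b)
  case 0
  show ?case using ternary_bounds[of a] ternary_bounds[of b] by auto
next
  case (Suc n)
  have "ternary a - ternary b = (ternary (\<lambda>n. a (Suc n)) - ternary (\<lambda>n. b (Suc n))) / 3"
    using Suc.prems[of 0] by (simp add: ternary_Suc[of a] ternary_Suc[of b] diff_divide_distrib add_divide_distrib)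
  moreover have "\<bar>ternary (\<lambda>n. a (Suc n)) - ternary (\<lambda>n. b (Suc n))\<bar> \<le> (1/3) ^ n"
    using Suc.prems by (intro Suc.IH) simp
  ultimately show ?case by (simp add: abs_divide del: divide_minus_left right_diff_distrib_numeral left_diff_distrib_numeral eq_divide_eq_numeral1)
qed

lemma space_borel_of: "space (borel_of X) = topspace X"
  unfolding borel_of_def by (rule space_measure_of) (auto dest: openin_subset)

lemma sets_borel_of: "sets (borel_of X) = sigma_sets (topspace X) {U. openin X U}"
  unfolding borel_of_def by (rule sets_measure_of) (auto dest: openin_subset)

lemma openin_borel_of: "openin X U \<Longrightarrow> U \<in> sets (borel_of X)"
  unfolding sets_borel_of by auto

lemma closedin_borel_of: 
  assumes "closedin X C" shows "C \<in> sets (borel_of X)"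
proof -
  have "topspace X - (topspace X - C) \<in> sets (borel_of X)"
    using assms sets.top[of "borel_of X"] by (intro sets.Diff openin_borel_of) (auto simp: space_borel_of)
  moreover have "topspace X - (topspace X - C) = C"
    using closedin_subset[OF assms] by auto
  ultimately show ?thesis by simp
qed

lemma measurable_borel_of:
  assumes "f \<in> space M \<rightarrow> topspace X" "\<And>U. openin X U \<Longrightarrow> f -` U \<inter> space M \<in> sets M"
  shows "f \<in> M \<rightarrow>\<^sub>M borel_of X"
  unfolding borel_of_def by (rule measurable_measure_of) (use assms in \<open>auto dest: openin_subset\<close>)

text \<open>
  The code \<open>x \<mapsto> (x \<in> U n)\<close> is discontinuous only because the \<open>U n\<close> have boundaries.  On a set \<open>K\<close>
  where each \<open>U n\<close> is also relatively closed it is continuous, so that compact sets have compact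
  images.
\<close>

lemma ternary_code_on_closed_set:
  assumes X: "compact_space X" and K: "closedin X K"
    and U: "\<And>n. openin X (U n)" and F: "\<And>n. closedin X (F n)" and UK: "\<And>n. U n \<inter> K = F n \<inter> K"
    and C: "closedin X C"
  shows "compact ((\<lambda>x. ternary (\<lambda>n. x \<in> U n)) ` (K \<inter> C))"
proof -
  let ?f = "\<lambda>x. ternary (\<lambda>n. x \<in> U n)"
  have top: "topspace (subtopology X K) = K" using closedin_subset[OF K] by auto
  have "continuous_map (subtopology X K) euclidean ?f"
    unfolding Met_TC.continuous_map_to_metric[unfolded mtopology_is_euclidean]
  proof (intro ballI allI impI)
    fix x and e :: real assume x: "x \<in> topspace (subtopology X K)" and e: "0 < e"
    obtain n where n: "(1/3) ^ n < e" using e real_arch_pow_inv[of e "1/3"] by auto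
    define V where "V k = (if x \<in> U k then U k \<inter> K else K - F k)" for k
    have V: "openin (subtopology X K) (V k)" for k
    proof (cases "x \<in> U k")
      case True
      then show ?thesis unfolding V_def using U[of k] by (auto simp: openin_subtopology)
    next
      case False
      have "K - F k = (topspace X - F k) \<inter> K" using closedin_subset[OF K] by auto
      then show ?thesis unfolding V_def using False F[of k] by (auto simp: openin_subtopology)
    qed
    define W where "W = K \<inter> (\<Inter>k\<in>{..<n}. V k)"
    have W1: "openin (subtopology X K) W"
      unfolding W_def 
    proof (cases "n = 0")
      case True
      then show "openin (subtopology X K) (K \<inter> (\<Inter>k\<in>{..<n}. V k))"
        using openin_topspace[of "subtopology X K"] unfolding top by simp
    next
      case False
      then have "openin (subtopology X K) (\<Inter>k\<in>{..<n}. V k)" using V by (intro openin_Inter) auto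
      then show "openin (subtopology X K) (K \<inter> (\<Inter>k\<in>{..<n}. V k))"
        using openin_topspace[of "subtopology X K"] unfolding top by (intro openin_Int)
    qed
    have xK: "x \<in> K" using x top by simp
    then have W2: "x \<in> W" unfolding W_def V_def using UK by auto
    have W3: "?f y \<in> Met_TC.mball (?f x) e" if y: "y \<in> W" for y
    proof -
      have "(x \<in> U k) = (y \<in> U k)" if "k < n" for k
      proof -
        have "y \<in> K" "y \<in> V k" using y that by (auto simp: W_def)
        then show ?thesis using UK[of k] unfolding V_def by (cases "x \<in> U k") auto
      qed
      then have "\<bar>?f x - ?f y\<bar> \<le> (1/3) ^ n" by (rule ternary_close)
      then show ?thesis using n by (simp add: dist_real_def)
    qed
    show "\<exists>W. openin (subtopology X K) W \<and> x \<in> W \<and> (\<forall>y\<in>W. ?f y \<in> Met_TC.mball (?f x) e)"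
      using W1 W2 W3 by blast
  qed
  moreover have "compactin (subtopology X K) (K \<inter> C)"
    using closedin_compact_space[OF X closedin_Int[OF K C]] by (auto simp: compactin_subtopology)
  ultimately have "compactin euclidean (?f ` (K \<inter> C))"
    by (rule image_compactin[rotated])
  then show ?thesis by simp
qed

lemma closed_inner_approx:
  assumes X: "metrizable_space X" and \<mu>: "prob_space \<mu>" "sets \<mu> = sets (borel_of X)"
    and U: "openin X U" and e: "0 < e"
  shows "\<exists>F. closedin X F \<and> F \<subseteq> U \<and> measure \<mu> (U - F) < e"
proof -
  interpret prob_space \<mu> by fact
  obtain C where C: "\<And>n. closedin X (C n)" "\<And>n. C n \<subseteq> C (Suc n)" "\<Union> (range C) = U"
    using open_imp_fsigma_in[OF X U] unfolding fsigma_in_ascending by auto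
  have m: "C n \<in> sets \<mu>" "U \<in> sets \<mu>" for n
    using C(1) U by (auto simp: \<mu> closedin_borel_of openin_borel_of)
  have "(\<lambda>n. measure \<mu> (C n)) \<longlonglongrightarrow> measure \<mu> (\<Union>n. C n)"
    using m C(2) by (intro finite_Lim_measure_incseq incseq_SucI) auto
  then have "\<forall>\<^sub>F n in sequentially. measure \<mu> U - e < measure \<mu> (C n)"
    using e C(3) by (intro order_tendstoD(1)) auto
  then obtain n where "measure \<mu> U - e < measure \<mu> (C n)" by (auto simp: eventually_sequentially)
  moreover have "measure \<mu> (U - C n) = measure \<mu> U - measure \<mu> (C n)"
    using C(3) m by (intro finite_measure_Diff) auto
  ultimately show ?thesis using C by (intro exI[of _ "C n"]) auto
qed

text \<open>
  Code a point by the members of a countable base that contain it.  This is injective, and what has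
  to be shown is that the inverse is measurable up to a null set.  Shrink every basic set \<open>U n\<close> to a
  closed \<open>F n m\<close> and let \<open>K m\<close> consist of the points that lie in no \<open>U n - F n m\<close>.  On \<open>K m\<close> the basic
  sets are clopen, hence closed subsets of \<open>K m\<close> have compact, in particular Borel, codes.  The
  measures of the \<open>U n - F n m\<close> sum to at most \<open>2 * (1/2) ^ m\<close>, so the sets \<open>K m\<close> exhaust the space up
  to a null set.
\<close>

lemma compact_polish_real_coded:
  assumes X: "compact_space X" "polish X" and \<mu>: "prob_space \<mu>" "sets \<mu> = sets (borel_of X)"
  shows "real_coded \<mu>"
proof -
  interpret prob_space \<mu> by fact
  have met: "metrizable_space X"
    using X(2) by (auto simp: polish_def completely_metrizable_imp_metrizable_space)
  have sp: "space \<mu> = topspace X" using sets_eq_imp_space_eq[OF \<mu>(2)] by (simp add: space_borel_of)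
  obtain \<B> where B: "countable \<B>" "\<And>V. V \<in> \<B> \<Longrightarrow> openin X V"
    "\<And>U x. openin X U \<Longrightarrow> x \<in> U \<Longrightarrow> \<exists>V\<in>\<B>. x \<in> V \<and> V \<subseteq> U"
    using X(2) unfolding polish_def second_countable_def by metis
  define U where "U = from_nat_into (insert {} \<B>)"
  have rU: "range U = insert {} \<B>" unfolding U_def using B(1) by (intro range_from_nat_into) auto
  have U: "openin X (U n)" for n
    using rU B(2) by (metis insertE openin_empty rangeI)
  define f where "f x = ternary (\<lambda>n. x \<in> U n)" for x
  have inj: "x = y" if fxy: "f x = f y" and xy: "x \<in> topspace X" "y \<in> topspace X" for x y
  proof (rule ccontr)
    assume "x \<noteq> y"
    then obtain W where W: "openin X W" "x \<in> W" "y \<notin> W"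
      using metrizable_imp_t1_space[OF met] xy unfolding t1_space_def by blast
    then obtain V where V: "V \<in> \<B>" "x \<in> V" "y \<notin> V" using B(3) by blast
    then obtain n where "V = U n" using rU by (metis imageE insertI2)
    with V ternary_inj[OF fxy[unfolded f_def], of n] show False by simp
  qed
  have f_m: "f \<in> borel_measurable \<mu>"
  proof -
    have [measurable]: "U n \<in> sets \<mu>" for n using U by (simp add: \<mu> openin_borel_of)
    have "(\<lambda>x. \<Sum>n. (1/3::real) ^ Suc n * of_bool (x \<in> U n)) \<in> borel_measurable \<mu>" 
      unfolding of_bool_def by measurable
    then show ?thesis unfolding f_def[abs_def] ternary_def .
  qed
  have "\<exists>F. closedin X F \<and> F \<subseteq> U n \<and> measure \<mu> (U n - F) < (1/2) ^ (n + m)" for n m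
    by (rule closed_inner_approx[OF met \<mu> U]) simp
  then obtain F where F: "\<And>n m. closedin X (F n m)" "\<And>n m. F n m \<subseteq> U n"
    "\<And>n m. measure \<mu> (U n - F n m) < (1/2) ^ (n + m)" by metis
  define K where "K m = topspace X - (\<Union>n. U n - F n m)" for m
  have K: "closedin X (K m)" for m
    unfolding K_def using U F(1) by (intro closedin_diff closedin_topspace openin_Union) (auto intro: openin_diff)
  have UK: "U n \<inter> K m = F n m \<inter> K m" for n m
    unfolding K_def using F(2)[of n m] by auto
  have cpt: "compact (f ` (K m \<inter> C))" if "closedin X C" for m C
    unfolding f_def using ternary_code_on_closed_set[OF X(1) K U F(1) UK that] .
  define K' where "K' = (\<Union>m. K m)"
  have K'_sets: "K' \<in> sets \<mu>" unfolding K'_def using K by (auto simp: \<mu> closedin_borel_of)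
  have K'_sub: "K' \<subseteq> topspace X" unfolding K'_def K_def by auto
  have full: "AE x in \<mu>. x \<in> K'"
  proof -
    have "measure \<mu> (topspace X - K') \<le> e" if e: "0 < e" for e
    proof -
      obtain m where m: "(1/2::real) ^ m < e / 2" using e real_arch_pow_inv[of "e/2" "1/2"] by auto
      have UF: "U n - F n m \<in> sets \<mu>" for n using U F(1) by (auto simp: \<mu> openin_borel_of closedin_borel_of)
      have sm: "summable (\<lambda>n. (1/2::real) ^ (n + m))"
        unfolding power_add by (intro summable_mult2 summable_geometric) simp
      have sm': "summable (\<lambda>n. measure \<mu> (U n - F n m))"
        by (rule summable_comparison_test[OF _ sm]) (use F(3) in \<open>auto intro: less_imp_le\<close>)
      have "measure \<mu> (topspace X - K') \<le> measure \<mu> (\<Union>n. U n - F n m)"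
        using UF by (intro finite_measure_mono) (auto simp: K'_def K_def)
      also have "\<dots> \<le> (\<Sum>n. measure \<mu> (U n - F n m))"
        using UF sm' by (intro finite_measure_subadditive_countably) auto
      also have "\<dots> \<le> (\<Sum>n. (1/2) ^ (n + m))"
        using F(3) by (intro suminf_le sm sm') (auto intro: less_imp_le)
      also have "\<dots> = 2 * (1/2) ^ m"
        unfolding power_add using suminf_geometric[of "1/2::real"]
        by (subst suminf_mult2[symmetric]) (auto intro: summable_geometric)
      finally show ?thesis using m by simp
    qed
    then have "measure \<mu> (topspace X - K') \<le> 0 + e" if "0 < e" for e
      unfolding add_0_left using that by blast
    then have "measure \<mu> (topspace X - K') \<le> 0" by (rule field_le_epsilon)
    then have "measure \<mu> (topspace X - K') = 0" by (rule antisym[OF _ measure_nonneg])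
    then have "emeasure \<mu> (topspace X - K') = 0" by (simp only: emeasure_eq_measure ennreal_0)
    moreover have "topspace X - K' \<in> sets \<mu>"
      using sets.compl_sets[OF K'_sets] by (simp add: sp)
    ultimately have "topspace X - K' \<in> null_sets \<mu>" by (rule null_setsI)
    from AE_not_in[OF this] AE_space[of \<mu>] show ?thesis by eventually_elim (auto simp: sp)
  qed
  obtain x0 where x0: "x0 \<in> topspace X" using not_empty unfolding sp by blast
  define g where "g t = (if t \<in> f ` K' then inv_into K' f t else x0)" for t
  have injK: "inj_on f K'" using inj K'_sub by (auto simp: inj_on_def)
  have gf: "g (f x) = x" if "x \<in> K'" for x
    using that injK by (auto simp: g_def)
  have img: "f ` (K' \<inter> C) \<in> sets borel" if "closedin X C" for C
  proof -
    have "f ` (K' \<inter> C) = (\<Union>m. f ` (K m \<inter> C))" by (auto simp: K'_def)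
    also have "\<dots> \<in> sets borel"
      using cpt[OF that] by (intro sets.countable_UN'') (auto intro: borel_compact)
    finally show ?thesis .
  qed
  have fK': "f ` K' \<in> sets borel"
    using img[OF closedin_topspace] K'_sub by (simp add: Int_absorb2)
  have g_m: "g \<in> borel \<rightarrow>\<^sub>M borel_of X"
  proof (rule measurable_borel_of)
    show "g \<in> space borel \<rightarrow> topspace X"
      using x0 subsetD[OF K'_sub] by (auto simp: g_def inv_into_f_f[OF injK])
    fix V assume V: "openin X V"
    have "f ` (K' \<inter> V) = f ` K' - f ` (K' \<inter> (topspace X - V))"
      using injK K'_sub by (auto simp: inj_on_def)
    then have 1: "f ` (K' \<inter> V) \<in> sets borel" using fK' img[of "topspace X - V"] V by auto
    have "g -` V \<inter> space borel = f ` (K' \<inter> V) \<union> (if x0 \<in> V then - f ` K' else {})"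
      by (auto simp: g_def inv_into_f_f[OF injK] split: if_splits)
    then show "g -` V \<inter> space borel \<in> sets borel" using 1 fK' by auto
  qed
  have "g \<in> borel \<rightarrow>\<^sub>M \<mu>" using g_m \<mu>(2) by (simp cong: measurable_cong_sets)
  moreover have "range f \<subseteq> {0..1}" using ternary_bounds order_trans[OF ternary_bounds(2), of 1] by (auto simp: f_def)
  moreover have "AE x in \<mu>. g (f x) = x" using full by eventually_elim (rule gf)
  ultimately show ?thesis unfolding real_coded_def using f_m \<mu>(1) by blast
qed

section \<open>Composition of couplings\<close>

definition section_density_fst ::
  "'a measure \<Rightarrow> ('a \<times> 'b) measure \<Rightarrow> 'b set \<Rightarrow> ('a \<Rightarrow> ennreal) \<Rightarrow> bool" where
  "section_density_fst \<mu> \<pi> C g \<longleftrightarrow> g \<in> borel_measurable \<mu> \<and>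
     (\<forall>B\<in>sets \<mu>. emeasure \<pi> (B \<times> C) = (\<integral>\<^sup>+x\<in>B. g x \<partial>\<mu>))"

lemma section_density_fst_swap:
  assumes "\<pi> \<in> couplings \<mu> \<nu>" "C \<in> sets \<nu>"
  shows "section_density_fst \<mu> \<pi> C g \<longleftrightarrow> section_density \<mu> (swap_measure \<mu> \<nu> \<pi>) C g"
  using swap_coupling(2)[OF assms(1) _ assms(2)] by (auto simp: section_density_fst_def section_density_def)

lemma section_density_fst_unique:
  assumes \<pi>: "\<pi> \<in> couplings \<mu> \<nu>" and C: "C \<in> sets \<nu>"
    and "section_density_fst \<mu> \<pi> C f" "section_density_fst \<mu> \<pi> C g"
  shows "AE x in \<mu>. f x = g x"
  using assms(3,4) section_density_unique[OF swap_coupling(1)[OF \<pi>] C]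
  unfolding section_density_fst_swap[OF \<pi> C] by blast

lemma section_density_fst_exists:
  assumes \<pi>: "\<pi> \<in> couplings \<mu> \<nu>" and C: "C \<in> sets \<nu>"
  obtains g where "section_density_fst \<mu> \<pi> C g"
  using section_density_exists[OF swap_coupling(1)[OF \<pi>] C] section_density_fst_swap[OF \<pi> C] by metis

lemma section_density_fst_one:
  assumes \<pi>: "\<pi> \<in> couplings \<mu> \<nu>"
  shows "section_density_fst \<mu> \<pi> (space \<nu>) (\<lambda>_. 1)"
  using coupling_emeasure_fst[OF \<pi>] by (auto simp: section_density_fst_def)

text \<open>
  Two couplings that can be glued along \<open>\<mu>'\<close>.  Coding is asked of the outer measures, since these
  carry the conditional measures.
\<close>

locale composable =
  fixes \<mu> :: "'a measure" and \<mu>' :: "'b measure" and \<mu>'' :: "'c measure" and \<pi> \<pi>'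
  assumes \<pi>: "\<pi> \<in> couplings \<mu> \<mu>'" and \<pi>': "\<pi>' \<in> couplings \<mu>' \<mu>''"
    and coded: "real_coded \<mu>" "real_coded \<mu>''"
begin

definition k where "k = (SOME k. is_disintegration_snd \<mu> \<mu>' \<pi> k)"
definition k' where "k' = (SOME k'. is_disintegration_fst \<mu>' \<mu>'' \<pi>' k')"

lemma k: "is_disintegration_snd \<mu> \<mu>' \<pi> k"
  unfolding k_def by (rule someI_ex[OF disintegration_snd_exists[OF \<pi> coded(1)]])

lemma k': "is_disintegration_fst \<mu>' \<mu>'' \<pi>' k'"
  unfolding k'_def by (rule someI_ex[OF disintegration_fst_exists[OF \<pi>' coded(2)]])

lemma k_measurable: "k \<in> \<mu>' \<rightarrow>\<^sub>M prob_algebra \<mu>" and k'_measurable: "k' \<in> \<mu>' \<rightarrow>\<^sub>M prob_algebra \<mu>''"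
  using k k' by (auto simp: is_disintegration_snd_def is_disintegration_fst_def)

lemma k_emeasure_measurable: "A \<in> sets \<mu> \<Longrightarrow> (\<lambda>x. emeasure (k x) A) \<in> borel_measurable \<mu>'"
  using measurable_compose[OF measurable_prob_algebraD[OF k_measurable] measurable_emeasure_subprob_algebra] .

lemma k'_emeasure_measurable: "A \<in> sets \<mu>'' \<Longrightarrow> (\<lambda>x. emeasure (k' x) A) \<in> borel_measurable \<mu>'"
  using measurable_compose[OF measurable_prob_algebraD[OF k'_measurable] measurable_emeasure_subprob_algebra] .

lemma k_density: "A \<in> sets \<mu> \<Longrightarrow> section_density \<mu>' \<pi> A (\<lambda>x. emeasure (k x) A)"
  using k k_emeasure_measurable by (auto simp: is_disintegration_snd_def section_density_def)

lemma k'_density: "C \<in> sets \<mu>'' \<Longrightarrow> section_density_fst \<mu>' \<pi>' C (\<lambda>x. emeasure (k' x) C)"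
  using k' k'_emeasure_measurable by (auto simp: is_disintegration_fst_def section_density_fst_def)

abbreviation "G \<equiv> gluing \<mu> \<mu>' \<mu>'' \<pi>' \<pi>"

definition \<kappa> where
  "\<kappa> x' = distr (k x' \<Otimes>\<^sub>M k' x') (\<mu> \<Otimes>\<^sub>M (\<mu>' \<Otimes>\<^sub>M \<mu>'')) (\<lambda>(x, x''). (x, x', x''))"

lemma \<kappa>_measurable: "\<kappa> \<in> \<mu>' \<rightarrow>\<^sub>M prob_algebra (\<mu> \<Otimes>\<^sub>M (\<mu>' \<Otimes>\<^sub>M \<mu>''))"
  unfolding \<kappa>_def[abs_def]
  by (rule measurable_distr_prob_space2[OF measurable_pair_prob[OF k_measurable k'_measurable]]) measurable

lemma G_eq: "G = \<mu>' \<bind> \<kappa>"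
  unfolding gluing_def k_def[symmetric] k'_def[symmetric] \<kappa>_def[abs_def] by simp

lemma \<mu>'_in: "\<mu>' \<in> space (prob_algebra \<mu>')"
  using couplingsD(9)[OF \<pi>] by (simp add: space_prob_algebra)

lemma G_prob: "prob_space G"
  unfolding G_eq by (rule prob_space_bind'[OF \<mu>'_in \<kappa>_measurable])

lemma G_sets: "sets G = sets (\<mu> \<Otimes>\<^sub>M (\<mu>' \<Otimes>\<^sub>M \<mu>''))"
  unfolding G_eq by (rule sets_bind'[OF \<mu>'_in \<kappa>_measurable])

lemma G_box:
  assumes A: "A \<in> sets \<mu>" and B: "B \<in> sets \<mu>'" and C: "C \<in> sets \<mu>''"
  shows "emeasure G (A \<times> (B \<times> C)) = (\<integral>\<^sup>+x\<in>B. emeasure (k x) A * emeasure (k' x) C \<partial>\<mu>')"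
proof -
  have "emeasure G (A \<times> (B \<times> C)) = (\<integral>\<^sup>+x. emeasure (\<kappa> x) (A \<times> (B \<times> C)) \<partial>\<mu>')"
    unfolding G_eq using A B C by (intro emeasure_bind_prob_algebra[OF \<mu>'_in \<kappa>_measurable]) auto
  also have "\<dots> = (\<integral>\<^sup>+x\<in>B. emeasure (k x) A * emeasure (k' x) C \<partial>\<mu>')"
  proof (rule nn_integral_cong)
    fix x assume x: "x \<in> space \<mu>'"
    then have s: "sets (k x) = sets \<mu>" "sets (k' x) = sets \<mu>''" "prob_space (k x)" "prob_space (k' x)"
      using measurable_space[OF k_measurable x] measurable_space[OF k'_measurable x]
      by (auto simp: space_prob_algebra)
    interpret k': prob_space "k' x" by fact
    have sp: "space (k x) = space \<mu>" "space (k' x) = space \<mu>''"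
      using s by (auto dest: sets_eq_imp_space_eq)
    have m: "(\<lambda>(y, z). (y, x, z)) \<in> k x \<Otimes>\<^sub>M k' x \<rightarrow>\<^sub>M \<mu> \<Otimes>\<^sub>M (\<mu>' \<Otimes>\<^sub>M \<mu>'')"
    proof (subst measurable_cong_sets[OF sets_pair_measure_cong[OF s(1,2)] refl])
      show "(\<lambda>(y, z). (y, x, z)) \<in> \<mu> \<Otimes>\<^sub>M \<mu>'' \<rightarrow>\<^sub>M \<mu> \<Otimes>\<^sub>M (\<mu>' \<Otimes>\<^sub>M \<mu>'')"
        using x by measurable
    qed
    have "(\<lambda>(y, z). (y, x, z)) -` (A \<times> (B \<times> C)) \<inter> space (k x \<Otimes>\<^sub>M k' x) = (if x \<in> B then A \<times> C else {})"
      using A[THEN sets.sets_into_space] C[THEN sets.sets_into_space]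
      by (auto simp: space_pair_measure sp)
    then show "emeasure (\<kappa> x) (A \<times> (B \<times> C)) = emeasure (k x) A * emeasure (k' x) C * indicator B x"
      unfolding \<kappa>_def using A B C by (simp add: emeasure_distr[OF m] k'.emeasure_pair_measure_Times s)
  qed
  finally show ?thesis .
qed

lemma G_fst_measurable: "(\<lambda>(x, x', x''). (x, x')) \<in> G \<rightarrow>\<^sub>M \<mu> \<Otimes>\<^sub>M \<mu>'"
  and G_snd_measurable: "(\<lambda>(x, x', x''). (x', x'')) \<in> G \<rightarrow>\<^sub>M \<mu>' \<Otimes>\<^sub>M \<mu>''"
  and G_outer_measurable: "(\<lambda>(x, x', x''). (x, x'')) \<in> G \<rightarrow>\<^sub>M \<mu> \<Otimes>\<^sub>M \<mu>''"
  by (subst measurable_cong_sets[OF G_sets refl], measurable)+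

lemma G_space: "space G = space \<mu> \<times> space \<mu>' \<times> space \<mu>''"
  using sets_eq_imp_space_eq[OF G_sets] by (simp add: space_pair_measure)

lemma distr_G_fst: "distr G (\<mu> \<Otimes>\<^sub>M \<mu>') (\<lambda>(x, x', x''). (x, x')) = \<pi>"
proof (rule measure_eqI_rectangles)
  show "prob_space (distr G (\<mu> \<Otimes>\<^sub>M \<mu>') (\<lambda>(x, x', x''). (x, x')))"
    by (rule prob_space.prob_space_distr[OF G_prob G_fst_measurable])
  show "sets \<pi> = sets (\<mu> \<Otimes>\<^sub>M \<mu>')" by (rule couplingsD(2)[OF \<pi>])
  fix A B assume A: "A \<in> sets \<mu>" and B: "B \<in> sets \<mu>'"
  have eq: "(\<lambda>(x, x', x''). (x, x')) -` (A \<times> B) \<inter> space G = A \<times> (B \<times> space \<mu>'')"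
    using A[THEN sets.sets_into_space] B[THEN sets.sets_into_space] by (auto simp: G_space)
  have "emeasure (distr G (\<mu> \<Otimes>\<^sub>M \<mu>') (\<lambda>(x, x', x''). (x, x'))) (A \<times> B)
      = (\<integral>\<^sup>+x\<in>B. emeasure (k x) A * emeasure (k' x) (space \<mu>'') \<partial>\<mu>')"
    using A B G_box[OF A B sets.top] by (simp add: emeasure_distr[OF G_fst_measurable] eq)
  also have "\<dots> = (\<integral>\<^sup>+x\<in>B. emeasure (k x) A \<partial>\<mu>')"
    using in_space_prob_algebra[OF measurable_space[OF k'_measurable]] by (auto intro!: nn_integral_cong)
  also have "\<dots> = emeasure \<pi> (A \<times> B)"
    using k_density[OF A] B by (simp add: section_density_def)
  finally show "emeasure (distr G (\<mu> \<Otimes>\<^sub>M \<mu>') (\<lambda>(x, x', x''). (x, x'))) (A \<times> B) = emeasure \<pi> (A \<times> B)" .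
qed simp

lemma distr_G_snd: "distr G (\<mu>' \<Otimes>\<^sub>M \<mu>'') (\<lambda>(x, x', x''). (x', x'')) = \<pi>'"
proof (rule measure_eqI_rectangles)
  show "prob_space (distr G (\<mu>' \<Otimes>\<^sub>M \<mu>'') (\<lambda>(x, x', x''). (x', x'')))"
    by (rule prob_space.prob_space_distr[OF G_prob G_snd_measurable])
  show "sets \<pi>' = sets (\<mu>' \<Otimes>\<^sub>M \<mu>'')" by (rule couplingsD(2)[OF \<pi>'])
  fix B C assume B: "B \<in> sets \<mu>'" and C: "C \<in> sets \<mu>''"
  have eq: "(\<lambda>(x, x', x''). (x', x'')) -` (B \<times> C) \<inter> space G = space \<mu> \<times> (B \<times> C)"
    using B[THEN sets.sets_into_space] C[THEN sets.sets_into_space] by (auto simp: G_space)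
  have "emeasure (distr G (\<mu>' \<Otimes>\<^sub>M \<mu>'') (\<lambda>(x, x', x''). (x', x''))) (B \<times> C)
      = (\<integral>\<^sup>+x\<in>B. emeasure (k x) (space \<mu>) * emeasure (k' x) C \<partial>\<mu>')"
    using B C G_box[OF sets.top B C] by (subst emeasure_distr[OF G_snd_measurable]) (simp_all only: eq pair_measureI)
  also have "\<dots> = (\<integral>\<^sup>+x\<in>B. emeasure (k' x) C \<partial>\<mu>')"
    using in_space_prob_algebra[OF measurable_space[OF k_measurable]] by (auto intro!: nn_integral_cong)
  also have "\<dots> = emeasure \<pi>' (B \<times> C)"
    using k'_density[OF C] B by (simp add: section_density_fst_def)
  finally show "emeasure (distr G (\<mu>' \<Otimes>\<^sub>M \<mu>'') (\<lambda>(x, x', x''). (x', x''))) (B \<times> C) = emeasure \<pi>' (B \<times> C)" .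
qed simp

lemma AE_G_fst: "AE (x, x') in \<pi>. P x x' \<Longrightarrow> AE (x, x', x'') in G. P x x'"
  and AE_G_snd: "AE (x', x'') in \<pi>'. Q x' x'' \<Longrightarrow> AE (x, x', x'') in G. Q x' x''"
  using AE_distrD[OF G_fst_measurable, of "\<lambda>(x, x'). P x x'"]
    AE_distrD[OF G_snd_measurable, of "\<lambda>(x', x''). Q x' x''"]
  unfolding distr_G_fst distr_G_snd by (simp_all add: case_prod_beta')

abbreviation "P \<equiv> coupling_comp \<mu> \<mu>' \<mu>'' \<pi>' \<pi>"

lemma comp_prob: "prob_space P" and comp_sets: "sets P = sets (\<mu> \<Otimes>\<^sub>M \<mu>'')"
  unfolding coupling_comp_def using prob_space.prob_space_distr[OF G_prob G_outer_measurable] by simp_all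

text \<open>
  Any choice of densities computes the composite, because they agree almost everywhere with the
  conditional measures that the gluing integrates.
\<close>

lemma comp_rectangle:
  assumes A: "A \<in> sets \<mu>" and C: "C \<in> sets \<mu>''"
    and f: "section_density \<mu>' \<pi> A f" and g: "section_density_fst \<mu>' \<pi>' C g"
  shows "emeasure P (A \<times> C) = (\<integral>\<^sup>+x. f x * g x \<partial>\<mu>')"
proof -
  have eq: "(\<lambda>(x, x', x''). (x, x'')) -` (A \<times> C) \<inter> space G = A \<times> (space \<mu>' \<times> C)"
    using A[THEN sets.sets_into_space] C[THEN sets.sets_into_space] by (auto simp: G_space)
  have "emeasure P (A \<times> C) = (\<integral>\<^sup>+x\<in>space \<mu>'. emeasure (k x) A * emeasure (k' x) C \<partial>\<mu>')"
    using A C G_box[OF A sets.top C] unfolding coupling_comp_def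
    by (simp add: emeasure_distr[OF G_outer_measurable] eq)
  also have "\<dots> = (\<integral>\<^sup>+x. f x * g x \<partial>\<mu>')"
  proof (rule nn_integral_cong_AE)
    show "AE x in \<mu>'. emeasure (k x) A * emeasure (k' x) C * indicator (space \<mu>') x = f x * g x"
      using section_density_unique[OF \<pi> A f k_density[OF A]]
        section_density_fst_unique[OF \<pi>' C g k'_density[OF C]] AE_space
      by eventually_elim simp
  qed
  finally show ?thesis .
qed

lemma comp_coupling: "P \<in> couplings \<mu> \<mu>''"
proof (rule couplingsI[OF comp_prob comp_sets])
  fix A assume A: "A \<in> sets \<mu>"
  have "emeasure P (A \<times> space \<mu>'') = (\<integral>\<^sup>+x\<in>space \<mu>'. emeasure (k x) A \<partial>\<mu>')"
    using comp_rectangle[OF A sets.top k_density[OF A] section_density_fst_one[OF \<pi>']]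
    by (auto intro!: nn_integral_cong)
  also have "\<dots> = emeasure \<mu> A"
    using k_density[OF A] coupling_emeasure_fst[OF \<pi> A] by (simp add: section_density_def)
  finally show "emeasure P (A \<times> space \<mu>'') = emeasure \<mu> A" .
next
  fix C assume C: "C \<in> sets \<mu>''"
  have "emeasure P (space \<mu> \<times> C) = (\<integral>\<^sup>+x\<in>space \<mu>'. emeasure (k' x) C \<partial>\<mu>')"
    using comp_rectangle[OF sets.top C section_density_one[OF \<pi>] k'_density[OF C]]
    by (auto intro!: nn_integral_cong)
  also have "\<dots> = emeasure \<mu>'' C"
    using k'_density[OF C] coupling_emeasure_snd[OF \<pi>' C] by (simp add: section_density_fst_def)
  finally show "emeasure P (space \<mu> \<times> C) = emeasure \<mu>'' C" .
qed

lemma AE_comp: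
  assumes "AE (x, x') in \<pi>. Q x x'" "AE (x', x'') in \<pi>'. Q' x' x''"
    and R: "\<And>x x' x''. Q x x' \<Longrightarrow> Q' x' x'' \<Longrightarrow> R x x''"
    and m: "{z \<in> space (\<mu> \<Otimes>\<^sub>M \<mu>''). R (fst z) (snd z)} \<in> sets (\<mu> \<Otimes>\<^sub>M \<mu>'')"
  shows "AE (x, x'') in P. R x x''"
proof -
  have "AE (x, x', x'') in G. R x x''"
    using AE_G_fst[OF assms(1)] AE_G_snd[OF assms(2)] by eventually_elim (auto intro: R)
  then show ?thesis
    unfolding coupling_comp_def using m
    by (subst AE_distr_iff[OF G_outer_measurable]) (auto simp: case_prod_beta')
qed

end

text \<open>
  The hypothesis says that \<open>density N h\<close> is the image of \<open>density P w\<close> under \<open>T\<close>, so integrals of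
  measurable functions agree.
\<close>

lemma nn_integral_eq_if_set_nn_integral_eq:
  assumes [measurable]: "T \<in> P \<rightarrow>\<^sub>M N" "w \<in> borel_measurable P" "h \<in> borel_measurable N" "v \<in> borel_measurable N"
    and eq: "\<And>C. C \<in> sets N \<Longrightarrow> (\<integral>\<^sup>+x\<in>C. h x \<partial>N) = (\<integral>\<^sup>+z. w z * indicator C (T z) \<partial>P)"
  shows "(\<integral>\<^sup>+x. h x * v x \<partial>N) = (\<integral>\<^sup>+z. w z * v (T z) \<partial>P)"
proof -
  have "density N h = distr (density P w) N T"
  proof (rule measure_eqI)
    fix C assume "C \<in> sets (density N h)"
    then have [measurable]: "C \<in> sets N" by simp
    have "emeasure (distr (density P w) N T) C = (\<integral>\<^sup>+z. w z * indicator (T -` C \<inter> space P) z \<partial>P)"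
      by (simp add: emeasure_distr emeasure_density)
    also have "\<dots> = (\<integral>\<^sup>+z. w z * indicator C (T z) \<partial>P)"
      by (intro nn_integral_cong) (auto simp: indicator_def)
    finally show "emeasure (density N h) C = emeasure (distr (density P w) N T) C"
      by (simp add: emeasure_density eq)
  qed simp
  then have "(\<integral>\<^sup>+x. v x \<partial>density N h) = (\<integral>\<^sup>+x. v x \<partial>distr (density P w) N T)" by simp
  then show ?thesis by (simp add: nn_integral_density nn_integral_distr)
qed

lemma diagonal_coupling_facts:
  assumes \<mu>: "prob_space \<mu>"
  shows diagonal_coupling_rectangle:
      "A \<in> sets \<mu> \<Longrightarrow> B \<in> sets \<mu> \<Longrightarrow> emeasure (diagonal_coupling \<mu>) (A \<times> B) = emeasure \<mu> (A \<inter> B)"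
    and diagonal_coupling: "diagonal_coupling \<mu> \<in> couplings \<mu> \<mu>"
proof -
  have h: "(\<lambda>x. (x, x)) \<in> \<mu> \<rightarrow>\<^sub>M \<mu> \<Otimes>\<^sub>M \<mu>" by measurable
  show rect: "emeasure (diagonal_coupling \<mu>) (A \<times> B) = emeasure \<mu> (A \<inter> B)"
    if "A \<in> sets \<mu>" "B \<in> sets \<mu>" for A B
  proof -
    have "(\<lambda>x. (x, x)) -` (A \<times> B) \<inter> space \<mu> = A \<inter> B"
      using that[THEN sets.sets_into_space] by auto
    then show ?thesis using that by (simp add: diagonal_coupling_def emeasure_distr[OF h])
  qed
  show "diagonal_coupling \<mu> \<in> couplings \<mu> \<mu>"
    using prob_space.prob_space_distr[OF \<mu> h]
    by (intro couplingsI) (auto simp: rect sets.Int_space_eq1 sets.Int_space_eq2, auto simp: diagonal_coupling_def)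
qed

lemma coupling_comp_diagonal_right:
  assumes c: "\<pi> \<in> couplings \<mu> \<nu>" and coded: "real_coded \<mu>" "real_coded \<nu>"
  shows "coupling_comp \<mu> \<mu> \<nu> \<pi> (diagonal_coupling \<mu>) = \<pi>"
proof -
  have p: "prob_space \<mu>" by (rule couplingsD[OF c])
  interpret composable \<mu> \<mu> \<nu> "diagonal_coupling \<mu>" \<pi>
    by unfold_locales (use assms diagonal_coupling[OF p] in auto)
  show ?thesis
  proof (rule measure_eqI_rectangles[OF comp_prob comp_sets couplingsD(2)[OF c]])
    fix A C assume A: "A \<in> sets \<mu>" and C: "C \<in> sets \<nu>"
    obtain g where g: "section_density_fst \<mu> \<pi> C g" using section_density_fst_exists[OF c C] .
    have "section_density \<mu> (diagonal_coupling \<mu>) A (indicator A)"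
      using A by (auto simp: section_density_def diagonal_coupling_rectangle[OF p] indicator_inter_arith[symmetric])
    from comp_rectangle[OF A C this g]
    have "emeasure P (A \<times> C) = (\<integral>\<^sup>+x\<in>A. g x \<partial>\<mu>)" by (simp add: mult.commute)
    also have "\<dots> = emeasure \<pi> (A \<times> C)" using g A by (simp add: section_density_fst_def)
    finally show "emeasure P (A \<times> C) = emeasure \<pi> (A \<times> C)" .
  qed
qed

lemma coupling_comp_diagonal_left:
  assumes \<pi>: "\<pi> \<in> couplings \<mu> \<nu>" and coded: "real_coded \<mu>" "real_coded \<nu>"
  shows "coupling_comp \<mu> \<nu> \<nu> (diagonal_coupling \<nu>) \<pi> = \<pi>"
proof -
  have p: "prob_space \<nu>" by (rule couplingsD[OF \<pi>])
  interpret composable \<mu> \<nu> \<nu> \<pi> "diagonal_coupling \<nu>"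
    by unfold_locales (use assms diagonal_coupling[OF p] in auto)
  show ?thesis
  proof (rule measure_eqI_rectangles[OF comp_prob comp_sets couplingsD(2)[OF \<pi>]])
    fix A C assume A: "A \<in> sets \<mu>" and C: "C \<in> sets \<nu>"
    have "section_density_fst \<nu> (diagonal_coupling \<nu>) C (indicator C)"
      using C by (auto simp: section_density_fst_def diagonal_coupling_rectangle[OF p] indicator_inter_arith[symmetric] Int_commute)
    from comp_rectangle[OF A C k_density[OF A] this]
    have "emeasure P (A \<times> C) = (\<integral>\<^sup>+x\<in>C. emeasure (k x) A \<partial>\<nu>)" .
    also have "\<dots> = emeasure \<pi> (A \<times> C)" using k_density[OF A] C by (simp add: section_density_def)
    finally show "emeasure P (A \<times> C) = emeasure \<pi> (A \<times> C)" .
  qed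
qed

text \<open>
  On a rectangle \<open>A \<times> D\<close> both sides equal the integral of \<open>f x' * l x''\<close> over the middle coupling
  \<open>\<pi>'\<close>, where \<open>f\<close> is the density of \<open>\<pi>\<close> at \<open>A\<close> and \<open>l\<close> that of \<open>\<pi>''\<close> at \<open>D\<close>: the density of either
  inner composite is the conditional expectation under \<open>\<pi>'\<close> of \<open>f\<close> or of \<open>l\<close>.
\<close>

lemma coupling_comp_assoc:
  assumes \<pi>: "\<pi> \<in> couplings \<mu> \<mu>'" and \<pi>': "\<pi>' \<in> couplings \<mu>' \<mu>''" and \<pi>'': "\<pi>'' \<in> couplings \<mu>'' \<mu>'''"
    and coded: "real_coded \<mu>" "real_coded \<mu>'" "real_coded \<mu>''" "real_coded \<mu>'''"
  shows "coupling_comp \<mu> \<mu>'' \<mu>''' \<pi>'' (coupling_comp \<mu> \<mu>' \<mu>'' \<pi>' \<pi>) =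
         coupling_comp \<mu> \<mu>' \<mu>''' (coupling_comp \<mu>' \<mu>'' \<mu>''' \<pi>'' \<pi>') \<pi>"
proof -
  interpret L1: composable \<mu> \<mu>' \<mu>'' \<pi> \<pi>' by unfold_locales fact+
  interpret R1: composable \<mu>' \<mu>'' \<mu>''' \<pi>' \<pi>'' by unfold_locales fact+
  interpret L: composable \<mu> \<mu>'' \<mu>''' L1.P \<pi>'' by unfold_locales (use L1.comp_coupling \<pi>'' coded in auto)
  interpret R: composable \<mu> \<mu>' \<mu>''' \<pi> R1.P by unfold_locales (use R1.comp_coupling \<pi> coded in auto)
  note [measurable] = couplingsD(4,5)[OF \<pi>']
  show ?thesis
  proof (rule measure_eqI_rectangles[OF L.comp_prob L.comp_sets R.comp_sets])
    fix A D assume A: "A \<in> sets \<mu>" and D: "D \<in> sets \<mu>'''"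
    obtain f where f: "section_density \<mu>' \<pi> A f" using section_density_exists[OF \<pi> A] .
    obtain l where l: "section_density_fst \<mu>'' \<pi>'' D l" using section_density_fst_exists[OF \<pi>'' D] .
    obtain h where h: "section_density \<mu>'' L1.P A h" using section_density_exists[OF L1.comp_coupling A] .
    obtain m where m: "section_density_fst \<mu>' R1.P D m" using section_density_fst_exists[OF R1.comp_coupling D] .
    have [measurable]: "f \<in> borel_measurable \<mu>'" "l \<in> borel_measurable \<mu>''"
      "h \<in> borel_measurable \<mu>''" "m \<in> borel_measurable \<mu>'"
      using f l h m by (auto simp: section_density_def section_density_fst_def)
    have "emeasure L.P (A \<times> D) = (\<integral>\<^sup>+x. h x * l x \<partial>\<mu>'')" by (rule L.comp_rectangle[OF A D h l])
    also have "\<dots> = (\<integral>\<^sup>+z. f (fst z) * l (snd z) \<partial>\<pi>')"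
    proof (rule nn_integral_eq_if_set_nn_integral_eq)
      fix C assume C[measurable]: "C \<in> sets \<mu>''"
      obtain g where g: "section_density_fst \<mu>' \<pi>' C g" using section_density_fst_exists[OF \<pi>' C] .
      have [measurable]: "g \<in> borel_measurable \<mu>'" using g by (simp add: section_density_fst_def)
      have "(\<integral>\<^sup>+x\<in>C. h x \<partial>\<mu>'') = emeasure L1.P (A \<times> C)" using h C by (simp add: section_density_def)
      also have "\<dots> = (\<integral>\<^sup>+x. g x * f x \<partial>\<mu>')" using L1.comp_rectangle[OF A C f g] by (simp add: mult.commute)
      also have "\<dots> = (\<integral>\<^sup>+z. indicator C (snd z) * f (fst z) \<partial>\<pi>')"
      proof (rule nn_integral_eq_if_set_nn_integral_eq)
        fix B assume B: "B \<in> sets \<mu>'"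
        have "(\<integral>\<^sup>+z. indicator C (snd z) * indicator B (fst z) \<partial>\<pi>') = (\<integral>\<^sup>+z. indicator (B \<times> C) z \<partial>\<pi>')"
          by (intro nn_integral_cong) (auto simp: indicator_def)
        also have "\<dots> = emeasure \<pi>' (B \<times> C)" using B C by (simp add: couplingsD[OF \<pi>'])
        finally show "(\<integral>\<^sup>+x\<in>B. g x \<partial>\<mu>') = (\<integral>\<^sup>+z. indicator C (snd z) * indicator B (fst z) \<partial>\<pi>')"
          using g B by (simp add: section_density_fst_def)
      qed measurable
      finally show "(\<integral>\<^sup>+x\<in>C. h x \<partial>\<mu>'') = (\<integral>\<^sup>+z. f (fst z) * indicator C (snd z) \<partial>\<pi>')"
        by (simp add: mult.commute)
    qed measurable
    also have "\<dots> = (\<integral>\<^sup>+z. l (snd z) * f (fst z) \<partial>\<pi>')" by (simp add: mult.commute)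
    also have "\<dots> = (\<integral>\<^sup>+x. m x * f x \<partial>\<mu>')"
    proof (rule nn_integral_eq_if_set_nn_integral_eq[symmetric])
      fix B assume B[measurable]: "B \<in> sets \<mu>'"
      obtain g where g: "section_density \<mu>'' \<pi>' B g" using section_density_exists[OF \<pi>' B] .
      have [measurable]: "g \<in> borel_measurable \<mu>''" using g by (simp add: section_density_def)
      have "(\<integral>\<^sup>+x\<in>B. m x \<partial>\<mu>') = emeasure R1.P (B \<times> D)" using m B by (simp add: section_density_fst_def)
      also have "\<dots> = (\<integral>\<^sup>+x. g x * l x \<partial>\<mu>'')" by (rule R1.comp_rectangle[OF B D g l])
      also have "\<dots> = (\<integral>\<^sup>+z. indicator B (fst z) * l (snd z) \<partial>\<pi>')"
      proof (rule nn_integral_eq_if_set_nn_integral_eq)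
        fix C assume C: "C \<in> sets \<mu>''"
        have "(\<integral>\<^sup>+z. indicator B (fst z) * indicator C (snd z) \<partial>\<pi>') = (\<integral>\<^sup>+z. indicator (B \<times> C) z \<partial>\<pi>')"
          by (intro nn_integral_cong) (auto simp: indicator_def)
        also have "\<dots> = emeasure \<pi>' (B \<times> C)" using B C by (simp add: couplingsD[OF \<pi>'])
        finally show "(\<integral>\<^sup>+x\<in>C. g x \<partial>\<mu>'') = (\<integral>\<^sup>+z. indicator B (fst z) * indicator C (snd z) \<partial>\<pi>')"
          using g C by (simp add: section_density_def)
      qed measurable
      finally show "(\<integral>\<^sup>+x\<in>B. m x \<partial>\<mu>') = (\<integral>\<^sup>+z. l (snd z) * indicator B (fst z) \<partial>\<pi>')"
        by (simp add: mult.commute)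
    qed measurable
    also have "\<dots> = emeasure R.P (A \<times> D)"
      using R.comp_rectangle[OF A D f m] by (simp add: mult.commute)
    finally show "emeasure L.P (A \<times> D) = emeasure R.P (A \<times> D)" .
  qed
qed

text \<open>
  Both inequalities hold almost everywhere on the product of the two gluings, which projects to all
  the products of couplings involved; there they can be chained.
\<close>

lemma AE_expansive_comp:
  assumes c1: "composable \<mu> \<mu>' \<mu>'' \<pi> \<pi>'" and c2: "composable \<nu> \<nu>' \<nu>'' \<xi> \<xi>'"
    and [measurable]: "w \<in> borel_measurable (\<mu> \<Otimes>\<^sub>M \<nu>)" "w'' \<in> borel_measurable (\<mu>'' \<Otimes>\<^sub>M \<nu>'')"
    and le: "AE ((x, x'), (y, y')) in \<pi> \<Otimes>\<^sub>M \<xi>. w (x, y) \<le> (w' (x', y') :: real)"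
    and le': "AE ((x', x''), (y', y'')) in \<pi>' \<Otimes>\<^sub>M \<xi>'. w' (x', y') \<le> w'' (x'', y'')"
  shows "AE ((x, x''), (y, y'')) in coupling_comp \<mu> \<mu>' \<mu>'' \<pi>' \<pi> \<Otimes>\<^sub>M coupling_comp \<nu> \<nu>' \<nu>'' \<xi>' \<xi>.
           w (x, y) \<le> w'' (x'', y'')"
proof -
  interpret a: composable \<mu> \<mu>' \<mu>'' \<pi> \<pi>' by fact
  interpret b: composable \<nu> \<nu>' \<nu>'' \<xi> \<xi>' by fact
  have sf: "sigma_finite_measure M" if "prob_space M" for M :: "'z measure"
    using that by (simp add: prob_space_imp_sigma_finite)
  let ?GG = "a.G \<Otimes>\<^sub>M b.G"
  have 1: "AE z in ?GG. case z of ((x, x', x''), (y, y', y'')) \<Rightarrow> w (x, y) \<le> w' (x', y')"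
  proof -
    have "\<pi> \<Otimes>\<^sub>M \<xi> = distr ?GG ((\<mu> \<Otimes>\<^sub>M \<mu>') \<Otimes>\<^sub>M (\<nu> \<Otimes>\<^sub>M \<nu>')) (\<lambda>(u, v). ((\<lambda>(x, x', x''). (x, x')) u, (\<lambda>(x, x', x''). (x, x')) v))"
      by (subst (1) a.distr_G_fst[symmetric], subst (1) b.distr_G_fst[symmetric])
         (rule pair_measure_distr[OF a.G_fst_measurable b.G_fst_measurable],
          simp add: b.distr_G_fst sf couplingsD[OF b.\<pi>])
    note le[unfolded this]
    from AE_distrD[OF _ this] show ?thesis
      using a.G_fst_measurable b.G_fst_measurable by (auto simp: case_prod_beta')
  qed
  have 2: "AE z in ?GG. case z of ((x, x', x''), (y, y', y'')) \<Rightarrow> w' (x', y') \<le> w'' (x'', y'')"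
  proof -
    have "\<pi>' \<Otimes>\<^sub>M \<xi>' = distr ?GG ((\<mu>' \<Otimes>\<^sub>M \<mu>'') \<Otimes>\<^sub>M (\<nu>' \<Otimes>\<^sub>M \<nu>'')) (\<lambda>(u, v). ((\<lambda>(x, x', x''). (x', x'')) u, (\<lambda>(x, x', x''). (x', x'')) v))"
      by (subst (1) a.distr_G_snd[symmetric], subst (1) b.distr_G_snd[symmetric])
         (rule pair_measure_distr[OF a.G_snd_measurable b.G_snd_measurable],
          simp only: b.distr_G_snd sf couplingsD(1)[OF b.\<pi>'])
    note le'[unfolded this]
    from AE_distrD[OF _ this] show ?thesis
      using a.G_snd_measurable b.G_snd_measurable by (auto simp: case_prod_beta')
  qed
  have 3: "a.P \<Otimes>\<^sub>M b.P = distr ?GG ((\<mu> \<Otimes>\<^sub>M \<mu>'') \<Otimes>\<^sub>M (\<nu> \<Otimes>\<^sub>M \<nu>'')) (\<lambda>(u, v). ((\<lambda>(x, x', x''). (x, x'')) u, (\<lambda>(x, x', x''). (x, x'')) v))"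
    unfolding coupling_comp_def
    by (rule pair_measure_distr[OF a.G_outer_measurable b.G_outer_measurable])
       (use b.comp_prob in \<open>simp add: coupling_comp_def sf\<close>)
  have m: "(\<lambda>(u, v). ((\<lambda>(x, x', x''). (x, x'')) u, (\<lambda>(x, x', x''). (x, x'')) v)) \<in> ?GG \<rightarrow>\<^sub>M (\<mu> \<Otimes>\<^sub>M \<mu>'') \<Otimes>\<^sub>M (\<nu> \<Otimes>\<^sub>M \<nu>'')"
    using a.G_outer_measurable b.G_outer_measurable by measurable
  have "AE z in ?GG. case z of ((x, x', x''), (y, y', y'')) \<Rightarrow> w (x, y) \<le> w'' (x'', y'')"
    using 1 2 by eventually_elim auto
  then show ?thesis
    unfolding 3 by (subst AE_distr_iff[OF m]) (auto simp: case_prod_beta')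
qed

lemma AE_expansive_diagonal:
  assumes "prob_space \<mu>" "prob_space \<nu>" and [measurable]: "w \<in> borel_measurable (\<mu> \<Otimes>\<^sub>M \<nu>)"
  shows "AE ((x, x'), (y, y')) in diagonal_coupling \<mu> \<Otimes>\<^sub>M diagonal_coupling \<nu>. w (x, y) \<le> (w (x', y') :: real)"
proof -
  have h: "(\<lambda>x. (x, x)) \<in> \<mu> \<rightarrow>\<^sub>M \<mu> \<Otimes>\<^sub>M \<mu>" "(\<lambda>x. (x, x)) \<in> \<nu> \<rightarrow>\<^sub>M \<nu> \<Otimes>\<^sub>M \<nu>" by measurable
  have 3: "diagonal_coupling \<mu> \<Otimes>\<^sub>M diagonal_coupling \<nu> = distr (\<mu> \<Otimes>\<^sub>M \<nu>) ((\<mu> \<Otimes>\<^sub>M \<mu>) \<Otimes>\<^sub>M (\<nu> \<Otimes>\<^sub>M \<nu>)) (\<lambda>(u, v). ((u, u), (v, v)))"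
    unfolding diagonal_coupling_def
    by (rule pair_measure_distr[OF h]) (rule prob_space_imp_sigma_finite, rule prob_space.prob_space_distr[OF assms(2) h(2)])
  show ?thesis unfolding 3
    by (subst AE_distr_iff) (auto simp: case_prod_beta')
qed

section \<open>Averaged measures on disjoint unions\<close>

lemma ennreal_half_sum_add:
  "(a + b) / 2 + (c + d) / 2 = ((a + c) + (b + d)) / (2::ennreal)"
  by (simp add: add_divide_distrib_ennreal ac_simps)

lemma sets_average_measure [simp]: "sets (average_measure M P Q) = sets M"
  and space_average_measure [simp]: "space (average_measure M P Q) = space M"
  by (simp_all add: average_measure_def sets.space_closed sets.sigma_sets_eq space_measure_of)

lemma measurable_average_measure [simp]:
  "f \<in> average_measure M P Q \<rightarrow>\<^sub>M N \<longleftrightarrow> f \<in> M \<rightarrow>\<^sub>M N"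
  by (simp cong: measurable_cong_sets)

lemma emeasure_average_measure:
  assumes [simp]: "sets P = sets M" "sets Q = sets M" and A: "A \<in> sets M"
  shows "emeasure (average_measure M P Q) A = (emeasure P A + emeasure Q A) / 2"
proof (rule emeasure_measure_of[OF average_measure_def])
  show "sets M \<subseteq> Pow (space M)" by (rule sets.space_closed)
  show "A \<in> sets (average_measure M P Q)" using A by simp
  show "positive (sets (average_measure M P Q)) (\<lambda>A. (emeasure P A + emeasure Q A) / 2)"
    by (simp add: positive_def)
  show "countably_additive (sets (average_measure M P Q)) (\<lambda>A. (emeasure P A + emeasure Q A) / 2)"
  proof (rule countably_additiveI)
    fix F :: "nat \<Rightarrow> 'a set"
    assume F: "range F \<subseteq> sets (average_measure M P Q)" "disjoint_family F"
    then have "(\<Sum>i. emeasure P (F i)) = emeasure P (\<Union>i. F i)" "(\<Sum>i. emeasure Q (F i)) = emeasure Q (\<Union>i. F i)"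
      by (auto intro!: suminf_emeasure)
    moreover have "(\<Sum>i. emeasure P (F i) + emeasure Q (F i)) = (\<Sum>i. emeasure P (F i)) + (\<Sum>i. emeasure Q (F i))"
      by (rule suminf_add[symmetric]) auto
    ultimately show "(\<Sum>i. (emeasure P (F i) + emeasure Q (F i)) / 2) = (emeasure P (\<Union>i. F i) + emeasure Q (\<Union>i. F i)) / 2"
      by simp
  qed
qed

lemma prob_space_average_measure:
  assumes "sets P = sets M" "sets Q = sets M" "prob_space P" "prob_space Q"
  shows "prob_space (average_measure M P Q)"
proof
  have "space P = space M" "space Q = space M"
    using assms by (auto dest: sets_eq_imp_space_eq)
  then show "emeasure (average_measure M P Q) (space (average_measure M P Q)) = 1"
    using prob_space.emeasure_space_1[OF assms(3)] prob_space.emeasure_space_1[OF assms(4)] assms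
    by (simp add: emeasure_average_measure)
qed

text \<open>
  The integral is additive and homogeneous in the measure.
\<close>

lemma nn_integral_average_measure:
  assumes s: "sets P = sets M" "sets Q = sets M" and f: "f \<in> borel_measurable M"
  shows "(\<integral>\<^sup>+x. f x \<partial>average_measure M P Q) = ((\<integral>\<^sup>+x. f x \<partial>P) + (\<integral>\<^sup>+x. f x \<partial>Q)) / 2"
  using f
proof (induction rule: borel_measurable_induct)
  case (cong f g)
  have "space P = space M" "space Q = space M" using s by (auto dest: sets_eq_imp_space_eq)
  then have "(\<integral>\<^sup>+x. f x \<partial>average_measure M P Q) = (\<integral>\<^sup>+x. g x \<partial>average_measure M P Q)"
    "(\<integral>\<^sup>+x. f x \<partial>P) = (\<integral>\<^sup>+x. g x \<partial>P)" "(\<integral>\<^sup>+x. f x \<partial>Q) = (\<integral>\<^sup>+x. g x \<partial>Q)"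
    using cong(3) by (auto intro!: nn_integral_cong)
  then show ?case using cong(4) by simp
next
  case (set A)
  then show ?case using s by (simp add: emeasure_average_measure)
next
  case (mult u c)
  have "u \<in> borel_measurable P" "u \<in> borel_measurable Q" using mult s by (auto cong: measurable_cong_sets)
  then show ?case using mult
    by (simp add: nn_integral_cmult ennreal_times_divide distrib_left)
next
  case (add u v)
  have "u \<in> borel_measurable P" "u \<in> borel_measurable Q" "v \<in> borel_measurable P" "v \<in> borel_measurable Q"
    using add s by (auto cong: measurable_cong_sets)
  then show ?case using add by (simp add: nn_integral_add ennreal_half_sum_add)
next
  case (seq U)
  have m: "U i \<in> borel_measurable P" "U i \<in> borel_measurable Q" for i using seq s by (auto cong: measurable_cong_sets)
  have sup: "Sup (range U) = (\<lambda>x. SUP i. U i x)" by (auto simp: fun_eq_iff image_image)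
  have "(\<integral>\<^sup>+x. (SUP i. U i) x \<partial>average_measure M P Q) = (SUP i. \<integral>\<^sup>+x. U i x \<partial>average_measure M P Q)"
    unfolding sup using seq by (intro nn_integral_monotone_convergence_SUP) simp_all
  also have "\<dots> = (SUP i. (\<integral>\<^sup>+x. U i x \<partial>P) + (\<integral>\<^sup>+x. U i x \<partial>Q)) / 2"
    using seq by (simp add: SUP_divide_ennreal)
  also have "(SUP i. (\<integral>\<^sup>+x. U i x \<partial>P) + (\<integral>\<^sup>+x. U i x \<partial>Q)) = (SUP i. \<integral>\<^sup>+x. U i x \<partial>P) + (SUP i. \<integral>\<^sup>+x. U i x \<partial>Q)"
    using seq(3) by (intro ennreal_SUP_add) (auto simp: incseq_def le_fun_def intro!: nn_integral_mono)
  also have "(SUP i. \<integral>\<^sup>+x. U i x \<partial>P) = (\<integral>\<^sup>+x. (SUP i. U i) x \<partial>P)"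
    unfolding sup using seq m by (intro nn_integral_monotone_convergence_SUP[symmetric]) simp_all
  also have "(SUP i. \<integral>\<^sup>+x. U i x \<partial>Q) = (\<integral>\<^sup>+x. (SUP i. U i) x \<partial>Q)"
    unfolding sup using seq m by (intro nn_integral_monotone_convergence_SUP[symmetric]) simp_all
  finally show ?case .
qed

lemma vimage_image_sum [simp]:
  "Inl -` Inl ` A = A" "Inr -` Inl ` A = {}" "Inl -` Inr ` B = {}" "Inr -` Inr ` B = B"
  by auto

text \<open>
  What the theory of couplings uses of the measure of the bipartite network of a hypernetwork.
\<close>

locale half_sum =
  fixes \<mu> :: "'a measure" and \<nu> :: "'b measure" and M :: "('a + 'b) measure"
  assumes prob: "prob_space \<mu>" "prob_space \<nu>"
    and sets_iff: "\<And>S. S \<in> sets M \<longleftrightarrow> Inl -` S \<in> sets \<mu> \<and> Inr -` S \<in> sets \<nu>"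
    and emeasure: "\<And>S. S \<in> sets M \<Longrightarrow> emeasure M S = (emeasure \<mu> (Inl -` S) + emeasure \<nu> (Inr -` S)) / 2"

lemma Inl_borel_of: "Inl \<in> borel_of X \<rightarrow>\<^sub>M borel_of (disjoint_union_topology X Y)"
  and Inr_borel_of: "Inr \<in> borel_of Y \<rightarrow>\<^sub>M borel_of (disjoint_union_topology X Y)"
proof -
  show "Inl \<in> borel_of X \<rightarrow>\<^sub>M borel_of (disjoint_union_topology X Y)"
    by (rule measurable_borel_of)
       (auto simp: space_borel_of topspace_disjoint_union_topology openin_disjoint_union_topology
         intro!: openin_borel_of)
  show "Inr \<in> borel_of Y \<rightarrow>\<^sub>M borel_of (disjoint_union_topology X Y)"
    by (rule measurable_borel_of)
       (auto simp: space_borel_of topspace_disjoint_union_topology openin_disjoint_union_topology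
         intro!: openin_borel_of)
qed

lemma open_embedding_image_borel_of:
  assumes f: "inj f" "\<And>U. openin X U \<Longrightarrow> openin Z (f ` U)" and A: "A \<in> sets (borel_of X)"
  shows "f ` A \<in> sets (borel_of Z)"
  using A unfolding sets_borel_of[of X]
proof (induction rule: sigma_sets.induct)
  case (Basic U)
  then show ?case using f(2) by (auto intro: openin_borel_of)
next
  case (Compl A)
  have "f ` (topspace X - A) = f ` topspace X - f ` A" by (rule image_set_diff[OF f(1)])
  then show ?case using Compl f(2)[OF openin_topspace] by (auto intro: openin_borel_of)
next
  case (Union F)
  then show ?case by (auto simp: image_UN)
qed auto

lemma sets_borel_of_disjoint_union:
  "S \<in> sets (borel_of (disjoint_union_topology X Y)) \<longleftrightarrow>
     Inl -` S \<in> sets (borel_of X) \<and> Inr -` S \<in> sets (borel_of Y)"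
proof
  assume S: "S \<in> sets (borel_of (disjoint_union_topology X Y))"
  then have "S \<subseteq> topspace X <+> topspace Y"
    using sets.sets_into_space[OF S] by (simp add: space_borel_of topspace_disjoint_union_topology)
  then have "Inl -` S = Inl -` S \<inter> space (borel_of X)" "Inr -` S = Inr -` S \<inter> space (borel_of Y)"
    by (auto simp: space_borel_of)
  then show "Inl -` S \<in> sets (borel_of X) \<and> Inr -` S \<in> sets (borel_of Y)"
    using measurable_sets[OF Inl_borel_of S] measurable_sets[OF Inr_borel_of S] by simp
next
  assume S: "Inl -` S \<in> sets (borel_of X) \<and> Inr -` S \<in> sets (borel_of Y)"
  have "S = Inl ` (Inl -` S) \<union> Inr ` (Inr -` S)"
  proof (intro set_eqI iffI)
    fix x assume "x \<in> S" then show "x \<in> Inl ` (Inl -` S) \<union> Inr ` (Inr -` S)" by (cases x) auto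
  qed auto
  moreover have "Inl ` (Inl -` S) \<in> sets (borel_of (disjoint_union_topology X Y))"
    "Inr ` (Inr -` S) \<in> sets (borel_of (disjoint_union_topology X Y))"
    using S by (auto intro!: open_embedding_image_borel_of[of Inl X] open_embedding_image_borel_of[of Inr Y]
        simp: openin_disjoint_union_topology simp del: image_vimage_eq)
  ultimately show "S \<in> sets (borel_of (disjoint_union_topology X Y))" by (metis sets.Un)
qed

lemma half_sum_bip:
  assumes H: "measure_hypernetwork H"
  shows "half_sum (hmeas1 H) (hmeas2 H) (nmeas (bip H))"
    and "sets (nmeas (bip H)) = sets (borel_of (nspace (bip H)))"
proof -
  let ?Z = "disjoint_union_topology (hspace1 H) (hspace2 H)"
  have p: "prob_space (hmeas1 H)" "prob_space (hmeas2 H)"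
    and s: "sets (hmeas1 H) = sets (borel_of (hspace1 H))" "sets (hmeas2 H) = sets (borel_of (hspace2 H))"
    using H by (auto simp: measure_hypernetwork_def full_borel_prob_def)
  have m: "Inl \<in> hmeas1 H \<rightarrow>\<^sub>M borel_of ?Z" "Inr \<in> hmeas2 H \<rightarrow>\<^sub>M borel_of ?Z"
    using Inl_borel_of Inr_borel_of s by (auto cong: measurable_cong_sets)
  have eq: "nmeas (bip H) = average_measure (borel_of ?Z) (distr (hmeas1 H) (borel_of ?Z) Inl) (distr (hmeas2 H) (borel_of ?Z) Inr)"
    by (simp add: bip_def Let_def)
  show "sets (nmeas (bip H)) = sets (borel_of (nspace (bip H)))"
    by (simp add: eq) (simp add: bip_def Let_def)
  show "half_sum (hmeas1 H) (hmeas2 H) (nmeas (bip H))"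
  proof (intro half_sum.intro p)
    show "S \<in> sets (nmeas (bip H)) \<longleftrightarrow> Inl -` S \<in> sets (hmeas1 H) \<and> Inr -` S \<in> sets (hmeas2 H)" for S
      by (simp add: eq s sets_borel_of_disjoint_union)
    fix S assume "S \<in> sets (nmeas (bip H))"
    then have S: "S \<in> sets (borel_of ?Z)" by (simp add: eq)
    then have "Inl -` S \<inter> space (hmeas1 H) = Inl -` S" "Inr -` S \<inter> space (hmeas2 H) = Inr -` S"
      by (auto intro!: sets.Int_space_eq2 simp: s sets_borel_of_disjoint_union)
    then show "emeasure (nmeas (bip H)) S = (emeasure (hmeas1 H) (Inl -` S) + emeasure (hmeas2 H) (Inr -` S)) / 2"
      unfolding eq using S m by (simp add: emeasure_average_measure emeasure_distr)
  qed
qed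

context half_sum
begin

lemma Plus_sets: "A \<in> sets \<mu> \<Longrightarrow> B \<in> sets \<nu> \<Longrightarrow> A <+> B \<in> sets M"
proof -
  have "Inl -` (A <+> B) = A" "Inr -` (A <+> B) = B" by auto
  then show "A \<in> sets \<mu> \<Longrightarrow> B \<in> sets \<nu> \<Longrightarrow> A <+> B \<in> sets M" by (simp add: sets_iff)
qed

lemma space: "space M = space \<mu> <+> space \<nu>"
proof
  show "space \<mu> <+> space \<nu> \<subseteq> space M" by (rule sets.sets_into_space[OF Plus_sets]) auto
  show "space M \<subseteq> space \<mu> <+> space \<nu>"
  proof
    fix z assume z: "z \<in> space M"
    have "Inl -` space M \<in> sets \<mu>" "Inr -` space M \<in> sets \<nu>" using sets_iff[of "space M"] by auto
    then show "z \<in> space \<mu> <+> space \<nu>" using z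
      by (cases z) (auto dest!: sets.sets_into_space)
  qed
qed

lemma Inl_measurable: "Inl \<in> \<mu> \<rightarrow>\<^sub>M M" and Inr_measurable: "Inr \<in> \<nu> \<rightarrow>\<^sub>M M"
  by (rule measurableI, auto simp: space sets_iff)+

lemma Inl_image: "A \<in> sets \<mu> \<Longrightarrow> Inl ` A \<in> sets M" and Inr_image: "B \<in> sets \<nu> \<Longrightarrow> Inr ` B \<in> sets M"
  using Plus_sets[of A "{}"] Plus_sets[of "{}" B] by (auto simp: Plus_def)

lemma measurable_case_sum:
  assumes "f \<in> \<mu> \<rightarrow>\<^sub>M N" "g \<in> \<nu> \<rightarrow>\<^sub>M N"
  shows "case_sum f g \<in> M \<rightarrow>\<^sub>M N"
proof (rule measurableI)
  fix z assume "z \<in> space M"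
  then show "case_sum f g z \<in> space N" using assms by (auto simp: space dest: measurable_space)
next
  fix S assume S: "S \<in> sets N"
  have "Inl -` (case_sum f g -` S \<inter> space M) = f -` S \<inter> space \<mu>"
    "Inr -` (case_sum f g -` S \<inter> space M) = g -` S \<inter> space \<nu>"
    by (auto simp: space)
  then show "case_sum f g -` S \<inter> space M \<in> sets M" using S assms by (simp add: sets_iff)
qed

lemma prob_space_M: "prob_space M"
proof
  have "Inl -` space M = space \<mu>" "Inr -` space M = space \<nu>" by (auto simp: space)
  then show "emeasure M (space M) = 1"
    using prob by (simp add: emeasure prob_space.emeasure_space_1)
qed

lemma M_eq: "M = average_measure M (distr \<mu> M Inl) (distr \<nu> M Inr)"
proof (rule measure_eqI)
  fix S assume S: "S \<in> sets M"
  then have "Inl -` S \<inter> space \<mu> = Inl -` S" "Inr -` S \<inter> space \<nu> = Inr -` S"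
    by (auto intro!: sets.Int_space_eq2 simp: sets_iff)
  then show "emeasure M S = emeasure (average_measure M (distr \<mu> M Inl) (distr \<nu> M Inr)) S"
    using S by (simp add: emeasure_average_measure emeasure_distr Inl_measurable Inr_measurable emeasure)
qed simp

lemma nn_integral:
  assumes f: "f \<in> borel_measurable M"
  shows "(\<integral>\<^sup>+z. f z \<partial>M) = ((\<integral>\<^sup>+x. f (Inl x) \<partial>\<mu>) + (\<integral>\<^sup>+y. f (Inr y) \<partial>\<nu>)) / 2"
  by (subst M_eq) (simp add: nn_integral_average_measure f nn_integral_distr Inl_measurable Inr_measurable)

end

text \<open>
  The disjoint union is a coproduct.
\<close>

lemma continuous_map_case_sum:
  assumes f: "continuous_map X W f" and g: "continuous_map Y W g"
  shows "continuous_map (disjoint_union_topology X Y) W (case_sum f g)"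
  unfolding continuous_map_def
proof (intro conjI allI impI)
  show "case_sum f g \<in> topspace (disjoint_union_topology X Y) \<rightarrow> topspace W"
    using f g by (auto simp: continuous_map_def topspace_disjoint_union_topology)
  fix U assume U: "openin W U"
  let ?S = "{z \<in> topspace (disjoint_union_topology X Y). case_sum f g z \<in> U}"
  have "Inl -` ?S = {x \<in> topspace X. f x \<in> U}" "Inr -` ?S = {y \<in> topspace Y. g y \<in> U}"
    by (auto simp: topspace_disjoint_union_topology)
  then show "openin (disjoint_union_topology X Y) ?S"
    using U f g by (simp add: openin_disjoint_union_topology continuous_map_def)
qed

lemma rectangle_base_prod_topology:
  assumes "second_countable X" "second_countable Y"
  shows "\<exists>\<R>. countable \<R> \<and> (\<forall>R\<in>\<R>. \<exists>U V. openin X U \<and> openin Y V \<and> R = U \<times> V) \<and>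
    (\<forall>W z. openin (prod_topology X Y) W \<longrightarrow> z \<in> W \<longrightarrow> (\<exists>R\<in>\<R>. z \<in> R \<and> R \<subseteq> W))"
proof -
  obtain \<B> where B: "countable \<B>" "\<And>V. V \<in> \<B> \<Longrightarrow> openin X V"
    "\<And>U x. openin X U \<Longrightarrow> x \<in> U \<Longrightarrow> \<exists>V\<in>\<B>. x \<in> V \<and> V \<subseteq> U"
    using assms(1) unfolding second_countable_def by metis
  obtain \<C> where C: "countable \<C>" "\<And>V. V \<in> \<C> \<Longrightarrow> openin Y V"
    "\<And>U x. openin Y U \<Longrightarrow> x \<in> U \<Longrightarrow> \<exists>V\<in>\<C>. x \<in> V \<and> V \<subseteq> U"
    using assms(2) unfolding second_countable_def by metis
  show ?thesis
  proof (intro exI[of _ "(\<lambda>(U, V). U \<times> V) ` (\<B> \<times> \<C>)"] conjI allI impI)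
    fix W z assume W: "openin (prod_topology X Y) W" "z \<in> W"
    then have "(fst z, snd z) \<in> W" by simp
    with W(1) obtain U V where UV: "openin X U" "openin Y V" "fst z \<in> U" "snd z \<in> V" "U \<times> V \<subseteq> W"
      unfolding openin_prod_topology_alt by (elim allE impE exE conjE) assumption+
    obtain U' where U': "U' \<in> \<B>" "fst z \<in> U'" "U' \<subseteq> U" using B(3)[OF UV(1,3)] by blast
    obtain V' where V': "V' \<in> \<C>" "snd z \<in> V'" "V' \<subseteq> V" using C(3)[OF UV(2,4)] by blast
    have "U' \<times> V' \<subseteq> W" using U'(3) V'(3) UV(5) by blast
    then show "\<exists>R\<in>(\<lambda>(U, V). U \<times> V) ` (\<B> \<times> \<C>). z \<in> R \<and> R \<subseteq> W"
      using U' V' by (intro bexI[of _ "U' \<times> V'"]) (auto simp: mem_Times_iff)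
  next
    show "countable ((\<lambda>(U, V). U \<times> V) ` (\<B> \<times> \<C>))" using B(1) C(1) by (intro countable_image countable_SIGMA)
    show "\<forall>R\<in>(\<lambda>(U, V). U \<times> V) ` (\<B> \<times> \<C>). \<exists>U V. openin X U \<and> openin Y V \<and> R = U \<times> V"
      using B(2) C(2) by fast
  qed
qed

lemma second_countable_prod_topology:
  assumes "second_countable X" "second_countable Y"
  shows "second_countable (prod_topology X Y)"
proof -
  obtain \<R> where R: "countable \<R>" "\<forall>R\<in>\<R>. \<exists>U V. openin X U \<and> openin Y V \<and> R = U \<times> V"
    "\<forall>W z. openin (prod_topology X Y) W \<longrightarrow> z \<in> W \<longrightarrow> (\<exists>R\<in>\<R>. z \<in> R \<and> R \<subseteq> W)"
    using rectangle_base_prod_topology[OF assms] by blast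
  have "\<forall>R\<in>\<R>. openin (prod_topology X Y) R" using R(2) by (auto simp: openin_prod_Times_iff)
  then show ?thesis
    using R(1,3) unfolding second_countable_def by (intro exI[of _ \<R>]) simp
qed

lemma measurable_base_prod_topology:
  assumes "second_countable X" "second_countable Y"
  shows "\<exists>\<R>. countable \<R> \<and> \<R> \<subseteq> sets (borel_of X \<Otimes>\<^sub>M borel_of Y) \<and>
    (\<forall>W z. openin (prod_topology X Y) W \<longrightarrow> z \<in> W \<longrightarrow> (\<exists>R\<in>\<R>. z \<in> R \<and> R \<subseteq> W))"
proof -
  obtain \<R> where R: "countable \<R>" "\<forall>R\<in>\<R>. \<exists>U V. openin X U \<and> openin Y V \<and> R = U \<times> V"
    "\<forall>W z. openin (prod_topology X Y) W \<longrightarrow> z \<in> W \<longrightarrow> (\<exists>R\<in>\<R>. z \<in> R \<and> R \<subseteq> W)"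
    using rectangle_base_prod_topology[OF assms] by blast
  have "\<R> \<subseteq> sets (borel_of X \<Otimes>\<^sub>M borel_of Y)" using R(2) by (auto intro!: pair_measureI openin_borel_of)
  then show ?thesis using R(1,3) by blast
qed

text \<open>
  An open set is a union of basic rectangles, of which there are only countably many.
\<close>

lemma open_prod_measurable:
  assumes "second_countable X" "second_countable Y" and W: "openin (prod_topology X Y) W"
  shows "W \<in> sets (borel_of X \<Otimes>\<^sub>M borel_of Y)"
proof -
  obtain \<R> where R: "countable \<R>" "\<R> \<subseteq> sets (borel_of X \<Otimes>\<^sub>M borel_of Y)"
    "\<forall>W z. openin (prod_topology X Y) W \<longrightarrow> z \<in> W \<longrightarrow> (\<exists>R\<in>\<R>. z \<in> R \<and> R \<subseteq> W)"
    using measurable_base_prod_topology[OF assms(1,2)] by blast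
  have "W = \<Union>{R \<in> \<R>. R \<subseteq> W}" using R(3) W by blast
  also have "\<dots> \<in> sets (borel_of X \<Otimes>\<^sub>M borel_of Y)"
    using R(2) by (intro sets.countable_Union countable_subset[OF _ R(1)]) auto
  finally show ?thesis .
qed

text \<open>
  With base points in \<open>X\<close> and \<open>Y\<close>, the disjoint union is a retract of \<open>X \<times> Y \<times> {True, False}\<close>, where
  the third component says which summand is meant.  Complete metrizability, second countability and
  compactness are inherited from the product; this avoids constructing a metric.
\<close>

lemma polish_disjoint_union:
  assumes X: "polish X" "topspace X \<noteq> {}" and Y: "polish Y" "topspace Y \<noteq> {}"
  shows "polish (disjoint_union_topology X Y)"
    and "compact_space X \<Longrightarrow> compact_space Y \<Longrightarrow> compact_space (disjoint_union_topology X Y)"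
proof -
  let ?Z = "disjoint_union_topology X Y"
  let ?D = "discrete_topology (UNIV :: bool set)"
  let ?P = "prod_topology X (prod_topology Y ?D)"
  obtain x0 y0 where x0: "x0 \<in> topspace X" and y0: "y0 \<in> topspace Y" using X(2) Y(2) by blast
  define g where "g = (\<lambda>(x, y, b). if b then Inl x else (Inr y :: 'a + 'b))"
  define s :: "'a + 'b \<Rightarrow> 'a \<times> 'b \<times> bool" where "s = case_sum (\<lambda>x. (x, y0, True)) (\<lambda>y. (x0, y, False))"
  have g: "continuous_map ?P ?Z g"
    unfolding continuous_map_def
  proof (intro conjI allI impI)
    show "g \<in> topspace ?P \<rightarrow> topspace ?Z" by (auto simp: g_def topspace_disjoint_union_topology)
    fix W assume W: "openin ?Z W"
    then have "openin X (Inl -` W)" "openin Y (Inr -` W)" by (auto simp: openin_disjoint_union_topology)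
    then have "openin ?P (Inl -` W \<times> (topspace Y \<times> {True}) \<union> topspace X \<times> (Inr -` W \<times> {False}))"
      by (intro openin_Un) (auto simp: openin_prod_Times_iff)
    also have "Inl -` W \<times> (topspace Y \<times> {True}) \<union> topspace X \<times> (Inr -` W \<times> {False}) = {p \<in> topspace ?P. g p \<in> W}"
      using openin_subset[OF W] by (auto simp: g_def topspace_disjoint_union_topology split: if_splits)
    finally show "openin ?P {p \<in> topspace ?P. g p \<in> W}" .
  qed
  have s: "continuous_map ?Z ?P s"
    unfolding s_def using x0 y0 by (intro continuous_map_case_sum) (simp_all add: continuous_map_pairwise o_def)
  have gs: "g (s z) = z" for z by (auto simp: g_def s_def split: sum.splits)
  have ret: "retraction_map ?P ?Z g"
    unfolding retraction_map_def retraction_maps_def using g s gs by blast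
  have "completely_metrizable_space ?P"
    using X Y by (auto simp: polish_def completely_metrizable_space_prod_topology completely_metrizable_space_discrete_topology)
  with ret have cm: "completely_metrizable_space ?Z" by (rule completely_metrizable_space_retraction_map_image)
  have "second_countable ?P"
    using X Y by (auto simp: polish_def second_countable_discrete_topology intro!: second_countable_prod_topology)
  with ret have "second_countable ?Z" by (rule second_countable_retraction_map_image)
  with cm show "polish ?Z" by (simp add: polish_def)
  show "compact_space ?Z" if "compact_space X" "compact_space Y"
  proof -
    have "compact_space ?P" using that by (simp add: compact_space_prod_topology compact_space_discrete_topology)
    then have "compactin ?Z (g ` topspace ?P)"
      using g by (intro image_compactin) (auto simp: compact_space_def)
    moreover have "g ` topspace ?P = topspace ?Z"
    proof
      show "g ` topspace ?P \<subseteq> topspace ?Z" using g by (auto simp: continuous_map_def)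
      show "topspace ?Z \<subseteq> g ` topspace ?P"
      proof
        fix z assume "z \<in> topspace ?Z"
        then have "s z \<in> topspace ?P" using s by (auto simp: continuous_map_def)
        then show "z \<in> g ` topspace ?P" using gs[of z] by (metis image_eqI)
      qed
    qed
    ultimately show ?thesis by (simp add: compact_space_def)
  qed
qed

lemma nspace_bip: "nspace (bip H) = disjoint_union_topology (hspace1 H) (hspace2 H)"
  and nleft_bip: "nleft (bip H) = Inl ` topspace (hspace1 H)"
  and nright_bip: "nright (bip H) = Inr ` topspace (hspace2 H)"
  and nweight_bip: "nweight (bip H) = restrict (incidence_weight (hweight H))
     ((topspace (hspace1 H) <+> topspace (hspace2 H)) \<times> (topspace (hspace1 H) <+> topspace (hspace2 H)))"
  by (simp_all add: bip_def Let_def topspace_disjoint_union_topology)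

lemma hypernetworkD:
  assumes "measure_hypernetwork H"
  shows "prob_space (hmeas1 H)" "prob_space (hmeas2 H)"
    "space (hmeas1 H) = topspace (hspace1 H)" "space (hmeas2 H) = topspace (hspace2 H)"
    "sets (hmeas1 H) = sets (borel_of (hspace1 H))" "sets (hmeas2 H) = sets (borel_of (hspace2 H))"
    "topspace (hspace1 H) \<noteq> {}" "topspace (hspace2 H) \<noteq> {}"
    "hweight H \<in> borel_measurable (hmeas1 H \<Otimes>\<^sub>M hmeas2 H)"
    "\<And>x y. x \<in> topspace (hspace1 H) \<Longrightarrow> y \<in> topspace (hspace2 H) \<Longrightarrow> 0 \<le> hweight H (x, y)"
proof -
  show 1: "prob_space (hmeas1 H)" "prob_space (hmeas2 H)"
    "sets (hmeas1 H) = sets (borel_of (hspace1 H))" "sets (hmeas2 H) = sets (borel_of (hspace2 H))"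
    "hweight H \<in> borel_measurable (hmeas1 H \<Otimes>\<^sub>M hmeas2 H)"
    using assms by (auto simp: measure_hypernetwork_def full_borel_prob_def)
  show 2: "space (hmeas1 H) = topspace (hspace1 H)" "space (hmeas2 H) = topspace (hspace2 H)"
    using sets_eq_imp_space_eq[OF 1(3)] sets_eq_imp_space_eq[OF 1(4)] by (auto simp: space_borel_of)
  show "topspace (hspace1 H) \<noteq> {}" "topspace (hspace2 H) \<noteq> {}"
    using prob_space.not_empty[OF 1(1)] prob_space.not_empty[OF 1(2)] unfolding 2 by auto
  show "0 \<le> hweight H (x, y)" if "x \<in> topspace (hspace1 H)" "y \<in> topspace (hspace2 H)" for x y
    using assms that by (auto simp: measure_hypernetwork_def PiE_iff)
qed

text \<open>
  Base points extend the partial projections of the disjoint union to \<open>X\<close> and \<open>Y\<close> to total measurable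
  maps, through which the weight factors on each of the four blocks.
\<close>

lemma nweight_bip_measurable:
  fixes H :: "('a, 'b) hypernetwork"
  assumes H: "measure_hypernetwork H"
  shows "nweight (bip H) \<in> borel_measurable (nmeas (bip H) \<Otimes>\<^sub>M nmeas (bip H))"
proof -
  interpret half_sum "hmeas1 H" "hmeas2 H" "nmeas (bip H)"
    by (rule half_sum_bip[OF H])
  note D = hypernetworkD[OF H]
  obtain x0 y0 where x0: "x0 \<in> space (hmeas1 H)" and y0: "y0 \<in> space (hmeas2 H)"
    using prob_space.not_empty[OF D(1)] prob_space.not_empty[OF D(2)] by blast
  define pl :: "'a + 'b \<Rightarrow> 'a" where "pl = case_sum (\<lambda>x. x) (\<lambda>_. x0)"
  define pr :: "'a + 'b \<Rightarrow> 'b" where "pr = case_sum (\<lambda>_. y0) (\<lambda>y. y)"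
  have [measurable]: "pl \<in> nmeas (bip H) \<rightarrow>\<^sub>M hmeas1 H" "pr \<in> nmeas (bip H) \<rightarrow>\<^sub>M hmeas2 H"
    unfolding pl_def pr_def using x0 y0 by (intro measurable_case_sum; simp)+
  define il :: "'a + 'b \<Rightarrow> bool" where "il = case_sum (\<lambda>_. True) (\<lambda>_. False)"
  have [measurable]: "il \<in> nmeas (bip H) \<rightarrow>\<^sub>M count_space UNIV"
    unfolding il_def by (intro measurable_case_sum; simp)
  note [measurable] = D(9)
  have "(\<lambda>z. if il (fst z) then (if il (snd z) then 0 else hweight H (pl (fst z), pr (snd z)))
      else (if il (snd z) then hweight H (pl (snd z), pr (fst z)) else 0))
    \<in> borel_measurable (nmeas (bip H) \<Otimes>\<^sub>M nmeas (bip H))"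
    by measurable
  then show ?thesis
    by (rule measurable_cong[THEN iffD1, rotated])
       (auto simp: nweight_bip space_pair_measure space D(3,4) il_def pl_def pr_def)
qed

lemma bip_labeled_bipartite_network:
  assumes H: "measure_hypernetwork H"
  shows "labeled_bipartite_network (bip H)"
proof -
  interpret half_sum "hmeas1 H" "hmeas2 H" "nmeas (bip H)"
    by (rule half_sum_bip[OF H])
  note D = hypernetworkD[OF H]
  have top: "topspace (nspace (bip H)) = topspace (hspace1 H) <+> topspace (hspace2 H)"
    by (simp add: nspace_bip topspace_disjoint_union_topology)
  have pol: "polish (nspace (bip H))"
    unfolding nspace_bip using H D by (intro polish_disjoint_union) (auto simp: measure_hypernetwork_def)
  have supp: "measure_support (nspace (bip H)) (nmeas (bip H)) = topspace (nspace (bip H))"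
  proof -
    have "emeasure (nmeas (bip H)) U > 0" if U: "openin (nspace (bip H)) U" "z \<in> U" for U z
    proof -
      have o: "openin (hspace1 H) (Inl -` U)" "openin (hspace2 H) (Inr -` U)"
        using U by (auto simp: nspace_bip openin_disjoint_union_topology)
      have "emeasure (hmeas1 H) (Inl -` U) > 0 \<or> emeasure (hmeas2 H) (Inr -` U) > 0"
      proof (cases z)
        case (Inl x)
        then have "x \<in> measure_support (hspace1 H) (hmeas1 H)"
          using H U openin_subset[OF o(1)] by (auto simp: measure_hypernetwork_def full_borel_prob_def)
        then show ?thesis using o(1) U Inl by (auto simp: measure_support_def)
      next
        case (Inr y)
        then have "y \<in> measure_support (hspace2 H) (hmeas2 H)"
          using H U openin_subset[OF o(2)] by (auto simp: measure_hypernetwork_def full_borel_prob_def)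
        then show ?thesis using o(2) U Inr by (auto simp: measure_support_def)
      qed
      moreover have "U \<in> sets (nmeas (bip H))"
        using o D by (simp add: sets_iff openin_borel_of)
      ultimately show ?thesis
        by (auto simp: emeasure zero_less_iff_neq_zero)
    qed
    then show ?thesis by (auto simp: measure_support_def)
  qed
  have nonneg: "nweight (bip H) \<in> topspace (nspace (bip H)) \<times> topspace (nspace (bip H)) \<rightarrow>\<^sub>E {0..}"
    using D(10) by (auto simp: nweight_bip top PiE_iff)
  have bnd: "bounded (nweight (bip H) ` (topspace (nspace (bip H)) \<times> topspace (nspace (bip H))))"
  proof -
    obtain B where B: "\<And>x y. x \<in> topspace (hspace1 H) \<Longrightarrow> y \<in> topspace (hspace2 H) \<Longrightarrow> norm (hweight H (x, y)) \<le> B"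
      using H unfolding measure_hypernetwork_def bounded_iff by auto
    have "0 \<le> B" using B D(7,8) norm_ge_zero order_trans by blast
    then show ?thesis using B
      unfolding bounded_iff by (intro exI[of _ B]) (auto simp: nweight_bip top)
  qed
  have half: "measure (nmeas (bip H)) (nleft (bip H)) = 1/2" "measure (nmeas (bip H)) (nright (bip H)) = 1/2"
  proof -
    have h: "(1/2 :: ennreal) = ennreal (1/2)" using divide_ennreal[of 1 2] by (simp only: ennreal_1 ennreal_numeral)
    have "emeasure (nmeas (bip H)) (nleft (bip H)) = 1/2"
      using Inl_image[OF sets.top] prob(1)
      by (simp add: nleft_bip emeasure prob_space.emeasure_space_1 flip: D(3))
    from this[unfolded h] show "measure (nmeas (bip H)) (nleft (bip H)) = 1/2" by (rule measure_eq_emeasure_eq_ennreal[rotated]) simp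
    have "emeasure (nmeas (bip H)) (nright (bip H)) = 1/2"
      using Inr_image[OF sets.top] prob(2)
      by (simp add: nright_bip emeasure prob_space.emeasure_space_1 flip: D(4))
    from this[unfolded h] show "measure (nmeas (bip H)) (nright (bip H)) = 1/2" by (rule measure_eq_emeasure_eq_ennreal[rotated]) simp
  qed
  have op: "openin (nspace (bip H)) (nleft (bip H))" "openin (nspace (bip H)) (nright (bip H))"
  proof -
    show "openin (nspace (bip H)) (nleft (bip H))" "openin (nspace (bip H)) (nright (bip H))"
      unfolding nspace_bip nleft_bip nright_bip openin_disjoint_union_topology by auto
  qed
  show ?thesis
    unfolding labeled_bipartite_network_def measure_network_def bipartite_decomposition_def full_borel_prob_def
  proof (intro conjI pol supp nonneg bnd half op half_sum_bip(2)[OF H] prob_space_M nweight_bip_measurable[OF H])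
    show "nleft (bip H) \<inter> nright (bip H) = {}" "nleft (bip H) \<union> nright (bip H) = topspace (nspace (bip H))"
      by (auto simp: nleft_bip nright_bip top)
  qed (auto simp: nleft_bip nright_bip nweight_bip)
qed

lemma bip_compact:
  assumes "compact_hypernetwork H"
  shows "compact_labeled_bipartite_network (bip H)"
proof -
  have H: "measure_hypernetwork H" and c: "compact_space (hspace1 H)" "compact_space (hspace2 H)"
    using assms by (auto simp: compact_hypernetwork_def)
  then have "compact_space (nspace (bip H))"
    unfolding nspace_bip using hypernetworkD(7,8)[OF H]
    by (intro polish_disjoint_union(2)) (auto simp: measure_hypernetwork_def)
  then show ?thesis
    using bip_labeled_bipartite_network[OF H] by (simp add: compact_labeled_bipartite_network_def)
qed

section \<open>Couplings of disjoint unions\<close>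

lemma ennreal_quarter: "(x / 2 + y / 2) / 2 = (x + y) / (4::ennreal)"
proof -
  have "inverse 2 * inverse 2 = (inverse 4 :: ennreal)"
    by (subst ennreal_inverse_mult[symmetric]) simp_all
  then show ?thesis
    by (simp add: divide_ennreal_def mult.assoc flip: distrib_right)
qed

lemma ennreal_half_add: "x / 2 + x / 2 = (x :: ennreal)"
proof -
  have "x / 2 + x / 2 = x * 2 / 2" by (simp add: add_divide_distrib_ennreal[symmetric] mult_2_right)
  then show ?thesis by (subst (asm) ennreal_mult_divide_eq) simp_all
qed

definition sum_coupling ::
  "('a + 'b) measure \<Rightarrow> ('c + 'd) measure \<Rightarrow> ('a \<times> 'c) measure \<Rightarrow> ('b \<times> 'd) measure \<Rightarrow>
   (('a + 'b) \<times> ('c + 'd)) measure" where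
  "sum_coupling M M' \<pi> \<xi> = average_measure (M \<Otimes>\<^sub>M M')
     (distr \<pi> (M \<Otimes>\<^sub>M M') (map_prod Inl Inl)) (distr \<xi> (M \<Otimes>\<^sub>M M') (map_prod Inr Inr))"

lemma bip_coupling_eq: "bip_coupling H H' (\<pi>, \<xi>) = sum_coupling (nmeas (bip H)) (nmeas (bip H')) \<pi> \<xi>"
  by (simp add: bip_coupling_def sum_coupling_def Let_def)

text \<open>
  A coupling of the left parts and a coupling of the right parts; their average \<open>J\<close> is concentrated on
  the two blocks \<open>l\<close> and \<open>r\<close> of the product.
\<close>

locale summed = L: half_sum \<mu> \<nu> M + R: half_sum \<mu>' \<nu>' M'
  for \<mu> :: "'a measure" and \<nu> :: "'b measure" and M and \<mu>' :: "'c measure" and \<nu>' :: "'d measure" and M' +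
  fixes \<pi> \<xi>
  assumes \<pi>: "\<pi> \<in> couplings \<mu> \<mu>'" and \<xi>: "\<xi> \<in> couplings \<nu> \<nu>'"
begin

abbreviation "J \<equiv> sum_coupling M M' \<pi> \<xi>"
abbreviation "l \<equiv> map_prod Inl Inl :: 'a \<times> 'c \<Rightarrow> ('a + 'b) \<times> ('c + 'd)"
abbreviation "r \<equiv> map_prod Inr Inr :: 'b \<times> 'd \<Rightarrow> ('a + 'b) \<times> ('c + 'd)"

lemma l_measurable: "l \<in> \<pi> \<rightarrow>\<^sub>M M \<Otimes>\<^sub>M M'" and r_measurable: "r \<in> \<xi> \<rightarrow>\<^sub>M M \<Otimes>\<^sub>M M'"
proof -
  note [measurable] = L.Inl_measurable R.Inl_measurable L.Inr_measurable R.Inr_measurable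
  show "l \<in> \<pi> \<rightarrow>\<^sub>M M \<Otimes>\<^sub>M M'"
    by (subst measurable_cong_sets[OF couplingsD(2)[OF \<pi>] refl]) (simp add: map_prod_def)
  show "r \<in> \<xi> \<rightarrow>\<^sub>M M \<Otimes>\<^sub>M M'"
    by (subst measurable_cong_sets[OF couplingsD(2)[OF \<xi>] refl]) (simp add: map_prod_def)
qed

lemma J_sets: "sets J = sets (M \<Otimes>\<^sub>M M')" and J_prob: "prob_space J"
  unfolding sum_coupling_def
  by (auto intro!: prob_space_average_measure prob_space.prob_space_distr couplingsD[OF \<pi>] couplingsD[OF \<xi>]
      l_measurable r_measurable)

lemma nn_integral_J:
  assumes f: "f \<in> borel_measurable (M \<Otimes>\<^sub>M M')"
  shows "(\<integral>\<^sup>+z. f z \<partial>J) = ((\<integral>\<^sup>+z. f (l z) \<partial>\<pi>) + (\<integral>\<^sup>+z. f (r z) \<partial>\<xi>)) / 2"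
  unfolding sum_coupling_def
  by (simp add: nn_integral_average_measure f nn_integral_distr l_measurable r_measurable)

lemma J_rectangle:
  assumes S: "S \<in> sets M" "S' \<in> sets M'"
  shows "emeasure J (S \<times> S') = (emeasure \<pi> (Inl -` S \<times> Inl -` S') + emeasure \<xi> (Inr -` S \<times> Inr -` S')) / 2"
proof -
  have 1: "l -` (S \<times> S') \<inter> space \<pi> = Inl -` S \<times> Inl -` S'" "r -` (S \<times> S') \<inter> space \<xi> = Inr -` S \<times> Inr -` S'"
    using S by (auto simp: couplingsD[OF \<pi>] couplingsD[OF \<xi>] L.sets_iff R.sets_iff dest!: sets.sets_into_space)
  show ?thesis unfolding sum_coupling_def
    using S by (simp add: emeasure_average_measure emeasure_distr l_measurable r_measurable 1)
qed

lemma J_coupling: "J \<in> couplings M M'"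
proof (rule couplingsI[OF J_prob J_sets])
  have e: "Inl -` space M = space \<mu>" "Inr -` space M = space \<nu>" "Inl -` space M' = space \<mu>'" "Inr -` space M' = space \<nu>'"
    by (auto simp: L.space R.space)
  show "emeasure J (S \<times> space M') = emeasure M S" if "S \<in> sets M" for S
    using that by (simp add: J_rectangle e L.sets_iff L.emeasure coupling_emeasure_fst[OF \<pi>] coupling_emeasure_fst[OF \<xi>])
  show "emeasure J (space M \<times> S) = emeasure M' S" if "S \<in> sets M'" for S
    using that by (simp add: J_rectangle e R.sets_iff R.emeasure coupling_emeasure_snd[OF \<pi>] coupling_emeasure_snd[OF \<xi>])
qed

lemma AE_J_blocks: "AE z in J. z \<in> Inl ` space \<mu> \<times> Inl ` space \<mu>' \<union> Inr ` space \<nu> \<times> Inr ` space \<nu>'"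
  (is "AE z in J. z \<in> ?S")
proof -
  have [measurable]: "?S \<in> sets (M \<Otimes>\<^sub>M M')"
    by (intro sets.Un pair_measureI L.Inl_image R.Inl_image L.Inr_image R.Inr_image sets.top)
  have f: "indicator (- ?S) \<in> borel_measurable (M \<Otimes>\<^sub>M M')"
    by (simp add: borel_measurable_indicator_iff Compl_eq_Diff_UNIV Int_Diff Diff_Int_distrib2)
  have "(\<integral>\<^sup>+z. indicator (- ?S) (l z) \<partial>\<pi>) = (\<integral>\<^sup>+z. 0 \<partial>\<pi>)" "(\<integral>\<^sup>+z. indicator (- ?S) (r z) \<partial>\<xi>) = (\<integral>\<^sup>+z. 0 \<partial>\<xi>)"
    by (rule nn_integral_cong; auto simp: indicator_def couplingsD[OF \<pi>] couplingsD[OF \<xi>])+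
  then have "(\<integral>\<^sup>+z. indicator (- ?S) z \<partial>J) = 0" using nn_integral_J[OF f] by simp
  then show ?thesis
    using f by (subst (asm) nn_integral_0_iff_AE) (auto simp: J_sets indicator_def cong: measurable_cong_sets)
qed

text \<open>
  The product of an average with itself has four blocks, each weighted by \<open>1/4\<close>.
\<close>

lemma nn_integral_J_J:
  assumes f[measurable]: "f \<in> borel_measurable ((M \<Otimes>\<^sub>M M') \<Otimes>\<^sub>M (M \<Otimes>\<^sub>M M'))"
  shows "(\<integral>\<^sup>+z. f z \<partial>(J \<Otimes>\<^sub>M J)) =
     ((\<integral>\<^sup>+(u, v). f (l u, l v) \<partial>(\<pi> \<Otimes>\<^sub>M \<pi>)) + (\<integral>\<^sup>+(u, v). f (l u, r v) \<partial>(\<pi> \<Otimes>\<^sub>M \<xi>)) +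
      ((\<integral>\<^sup>+(u, v). f (r u, l v) \<partial>(\<xi> \<Otimes>\<^sub>M \<pi>)) + (\<integral>\<^sup>+(u, v). f (r u, r v) \<partial>(\<xi> \<Otimes>\<^sub>M \<xi>)))) / 4"
proof -
  interpret J: prob_space J by (rule J_prob)
  interpret \<pi>: prob_space \<pi> by (rule couplingsD[OF \<pi>])
  interpret \<xi>: prob_space \<xi> by (rule couplingsD[OF \<xi>])
  note [measurable] = l_measurable r_measurable
  have fJ: "f \<in> borel_measurable (J \<Otimes>\<^sub>M J)"
    using f J_sets by (simp cong: measurable_cong_sets sets_pair_measure_cong)
  define F where "F u = ((\<integral>\<^sup>+v. f (u, l v) \<partial>\<pi>) + (\<integral>\<^sup>+v. f (u, r v) \<partial>\<xi>)) / 2" for u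
  have [measurable]: "F \<in> borel_measurable (M \<Otimes>\<^sub>M M')"
    unfolding F_def by measurable
  have "(\<integral>\<^sup>+z. f z \<partial>(J \<Otimes>\<^sub>M J)) = (\<integral>\<^sup>+u. \<integral>\<^sup>+v. f (u, v) \<partial>J \<partial>J)"
    by (rule J.nn_integral_fst[OF fJ, symmetric])
  also have "\<dots> = (\<integral>\<^sup>+u. F u \<partial>J)"
  proof (rule nn_integral_cong)
    fix u assume "u \<in> space J"
    then have u: "u \<in> space (M \<Otimes>\<^sub>M M')" using sets_eq_imp_space_eq[OF J_sets] by simp
    show "(\<integral>\<^sup>+v. f (u, v) \<partial>J) = F u"
      unfolding F_def using u by (intro nn_integral_J) measurable
  qed
  also have "\<dots> = ((\<integral>\<^sup>+u. F (l u) \<partial>\<pi>) + (\<integral>\<^sup>+u. F (r u) \<partial>\<xi>)) / 2"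
    by (rule nn_integral_J) measurable
  also have "(\<integral>\<^sup>+u. F (l u) \<partial>\<pi>) = ((\<integral>\<^sup>+u. (\<integral>\<^sup>+v. f (l u, l v) \<partial>\<pi>) \<partial>\<pi>) + (\<integral>\<^sup>+u. (\<integral>\<^sup>+v. f (l u, r v) \<partial>\<xi>) \<partial>\<pi>)) / 2"
    unfolding F_def by (simp add: nn_integral_divide nn_integral_add)
  also have "(\<integral>\<^sup>+u. F (r u) \<partial>\<xi>) = ((\<integral>\<^sup>+u. (\<integral>\<^sup>+v. f (r u, l v) \<partial>\<pi>) \<partial>\<xi>) + (\<integral>\<^sup>+u. (\<integral>\<^sup>+v. f (r u, r v) \<partial>\<xi>) \<partial>\<xi>)) / 2"
    unfolding F_def by (simp add: nn_integral_divide nn_integral_add)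
  also have "(\<integral>\<^sup>+u. (\<integral>\<^sup>+v. f (l u, l v) \<partial>\<pi>) \<partial>\<pi>) = (\<integral>\<^sup>+(u, v). f (l u, l v) \<partial>(\<pi> \<Otimes>\<^sub>M \<pi>))"
    by (subst \<pi>.nn_integral_fst[symmetric]) (simp_all add: case_prod_beta')
  also have "(\<integral>\<^sup>+u. (\<integral>\<^sup>+v. f (l u, r v) \<partial>\<xi>) \<partial>\<pi>) = (\<integral>\<^sup>+(u, v). f (l u, r v) \<partial>(\<pi> \<Otimes>\<^sub>M \<xi>))"
    by (subst \<xi>.nn_integral_fst[symmetric]) (simp_all add: case_prod_beta')
  also have "(\<integral>\<^sup>+u. (\<integral>\<^sup>+v. f (r u, l v) \<partial>\<pi>) \<partial>\<xi>) = (\<integral>\<^sup>+(u, v). f (r u, l v) \<partial>(\<xi> \<Otimes>\<^sub>M \<pi>))"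
    by (subst \<pi>.nn_integral_fst[symmetric]) (simp_all add: case_prod_beta')
  also have "(\<integral>\<^sup>+u. (\<integral>\<^sup>+v. f (r u, r v) \<partial>\<xi>) \<partial>\<xi>) = (\<integral>\<^sup>+(u, v). f (r u, r v) \<partial>(\<xi> \<Otimes>\<^sub>M \<xi>))"
    by (subst \<xi>.nn_integral_fst[symmetric]) (simp_all add: case_prod_beta')
  finally show ?thesis
    by (simp only: ennreal_quarter)
qed

end

lemma sum_coupling_diagonal:
  assumes "half_sum \<mu> \<nu> M"
  shows "sum_coupling M M (diagonal_coupling \<mu>) (diagonal_coupling \<nu>) = diagonal_coupling M"
proof -
  interpret H: half_sum \<mu> \<nu> M by fact
  interpret summed \<mu> \<nu> M \<mu> \<nu> M "diagonal_coupling \<mu>" "diagonal_coupling \<nu>"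
    by unfold_locales (use assms diagonal_coupling H.prob in auto)
  show ?thesis
  proof (rule measure_eqI_rectangles[OF J_prob J_sets])
    show "sets (diagonal_coupling M) = sets (M \<Otimes>\<^sub>M M)" by (simp add: diagonal_coupling_def)
    fix S S' assume S: "S \<in> sets M" "S' \<in> sets M"
    then show "emeasure J (S \<times> S') = emeasure (diagonal_coupling M) (S \<times> S')"
      using H.prob H.prob_space_M S[unfolded H.sets_iff]
      by (simp add: J_rectangle diagonal_coupling_rectangle H.emeasure)
  qed
qed

text \<open>
  Densities of averaged couplings are given piecewise by densities of their parts, so the formula for
  composites on rectangles splits along the summands.
\<close>

lemma sum_coupling_comp:
  assumes M: "half_sum \<mu> \<nu> M" "half_sum \<mu>' \<nu>' M'" "half_sum \<mu>'' \<nu>'' M''"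
    and \<pi>: "composable \<mu> \<mu>' \<mu>'' \<pi> \<pi>'" and \<xi>: "composable \<nu> \<nu>' \<nu>'' \<xi> \<xi>'"
    and coded: "real_coded M" "real_coded M''"
  shows "sum_coupling M M'' (coupling_comp \<mu> \<mu>' \<mu>'' \<pi>' \<pi>) (coupling_comp \<nu> \<nu>' \<nu>'' \<xi>' \<xi>) =
    coupling_comp M M' M'' (sum_coupling M' M'' \<pi>' \<xi>') (sum_coupling M M' \<pi> \<xi>)"
proof -
  interpret H: half_sum \<mu> \<nu> M by fact
  interpret H': half_sum \<mu>' \<nu>' M' by fact
  interpret H'': half_sum \<mu>'' \<nu>'' M'' by fact
  interpret a: composable \<mu> \<mu>' \<mu>'' \<pi> \<pi>' by fact
  interpret b: composable \<nu> \<nu>' \<nu>'' \<xi> \<xi>' by fact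
  interpret s1: summed \<mu> \<nu> M \<mu>' \<nu>' M' \<pi> \<xi> by unfold_locales (rule a.\<pi> b.\<pi>)+
  interpret s2: summed \<mu>' \<nu>' M' \<mu>'' \<nu>'' M'' \<pi>' \<xi>' by unfold_locales (rule a.\<pi>' b.\<pi>')+
  interpret s3: summed \<mu> \<nu> M \<mu>'' \<nu>'' M'' a.P b.P by unfold_locales (rule a.comp_coupling b.comp_coupling)+
  interpret c: composable M M' M'' s1.J s2.J
    by unfold_locales (use s1.J_coupling s2.J_coupling coded in auto)
  show ?thesis
  proof (rule measure_eqI_rectangles[OF s3.J_prob s3.J_sets c.comp_sets])
    fix S S'' assume S: "S \<in> sets M" and S'': "S'' \<in> sets M''"
    then have sl: "Inl -` S \<in> sets \<mu>" "Inr -` S \<in> sets \<nu>" "Inl -` S'' \<in> sets \<mu>''" "Inr -` S'' \<in> sets \<nu>''"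
      by (auto simp: H.sets_iff H''.sets_iff)
    obtain f1 where f1: "section_density \<mu>' \<pi> (Inl -` S) f1" using section_density_exists[OF a.\<pi> sl(1)] .
    obtain f2 where f2: "section_density \<nu>' \<xi> (Inr -` S) f2" using section_density_exists[OF b.\<pi> sl(2)] .
    obtain g1 where g1: "section_density_fst \<mu>' \<pi>' (Inl -` S'') g1" using section_density_fst_exists[OF a.\<pi>' sl(3)] .
    obtain g2 where g2: "section_density_fst \<nu>' \<xi>' (Inr -` S'') g2" using section_density_fst_exists[OF b.\<pi>' sl(4)] .
    have m: "case_sum f1 f2 \<in> borel_measurable M'" "case_sum g1 g2 \<in> borel_measurable M'"
      using f1 f2 g1 g2 by (auto intro!: H'.measurable_case_sum simp: section_density_def section_density_fst_def)
    have ind: "indicator S' (Inl x) = (indicator (Inl -` S') x :: ennreal)" "indicator S' (Inr y) = (indicator (Inr -` S') y :: ennreal)"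
      for S' :: "('c + 'd) set" and x y by (auto simp: indicator_def)
    have f: "section_density M' s1.J S (case_sum f1 f2)"
      unfolding section_density_def
    proof (intro conjI ballI m)
      fix S' assume S': "S' \<in> sets M'"
      then have "(\<lambda>z. case_sum f1 f2 z * indicator S' z) \<in> borel_measurable M'" using m by simp
      from H'.nn_integral[OF this] f1 f2 S'
      show "emeasure s1.J (S \<times> S') = (\<integral>\<^sup>+z\<in>S'. case_sum f1 f2 z \<partial>M')"
        by (simp add: s1.J_rectangle[OF S S'] section_density_def ind H'.sets_iff)
    qed
    have g: "section_density_fst M' s2.J S'' (case_sum g1 g2)"
      unfolding section_density_fst_def
    proof (intro conjI ballI m)
      fix S' assume S': "S' \<in> sets M'"
      then have "(\<lambda>z. case_sum g1 g2 z * indicator S' z) \<in> borel_measurable M'" using m by simp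
      from H'.nn_integral[OF this] g1 g2 S'
      show "emeasure s2.J (S' \<times> S'') = (\<integral>\<^sup>+z\<in>S'. case_sum g1 g2 z \<partial>M')"
        by (simp add: s2.J_rectangle[OF S' S''] section_density_fst_def ind H'.sets_iff)
    qed
    have "emeasure c.P (S \<times> S'') = (\<integral>\<^sup>+z. case_sum f1 f2 z * case_sum g1 g2 z \<partial>M')"
      by (rule c.comp_rectangle[OF S S'' f g])
    also have "\<dots> = ((\<integral>\<^sup>+x. f1 x * g1 x \<partial>\<mu>') + (\<integral>\<^sup>+y. f2 y * g2 y \<partial>\<nu>')) / 2"
      using m by (subst H'.nn_integral) auto
    also have "\<dots> = emeasure s3.J (S \<times> S'')"
      using s3.J_rectangle[OF S S''] a.comp_rectangle[OF sl(1,3) f1 g1] b.comp_rectangle[OF sl(2,4) f2 g2] by simp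
    finally show "emeasure s3.J (S \<times> S'') = emeasure c.P (S \<times> S'')" by simp
  qed
qed

text \<open>
  Restrict \<open>P\<close> to the block, double it and pull it back along \<open>i\<close> and \<open>i'\<close>.  The marginals are right
  because almost all mass over either image lies in the block.
\<close>

lemma block_coupling:
  assumes P: "P \<in> couplings M M'" and \<mu>: "prob_space \<mu>"
    and i: "i \<in> \<mu> \<rightarrow>\<^sub>M M" "\<And>A. A \<in> sets \<mu> \<Longrightarrow> i ` A \<in> sets M" "\<And>A. A \<in> sets \<mu> \<Longrightarrow> emeasure M (i ` A) = emeasure \<mu> A / 2"
    and i': "i' \<in> \<mu>' \<rightarrow>\<^sub>M M'" "\<And>A. A \<in> sets \<mu>' \<Longrightarrow> i' ` A \<in> sets M'" "\<And>A. A \<in> sets \<mu>' \<Longrightarrow> emeasure M' (i' ` A) = emeasure \<mu>' A / 2"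
    and r: "r \<in> M \<rightarrow>\<^sub>M \<mu>" "\<And>x. x \<in> space \<mu> \<Longrightarrow> r (i x) = x"
    and r': "r' \<in> M' \<rightarrow>\<^sub>M \<mu>'" "\<And>x. x \<in> space \<mu>' \<Longrightarrow> r' (i' x) = x"
    and AE: "AE z in P. fst z \<in> i ` space \<mu> \<longleftrightarrow> snd z \<in> i' ` space \<mu>'"
  shows "\<exists>\<pi>\<in>couplings \<mu> \<mu>'. \<forall>A\<in>sets \<mu>. \<forall>A'\<in>sets \<mu>'. emeasure P (i ` A \<times> i' ` A') = emeasure \<pi> (A \<times> A') / 2"
proof -
  interpret P: prob_space P by (rule couplingsD[OF P])
  define BL where "BL = i ` space \<mu> \<times> i' ` space \<mu>'"
  have rect: "S \<times> S' \<in> sets P" if "S \<in> sets M" "S' \<in> sets M'" for S S'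
    using that by (simp add: couplingsD[OF P])
  have BL[measurable]: "BL \<in> sets P" unfolding BL_def using i(2) i'(2) by (intro rect) auto
  have rm[measurable]: "map_prod r r' \<in> P \<rightarrow>\<^sub>M \<mu> \<Otimes>\<^sub>M \<mu>'"
  proof -
    note [measurable] = r(1) r'(1)
    show ?thesis unfolding map_prod_def
      by (subst measurable_cong_sets[OF couplingsD(2)[OF P] refl]) measurable
  qed
  define \<pi> where "\<pi> = distr (density P (\<lambda>z. 2 * indicator BL z)) (\<mu> \<Otimes>\<^sub>M \<mu>') (map_prod r r')"
  have \<pi>_rect: "emeasure \<pi> (A \<times> A') = 2 * emeasure P (i ` A \<times> i' ` A')" if A: "A \<in> sets \<mu>" "A' \<in> sets \<mu>'" for A A'
  proof -
    have sub: "A \<subseteq> space \<mu>" "A' \<subseteq> space \<mu>'" using A by (auto dest: sets.sets_into_space)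
    have "i ` A \<subseteq> space M" "i' ` A' \<subseteq> space M'"
      using i(2)[OF A(1)] i'(2)[OF A(2)] by (auto dest: sets.sets_into_space)
    then have eq: "BL \<inter> (map_prod r r' -` (A \<times> A') \<inter> space P) = i ` A \<times> i' ` A'"
      using sub r(2) r'(2) by (auto simp: BL_def couplingsD(3)[OF P] subset_eq image_iff) 
    have "emeasure \<pi> (A \<times> A') = (\<integral>\<^sup>+z. 2 * indicator BL z * indicator (map_prod r r' -` (A \<times> A') \<inter> space P) z \<partial>P)"
      unfolding \<pi>_def using A by (simp add: emeasure_distr emeasure_density)
    also have "\<dots> = (\<integral>\<^sup>+z. 2 * indicator (i ` A \<times> i' ` A') z \<partial>P)"
      unfolding eq[symmetric] by (intro nn_integral_cong) (simp add: indicator_def)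
    also have "\<dots> = 2 * emeasure P (i ` A \<times> i' ` A')"
      using A by (subst nn_integral_cmult_indicator) (simp_all add: rect i(2) i'(2))
    finally show ?thesis .
  qed
  have half: "2 * (x / 2) = x" for x :: ennreal
    by (simp add: ennreal_times_divide mult_divide_eq_ennreal mult.commute)
  have fst: "emeasure \<pi> (A \<times> space \<mu>') = emeasure \<mu> A" if A: "A \<in> sets \<mu>" for A
  proof -
    have "emeasure P (i ` A \<times> i' ` space \<mu>') = emeasure P (i ` A \<times> space M')"
    proof (rule emeasure_eq_AE)
      show "AE z in P. z \<in> i ` A \<times> i' ` space \<mu>' \<longleftrightarrow> z \<in> i ` A \<times> space M'"
        using AE sets.sets_into_space[OF A] sets.sets_into_space[OF i'(2)[OF sets.top]]
        by (auto elim!: eventually_mono)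
    qed (use A i(2) i'(2) in \<open>auto intro!: rect\<close>)
    also have "\<dots> = emeasure \<mu> A / 2" using coupling_emeasure_fst[OF P i(2)[OF A]] i(3)[OF A] by simp
    finally show ?thesis by (simp add: \<pi>_rect[OF A] half)
  qed
  have snd: "emeasure \<pi> (space \<mu> \<times> A) = emeasure \<mu>' A" if A: "A \<in> sets \<mu>'" for A
  proof -
    have "emeasure P (i ` space \<mu> \<times> i' ` A) = emeasure P (space M \<times> i' ` A)"
    proof (rule emeasure_eq_AE)
      show "AE z in P. z \<in> i ` space \<mu> \<times> i' ` A \<longleftrightarrow> z \<in> space M \<times> i' ` A"
        using AE sets.sets_into_space[OF A] sets.sets_into_space[OF i(2)[OF sets.top]]
        by (auto elim!: eventually_mono)
    qed (use A i(2) i'(2) in \<open>auto intro!: rect\<close>)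
    also have "\<dots> = emeasure \<mu>' A / 2" using coupling_emeasure_snd[OF P i'(2)[OF A]] i'(3)[OF A] by simp
    finally show ?thesis by (simp add: \<pi>_rect[OF _ A] half)
  qed
  have "\<pi> \<in> couplings \<mu> \<mu>'"
  proof (rule couplingsI[OF _ _ fst snd])
    show "sets \<pi> = sets (\<mu> \<Otimes>\<^sub>M \<mu>')" by (simp add: \<pi>_def)
    show "prob_space \<pi>"
    proof
      have "space \<pi> = space \<mu> \<times> space \<mu>'" by (simp add: \<pi>_def space_pair_measure)
      then show "emeasure \<pi> (space \<pi>) = 1" using fst[OF sets.top] prob_space.emeasure_space_1[OF \<mu>] by simp
    qed
  qed
  moreover have "emeasure P (i ` A \<times> i' ` A') = emeasure \<pi> (A \<times> A') / 2" if "A \<in> sets \<mu>" "A' \<in> sets \<mu>'" for A A'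
    using ennreal_mult_divide_eq[of 2] by (simp add: \<pi>_rect[OF that] mult.commute[of 2])
  ultimately show ?thesis by blast
qed

text \<open>
  Cut the coupling into its two blocks and apply the preceding lemma to each of them.
\<close>

lemma sum_coupling_surj:
  assumes M: "half_sum \<mu> \<nu> M" "half_sum \<mu>' \<nu>' M'" and P: "P \<in> couplings M M'"
    and AE: "AE z in P. z \<in> Inl ` space \<mu> \<times> Inl ` space \<mu>' \<union> Inr ` space \<nu> \<times> Inr ` space \<nu>'"
  shows "\<exists>\<pi>\<in>couplings \<mu> \<mu>'. \<exists>\<xi>\<in>couplings \<nu> \<nu>'. P = sum_coupling M M' \<pi> \<xi>"
proof -
  interpret H: half_sum \<mu> \<nu> M by fact
  interpret H': half_sum \<mu>' \<nu>' M' by fact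
  interpret P: prob_space P by (rule couplingsD[OF P])
  obtain x0 where x0: "x0 \<in> space \<mu>" using prob_space.not_empty[OF H.prob(1)] by blast
  obtain y0 where y0: "y0 \<in> space \<nu>" using prob_space.not_empty[OF H.prob(2)] by blast
  obtain x0' where x0': "x0' \<in> space \<mu>'" using prob_space.not_empty[OF H'.prob(1)] by blast
  obtain y0' where y0': "y0' \<in> space \<nu>'" using prob_space.not_empty[OF H'.prob(2)] by blast
  have "\<exists>\<pi>\<in>couplings \<mu> \<mu>'. \<forall>A\<in>sets \<mu>. \<forall>A'\<in>sets \<mu>'. emeasure P (Inl ` A \<times> Inl ` A') = emeasure \<pi> (A \<times> A') / 2"
  proof (rule block_coupling[OF P H.prob(1), where r="case_sum (\<lambda>x. x) (\<lambda>_. x0)" and r'="case_sum (\<lambda>x. x) (\<lambda>_. x0')"])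
    show "AE z in P. fst z \<in> Inl ` space \<mu> \<longleftrightarrow> snd z \<in> Inl ` space \<mu>'"
      using AE by (auto elim!: eventually_mono)
  qed (use x0 x0' in \<open>auto simp: H.Inl_measurable H'.Inl_measurable H.Inl_image H'.Inl_image H.emeasure H'.emeasure
        intro!: H.measurable_case_sum H'.measurable_case_sum\<close>)
  then obtain \<pi> where p: "\<pi> \<in> couplings \<mu> \<mu>'"
    "\<And>A A'. A \<in> sets \<mu> \<Longrightarrow> A' \<in> sets \<mu>' \<Longrightarrow> emeasure P (Inl ` A \<times> Inl ` A') = emeasure \<pi> (A \<times> A') / 2" by blast
  have "\<exists>\<xi>\<in>couplings \<nu> \<nu>'. \<forall>A\<in>sets \<nu>. \<forall>A'\<in>sets \<nu>'. emeasure P (Inr ` A \<times> Inr ` A') = emeasure \<xi> (A \<times> A') / 2"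
  proof (rule block_coupling[OF P H.prob(2), where r="case_sum (\<lambda>_. y0) (\<lambda>x. x)" and r'="case_sum (\<lambda>_. y0') (\<lambda>x. x)"])
    show "AE z in P. fst z \<in> Inr ` space \<nu> \<longleftrightarrow> snd z \<in> Inr ` space \<nu>'"
      using AE by (auto elim!: eventually_mono)
  qed (use y0 y0' in \<open>auto simp: H.Inr_measurable H'.Inr_measurable H.Inr_image H'.Inr_image H.emeasure H'.emeasure
        intro!: H.measurable_case_sum H'.measurable_case_sum\<close>)
  then obtain \<xi> where x: "\<xi> \<in> couplings \<nu> \<nu>'"
    "\<And>A A'. A \<in> sets \<nu> \<Longrightarrow> A' \<in> sets \<nu>' \<Longrightarrow> emeasure P (Inr ` A \<times> Inr ` A') = emeasure \<xi> (A \<times> A') / 2" by blast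
  interpret summed \<mu> \<nu> M \<mu>' \<nu>' M' \<pi> \<xi> by unfold_locales (rule p(1) x(1))+
  have "P = J"
  proof (rule measure_eqI_rectangles[OF P.prob_space_axioms couplingsD(2)[OF P] J_sets])
    fix S S' assume S: "S \<in> sets M" "S' \<in> sets M'"
    then have s: "Inl -` S \<in> sets \<mu>" "Inr -` S \<in> sets \<nu>" "Inl -` S' \<in> sets \<mu>'" "Inr -` S' \<in> sets \<nu>'"
      by (auto simp: H.sets_iff H'.sets_iff)
    let ?A = "Inl ` (Inl -` S) \<times> Inl ` (Inl -` S') :: (('a + 'b) \<times> ('c + 'd)) set"
    let ?B = "Inr ` (Inr -` S) \<times> Inr ` (Inr -` S') :: (('a + 'b) \<times> ('c + 'd)) set"
    have AB: "?A \<in> sets P" "?B \<in> sets P" "S \<times> S' \<in> sets P"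
      unfolding couplingsD(2)[OF P]
      by (intro pair_measureI H.Inl_image H.Inr_image H'.Inl_image H'.Inr_image s S)+
    have "emeasure P (S \<times> S') = emeasure P (?A \<union> ?B)"
      using AE AB by (intro emeasure_eq_AE) (auto elim!: eventually_mono)
    also have "\<dots> = emeasure P ?A + emeasure P ?B"
      using AB by (intro plus_emeasure[symmetric]) auto
    also have "\<dots> = emeasure J (S \<times> S')"
      by (simp only: p(2)[OF s(1,3)] x(2)[OF s(2,4)] J_rectangle[OF S] add_divide_distrib_ennreal)
    finally show "emeasure P (S \<times> S') = emeasure J (S \<times> S')" .
  qed
  then show ?thesis using p(1) x(1) by blast
qed

section \<open>Labeled couplings\<close>

lemma sets_Collect_mem: "S \<in> sets M \<Longrightarrow> {z \<in> space M. z \<in> S} \<in> sets M"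
  by (simp add: Collect_conj_eq sets.Int)

lemma labeled_networkD:
  assumes "labeled_bipartite_network N"
  shows "prob_space (nmeas N)" "sets (nmeas N) = sets (borel_of (nspace N))" "space (nmeas N) = topspace (nspace N)"
    "second_countable (nspace N)" "openin (nspace N) (nleft N)" "openin (nspace N) (nright N)"
    "nleft N \<inter> nright N = {}" "nleft N \<union> nright N = topspace (nspace N)"
    "nleft N \<in> sets (nmeas N)" "nright N \<in> sets (nmeas N)"
    "nweight N \<in> borel_measurable (nmeas N \<Otimes>\<^sub>M nmeas N)"
proof -
  show 1: "prob_space (nmeas N)" "sets (nmeas N) = sets (borel_of (nspace N))"
    "second_countable (nspace N)" "openin (nspace N) (nleft N)" "openin (nspace N) (nright N)"
    "nleft N \<inter> nright N = {}" "nleft N \<union> nright N = topspace (nspace N)"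
    "nweight N \<in> borel_measurable (nmeas N \<Otimes>\<^sub>M nmeas N)"
    using assms by (auto simp: labeled_bipartite_network_def measure_network_def full_borel_prob_def polish_def
        bipartite_decomposition_def)
  show "space (nmeas N) = topspace (nspace N)" using sets_eq_imp_space_eq[OF 1(2)] by (simp add: space_borel_of)
  show "nleft N \<in> sets (nmeas N)" "nright N \<in> sets (nmeas N)" using 1 by (auto intro: openin_borel_of)
qed

text \<open>
  The condition on the support is a condition almost everywhere.  The mixed blocks are open, so the
  support misses them if they are null.  Conversely, every point of a mixed block outside the support
  has a basic neighbourhood of measure zero, and there are countably many of these.
\<close>

lemma labeled_couplings_iff:
  assumes N: "labeled_bipartite_network N" and N': "labeled_bipartite_network N'"
  shows "P \<in> labeled_couplings N N' \<longleftrightarrow> P \<in> couplings (nmeas N) (nmeas N') \<and>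
    (AE z in P. z \<in> nleft N \<times> nleft N' \<union> nright N \<times> nright N')"
proof -
  let ?X = "nspace N" and ?Y = "nspace N'"
  let ?S = "nleft N \<times> nleft N' \<union> nright N \<times> nright N'"
  note D = labeled_networkD[OF N] and D' = labeled_networkD[OF N']
  have "measure_support (prod_topology ?X ?Y) P \<subseteq> ?S \<longleftrightarrow> (AE z in P. z \<in> ?S)"
    if P: "P \<in> couplings (nmeas N) (nmeas N')"
  proof -
    interpret prob_space P by (rule couplingsD[OF P])
    have sets: "sets P = sets (borel_of ?X \<Otimes>\<^sub>M borel_of ?Y)"
      using couplingsD(2)[OF P] D(2) D'(2) by (simp cong: sets_pair_measure_cong)
    have sp: "space P = topspace ?X \<times> topspace ?Y" by (simp add: couplingsD[OF P] D D')
    have oS: "openin (prod_topology ?X ?Y) (nleft N \<times> nright N' \<union> nright N \<times> nleft N')"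
      using D D' by (intro openin_Un) (auto simp: openin_prod_Times_iff)
    have compl: "topspace ?X \<times> topspace ?Y - ?S = nleft N \<times> nright N' \<union> nright N \<times> nleft N'"
      using D(7,8) D'(7,8) by blast
    show ?thesis
    proof
      assume sub: "measure_support (prod_topology ?X ?Y) P \<subseteq> ?S"
      obtain \<R> where R: "countable \<R>" "\<R> \<subseteq> sets (borel_of ?X \<Otimes>\<^sub>M borel_of ?Y)"
        "\<forall>W z. openin (prod_topology ?X ?Y) W \<longrightarrow> z \<in> W \<longrightarrow> (\<exists>R\<in>\<R>. z \<in> R \<and> R \<subseteq> W)"
        using measurable_base_prod_topology[OF D(4) D'(4)] by blast
      have "AE z in P. \<forall>R\<in>{R\<in>\<R>. emeasure P R = 0}. z \<notin> R"
      proof (subst AE_ball_countable)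
        show "countable {R\<in>\<R>. emeasure P R = 0}" by (rule countable_subset[OF _ R(1)]) auto
        show "\<forall>R\<in>{R\<in>\<R>. emeasure P R = 0}. AE z in P. z \<notin> R"
          using R(2) by (auto simp: sets intro!: AE_not_in null_setsI)
      qed
      then show "AE z in P. z \<in> ?S"
        using AE_space
      proof eventually_elim
        case (elim z)
        show ?case
        proof (rule ccontr)
          assume "z \<notin> ?S"
          then have "z \<notin> measure_support (prod_topology ?X ?Y) P" using sub by blast
          then obtain W where W: "openin (prod_topology ?X ?Y) W" "z \<in> W" "emeasure P W = 0"
            using elim(2) by (auto simp: measure_support_def sp zero_less_iff_neq_zero)
          then obtain R where RW: "R \<in> \<R>" "z \<in> R" "R \<subseteq> W" using R(3) W(1,2) by blast
          have "emeasure P R \<le> emeasure P W"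
            using RW W open_prod_measurable[OF D(4) D'(4)] by (intro emeasure_mono) (simp_all add: sets)
          then show False using RW W elim(1) by simp
        qed
      qed
    next
      assume AE: "AE z in P. z \<in> ?S"
      show "measure_support (prod_topology ?X ?Y) P \<subseteq> ?S"
      proof
        fix z assume z: "z \<in> measure_support (prod_topology ?X ?Y) P"
        show "z \<in> ?S"
        proof (rule ccontr)
          assume "z \<notin> ?S"
          then have "z \<in> nleft N \<times> nright N' \<union> nright N \<times> nleft N'"
            using z compl by (auto simp: measure_support_def)
          then have "emeasure P (nleft N \<times> nright N' \<union> nright N \<times> nleft N') > 0"
            using z oS by (auto simp: measure_support_def)
          moreover have "emeasure P (nleft N \<times> nright N' \<union> nright N \<times> nleft N') = emeasure P {}"
          proof (rule emeasure_eq_AE)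
            show "AE z in P. z \<in> nleft N \<times> nright N' \<union> nright N \<times> nleft N' \<longleftrightarrow> z \<in> {}"
              using AE D(7) D'(7) by (auto elim!: eventually_mono)
          qed (use open_prod_measurable[OF D(4) D'(4) oS] in \<open>auto simp: sets\<close>)
          ultimately show False by simp
        qed
      qed
    qed
  qed
  then show ?thesis by (auto simp: labeled_couplings_def)
qed

locale bip_pair =
  fixes H :: "('a, 'b) hypernetwork" and H' :: "('c, 'd) hypernetwork" and \<pi> \<xi>
  assumes H: "measure_hypernetwork H" and H': "measure_hypernetwork H'"
    and p: "\<pi> \<in> couplings (hmeas1 H) (hmeas1 H')" and x: "\<xi> \<in> couplings (hmeas2 H) (hmeas2 H')"
begin

sublocale summed "hmeas1 H" "hmeas2 H" "nmeas (bip H)" "hmeas1 H'" "hmeas2 H'" "nmeas (bip H')" \<pi> \<xi>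
  by (intro summed.intro summed_axioms.intro half_sum_bip(1)[OF H] half_sum_bip(1)[OF H'] p x)

abbreviation "w \<equiv> nweight (bip H)"
abbreviation "w' \<equiv> nweight (bip H')"

lemma labeled: "J \<in> labeled_couplings (bip H) (bip H')"
  unfolding labeled_couplings_iff[OF bip_labeled_bipartite_network[OF H] bip_labeled_bipartite_network[OF H']]
  using J_coupling AE_J_blocks hypernetworkD(3,4)[OF H] hypernetworkD(3,4)[OF H']
  by (simp add: nleft_bip nright_bip)
abbreviation "MM \<equiv> (nmeas (bip H) \<Otimes>\<^sub>M nmeas (bip H')) \<Otimes>\<^sub>M (nmeas (bip H) \<Otimes>\<^sub>M nmeas (bip H'))"

lemma weights_measurable:
  "(\<lambda>z. w (fst (fst z), fst (snd z))) \<in> borel_measurable MM"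
  "(\<lambda>z. w' (snd (fst z), snd (snd z))) \<in> borel_measurable MM"
proof -
  note [measurable] = nweight_bip_measurable[OF H] nweight_bip_measurable[OF H']
  show "(\<lambda>z. w (fst (fst z), fst (snd z))) \<in> borel_measurable MM"
    "(\<lambda>z. w' (snd (fst z), snd (snd z))) \<in> borel_measurable MM"
    by measurable
qed

lemma weights_measurable_J:
  "(\<lambda>z. w (fst (fst z), fst (snd z))) \<in> borel_measurable (J \<Otimes>\<^sub>M J)"
  "(\<lambda>z. w' (snd (fst z), snd (snd z))) \<in> borel_measurable (J \<Otimes>\<^sub>M J)"
  using weights_measurable by (simp_all add: measurable_cong_sets[OF sets_pair_measure_cong[OF J_sets J_sets] refl])

lemma hweights_measurable:
  "(\<lambda>z. hweight H (fst (fst z), fst (snd z))) \<in> borel_measurable (\<pi> \<Otimes>\<^sub>M \<xi>)"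
  "(\<lambda>z. hweight H' (snd (fst z), snd (snd z))) \<in> borel_measurable (\<pi> \<Otimes>\<^sub>M \<xi>)"
proof -
  note [measurable] = hypernetworkD(9)[OF H] hypernetworkD(9)[OF H']
  show "(\<lambda>z. hweight H (fst (fst z), fst (snd z))) \<in> borel_measurable (\<pi> \<Otimes>\<^sub>M \<xi>)"
    "(\<lambda>z. hweight H' (snd (fst z), snd (snd z))) \<in> borel_measurable (\<pi> \<Otimes>\<^sub>M \<xi>)"
    by (simp_all add: measurable_cong_sets[OF sets_pair_measure_cong[OF couplingsD(2)[OF p] couplingsD(2)[OF x]] refl])
qed

text \<open>
  Where the factor \<open>1/2\<close> comes from: in the two homogeneous blocks both weights vanish, and the two
  mixed blocks are copies of \<open>\<pi> \<Otimes>\<^sub>M \<xi>\<close> with the original weights, which gives \<open>(0 + I + (I + 0)) / 4\<close>.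
  Leaving \<open>q\<close> arbitrary serves the \<open>p\<close>-norms, the essential supremum and expansiveness alike.
\<close>

lemma nn_integral_weights:
  assumes q[measurable]: "case_prod q \<in> borel_measurable (borel \<Otimes>\<^sub>M borel)" and q0: "q 0 (0::real) = (0::ennreal)"
  shows "(\<integral>\<^sup>+z. q (w (fst (fst z), fst (snd z))) (w' (snd (fst z), snd (snd z))) \<partial>(J \<Otimes>\<^sub>M J)) =
    (\<integral>\<^sup>+z. q (hweight H (fst (fst z), fst (snd z))) (hweight H' (snd (fst z), snd (snd z))) \<partial>(\<pi> \<Otimes>\<^sub>M \<xi>)) / 2"
proof -
  note [measurable] = weights_measurable
  note weights = nweight_bip hypernetworkD(3,4)[OF H] hypernetworkD(3,4)[OF H'] couplingsD(3)[OF p] couplingsD(3)[OF x]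
  interpret \<pi>: prob_space \<pi> by (rule couplingsD[OF p])
  interpret \<xi>: prob_space \<xi> by (rule couplingsD[OF x])
  interpret pair_sigma_finite \<pi> \<xi> ..
  let ?Q = "\<lambda>z. q (w (fst (fst z), fst (snd z))) (w' (snd (fst z), snd (snd z)))"
  let ?q = "\<lambda>u v. q (hweight H (fst u, fst v)) (hweight H' (snd u, snd v))"
  have "(\<lambda>z. case (w (fst (fst z), fst (snd z)), w' (snd (fst z), snd (snd z))) of (a, b) \<Rightarrow> q a b)
    \<in> borel_measurable MM"
    by (rule measurable_compose[OF _ q]) measurable
  then have "?Q \<in> borel_measurable MM"
    by simp
  note nn_integral_J_J[OF this]
  also have "(\<integral>\<^sup>+(u, v). ?Q (l u, l v) \<partial>(\<pi> \<Otimes>\<^sub>M \<pi>)) = (\<integral>\<^sup>+z. 0 \<partial>(\<pi> \<Otimes>\<^sub>M \<pi>))"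
    by (rule nn_integral_cong) (auto simp: space_pair_measure q0 weights)
  also have "(\<integral>\<^sup>+(u, v). ?Q (r u, r v) \<partial>(\<xi> \<Otimes>\<^sub>M \<xi>)) = (\<integral>\<^sup>+z. 0 \<partial>(\<xi> \<Otimes>\<^sub>M \<xi>))"
    by (rule nn_integral_cong) (auto simp: space_pair_measure q0 weights)
  also have "(\<integral>\<^sup>+(u, v). ?Q (l u, r v) \<partial>(\<pi> \<Otimes>\<^sub>M \<xi>)) = (\<integral>\<^sup>+(u, v). ?q u v \<partial>(\<pi> \<Otimes>\<^sub>M \<xi>))"
    by (rule nn_integral_cong) (auto simp: space_pair_measure weights)
  also have "(\<integral>\<^sup>+(v, u). ?Q (r v, l u) \<partial>(\<xi> \<Otimes>\<^sub>M \<pi>)) = (\<integral>\<^sup>+(v, u). ?q u v \<partial>(\<xi> \<Otimes>\<^sub>M \<pi>))"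
    by (rule nn_integral_cong) (auto simp: space_pair_measure weights)
  also have "(\<integral>\<^sup>+(v, u). ?q u v \<partial>(\<xi> \<Otimes>\<^sub>M \<pi>)) = (\<integral>\<^sup>+(u, v). ?q u v \<partial>(\<pi> \<Otimes>\<^sub>M \<xi>))"
  proof -
    have "(\<lambda>z. case (hweight H (fst (fst z), fst (snd z)), hweight H' (snd (fst z), snd (snd z))) of (a, b) \<Rightarrow> q a b)
      \<in> borel_measurable (\<pi> \<Otimes>\<^sub>M \<xi>)"
      using hweights_measurable by (intro measurable_compose[OF _ q]) measurable
    then have m: "(\<lambda>(u, v). ?q u v) \<in> borel_measurable (\<pi> \<Otimes>\<^sub>M \<xi>)" by (simp add: case_prod_beta')
    show ?thesis
      using nn_integral_distr[of "\<lambda>(x, y). (y, x)" "\<xi> \<Otimes>\<^sub>M \<pi>" "\<pi> \<Otimes>\<^sub>M \<xi>" "\<lambda>(u, v). ?q u v"] m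
      unfolding distr_pair_swap[symmetric] by (simp add: case_prod_beta')
  qed
  finally show ?thesis
    using ennreal_quarter[of "\<integral>\<^sup>+(u, v). ?q u v \<partial>(\<pi> \<Otimes>\<^sub>M \<xi>)" "\<integral>\<^sup>+(u, v). ?q u v \<partial>(\<pi> \<Otimes>\<^sub>M \<xi>)"]
    by (simp add: case_prod_beta' ennreal_half_add)
qed

text \<open>
  Integrate the indicator of the negation of \<open>Q\<close>.
\<close>

lemma AE_weights_iff:
  assumes Q[measurable]: "Measurable.pred (borel \<Otimes>\<^sub>M borel) (case_prod Q)" and Q0: "Q 0 (0::real)"
  shows "(AE z in J \<Otimes>\<^sub>M J. Q (w (fst (fst z), fst (snd z))) (w' (snd (fst z), snd (snd z)))) \<longleftrightarrow>
    (AE z in \<pi> \<Otimes>\<^sub>M \<xi>. Q (hweight H (fst (fst z), fst (snd z))) (hweight H' (snd (fst z), snd (snd z))))"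
proof -
  define q where "q a b = (if Q a b then 0 else 1 :: ennreal)" for a b
  have q: "case_prod q \<in> borel_measurable (borel \<Otimes>\<^sub>M borel)"
    unfolding q_def case_prod_beta' using Q by (simp add: case_prod_beta')
  have iff: "(AE z in N. Q (f z) (g z)) \<longleftrightarrow> (\<integral>\<^sup>+z. q (f z) (g z) \<partial>N) = 0"
    if "f \<in> borel_measurable N" "g \<in> borel_measurable N" for N :: "'z measure" and f g
  proof -
    have "(\<lambda>z. case (f z, g z) of (a, b) \<Rightarrow> q a b) \<in> borel_measurable N"
      using that by (intro measurable_compose[OF _ q]) measurable
    then show ?thesis by (subst nn_integral_0_iff_AE) (auto simp: q_def cong: if_cong)
  qed
  show ?thesis
    using nn_integral_weights[OF q] Q0 by (subst (1 2) iff) (auto simp: weights_measurable_J hweights_measurable q_def)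
qed

lemma expansive_iff:
  "J \<in> expansive_labeled_couplings (bip H) (bip H') \<longleftrightarrow> (\<pi>, \<xi>) \<in> expansive_couplings H H'"
  using AE_weights_iff[of "(\<le>)"] labeled p x
  unfolding expansive_labeled_couplings_def expansive_couplings_def mem_Collect_eq prod.case
  by (simp add: case_prod_beta')

end

section \<open>Comparison of the distances\<close>

lemma esssup_nonneg:
  assumes M: "prob_space M" and f: "\<And>z. 0 \<le> f z"
  shows "0 \<le> esssup M f"
proof -
  have "AE z in M. 0 \<le> esssup M f"
    using esssup_AE[of f M] by eventually_elim (use f order_trans in blast)
  then show ?thesis using prob_space.AE_const[OF M] by blast
qed

lemma Lp_norm_nonneg:
  assumes "prob_space M"
  shows "0 \<le> Lp_norm p M f"
  using esssup_nonneg[OF assms, of "\<lambda>x. ereal \<bar>f x\<bar>"] by (simp add: Lp_norm_def real_of_ereal_pos)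

lemma prod_coupling:
  assumes "prob_space \<mu>" "prob_space \<nu>"
  shows "\<mu> \<Otimes>\<^sub>M \<nu> \<in> couplings \<mu> \<nu>"
proof -
  interpret \<nu>: prob_space \<nu> by fact
  interpret \<mu>: prob_space \<mu> by fact
  show ?thesis
    by (rule couplingsI) (auto simp: prob_space_pair assms \<nu>.emeasure_pair_measure_Times \<mu>.emeasure_space_1 \<nu>.emeasure_space_1)
qed

context bip_pair
begin

abbreviation "D \<equiv> (\<lambda>((x, x'), (y, y')). w (x, y) - w' (x', y'))"
abbreviation "d \<equiv> (\<lambda>((x, x'), (y, y')). hweight H (x, y) - hweight H' (x', y'))"

lemma D_measurable: "D \<in> borel_measurable (J \<Otimes>\<^sub>M J)" and d_measurable: "d \<in> borel_measurable (\<pi> \<Otimes>\<^sub>M \<xi>)"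
  using weights_measurable_J hweights_measurable by (simp_all add: case_prod_beta')

lemma J_J_prob: "prob_space (J \<Otimes>\<^sub>M J)" and \<pi>_\<xi>_prob: "prob_space (\<pi> \<Otimes>\<^sub>M \<xi>)"
  using prob_space_pair J_prob couplingsD(1)[OF p] couplingsD(1)[OF x] by auto

lemma distortion_real:
  fixes q :: real
  assumes q: "1 \<le> q"
  shows "2 powr (1 / q) * distortion (ereal q) (bip H) (bip H') J = Lp_norm (ereal q) (\<pi> \<Otimes>\<^sub>M \<xi>) d"
proof -
  let ?IJ = "\<integral>z. \<bar>D z\<bar> powr q \<partial>(J \<Otimes>\<^sub>M J)" and ?I = "\<integral>z. \<bar>d z\<bar> powr q \<partial>(\<pi> \<Otimes>\<^sub>M \<xi>)"
  have "?IJ = enn2real (\<integral>\<^sup>+z. ennreal (\<bar>D z\<bar> powr q) \<partial>(J \<Otimes>\<^sub>M J))"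
    using D_measurable by (intro integral_eq_nn_integral) auto
  also have "(\<integral>\<^sup>+z. ennreal (\<bar>D z\<bar> powr q) \<partial>(J \<Otimes>\<^sub>M J)) = (\<integral>\<^sup>+z. ennreal (\<bar>d z\<bar> powr q) \<partial>(\<pi> \<Otimes>\<^sub>M \<xi>)) / 2"
    using nn_integral_weights[of "\<lambda>a b. ennreal (\<bar>a - b\<bar> powr q)"] by (simp add: case_prod_beta')
  also have "enn2real \<dots> = enn2real (\<integral>\<^sup>+z. ennreal (\<bar>d z\<bar> powr q) \<partial>(\<pi> \<Otimes>\<^sub>M \<xi>)) / 2"
  proof -
    have h: "(inverse 2 :: ennreal) = ennreal (1 / 2)"
      using divide_ennreal[of 1 2] by (simp only: ennreal_1 ennreal_numeral divide_ennreal_def mult_1)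
    have "enn2real (inverse 2) = 1 / 2" unfolding h by (rule enn2real_ennreal) simp
    then show ?thesis by (simp add: divide_ennreal_def enn2real_mult)
  qed
  also have "enn2real (\<integral>\<^sup>+z. ennreal (\<bar>d z\<bar> powr q) \<partial>(\<pi> \<Otimes>\<^sub>M \<xi>)) = ?I"
    using d_measurable by (intro integral_eq_nn_integral[symmetric]) auto
  finally have "?I = 2 * ?IJ" by simp
  moreover have "0 \<le> ?IJ" by simp
  ultimately have "2 powr (1 / q) * ?IJ powr (1 / q) = ?I powr (1 / q)"
    using powr_mult[of 2 ?IJ "1 / q"] by (simp only:)
  then show ?thesis by (simp add: distortion_def Lp_norm_def)
qed

text \<open>
  The essential supremum depends on null sets only and does not see the factor \<open>1/2\<close>.
\<close>

lemma distortion_infinity: "distortion \<infinity> (bip H) (bip H') J = Lp_norm \<infinity> (\<pi> \<Otimes>\<^sub>M \<xi>) d"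
proof -
  let ?E = "esssup (J \<Otimes>\<^sub>M J) (\<lambda>z. ereal \<bar>D z\<bar>)" and ?e = "esssup (\<pi> \<Otimes>\<^sub>M \<xi>) (\<lambda>z. ereal \<bar>d z\<bar>)"
  have iff: "(AE z in J \<Otimes>\<^sub>M J. ereal \<bar>D z\<bar> \<le> c) \<longleftrightarrow> (AE z in \<pi> \<Otimes>\<^sub>M \<xi>. ereal \<bar>d z\<bar> \<le> c)" if "0 \<le> c" for c
    using AE_weights_iff[of "\<lambda>a b. ereal \<bar>a - b\<bar> \<le> c"] that[unfolded zero_ereal_def] by (simp add: case_prod_beta')
  have m: "(\<lambda>z. ereal \<bar>D z\<bar>) \<in> borel_measurable (J \<Otimes>\<^sub>M J)" "(\<lambda>z. ereal \<bar>d z\<bar>) \<in> borel_measurable (\<pi> \<Otimes>\<^sub>M \<xi>)"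
    using D_measurable d_measurable by (auto intro!: borel_measurable_ereal borel_measurable_abs)
  have "?E \<le> ?e"
    using iff[OF esssup_nonneg[OF \<pi>_\<xi>_prob, of "\<lambda>z. ereal \<bar>d z\<bar>"]] esssup_AE[of "\<lambda>z. ereal \<bar>d z\<bar>" "\<pi> \<Otimes>\<^sub>M \<xi>"]
    by (intro esssup_I[OF m(1)]) simp
  moreover have "?e \<le> ?E"
    using iff[OF esssup_nonneg[OF J_J_prob, of "\<lambda>z. ereal \<bar>D z\<bar>"]] esssup_AE[of "\<lambda>z. ereal \<bar>D z\<bar>" "J \<Otimes>\<^sub>M J"]
    by (intro esssup_I[OF m(2)]) simp
  ultimately have "?E = ?e" by (rule antisym)
  then show ?thesis by (simp add: distortion_def Lp_norm_def)
qed

end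

lemma labeled_couplings_bip:
  assumes H: "measure_hypernetwork H" and H': "measure_hypernetwork H'"
  shows "labeled_couplings (bip H) (bip H') =
    bip_coupling H H' ` (couplings (hmeas1 H) (hmeas1 H') \<times> couplings (hmeas2 H) (hmeas2 H'))"
proof (intro set_eqI iffI)
  fix P assume "P \<in> labeled_couplings (bip H) (bip H')"
  then have P: "P \<in> couplings (nmeas (bip H)) (nmeas (bip H'))"
    "AE z in P. z \<in> nleft (bip H) \<times> nleft (bip H') \<union> nright (bip H) \<times> nright (bip H')"
    using labeled_couplings_iff[OF bip_labeled_bipartite_network[OF H] bip_labeled_bipartite_network[OF H']] by auto
  from sum_coupling_surj[OF half_sum_bip(1)[OF H] half_sum_bip(1)[OF H'] P(1)] P(2)
  show "P \<in> bip_coupling H H' ` (couplings (hmeas1 H) (hmeas1 H') \<times> couplings (hmeas2 H) (hmeas2 H'))"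
    using hypernetworkD(3,4)[OF H] hypernetworkD(3,4)[OF H']
    by (force simp: nleft_bip nright_bip bip_coupling_eq image_iff)
next
  fix P assume "P \<in> bip_coupling H H' ` (couplings (hmeas1 H) (hmeas1 H') \<times> couplings (hmeas2 H) (hmeas2 H'))"
  then obtain \<pi> \<xi> where *: "\<pi> \<in> couplings (hmeas1 H) (hmeas1 H')" "\<xi> \<in> couplings (hmeas2 H) (hmeas2 H')"
    "P = sum_coupling (nmeas (bip H)) (nmeas (bip H')) \<pi> \<xi>" by (auto simp: bip_coupling_eq)
  interpret bip_pair H H' \<pi> \<xi> by unfold_locales (use H H' * in auto)
  show "P \<in> labeled_couplings (bip H) (bip H')" using labeled * by simp
qed

lemma cINF_mult_left:
  fixes f :: "'i \<Rightarrow> real"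
  assumes "0 < c" "S \<noteq> {}" "\<And>x. x \<in> S \<Longrightarrow> 0 \<le> f x"
  shows "c * (INF x\<in>S. f x) = (INF x\<in>S. c * f x)"
proof -
  have "c * Inf (f ` S) = (INF y\<in>f ` S. c * y)"
  proof (rule continuous_at_Inf_mono)
    show "mono ((*) c)" using assms by (auto intro!: monoI mult_left_mono)
    show "bdd_below (f ` S)" using assms by (auto intro!: bdd_belowI)
  qed (use assms in \<open>auto intro!: continuous_intros\<close>)
  then show ?thesis by (simp add: image_image)
qed

text \<open>
  Both distances are infima over the same set of pairs of couplings, of functions that agree up to the
  constant factor.
\<close>

lemma dist_bip:
  assumes H: "measure_hypernetwork H" and H': "measure_hypernetwork H'"
  shows dist_bip_real: "1 \<le> q \<Longrightarrow> 2 powr (1 / q) * dist_B (ereal q) (bip H) (bip H') = dist_H (ereal q) H H'"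
    and dist_bip_infinity: "dist_B \<infinity> (bip H) (bip H') = dist_H \<infinity> H H'"
proof -
  let ?C = "couplings (hmeas1 H) (hmeas1 H') \<times> couplings (hmeas2 H) (hmeas2 H')"
  have ne: "?C \<noteq> {}"
    using prod_coupling[of "hmeas1 H" "hmeas1 H'"] prod_coupling[of "hmeas2 H" "hmeas2 H'"] hypernetworkD(1,2)[OF H] hypernetworkD(1,2)[OF H']
    by blast
  have pair: "bip_pair H H' \<pi> \<xi>" if "(\<pi>, \<xi>) \<in> ?C" for \<pi> \<xi>
    by unfold_locales (use H H' that in auto)
  have eq: "dist_B p (bip H) (bip H') = (INF q\<in>?C. distortion p (bip H) (bip H') (bip_coupling H H' q))" for p
    by (simp add: dist_B_def labeled_couplings_bip[OF H H'] image_image)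
  show "dist_B \<infinity> (bip H) (bip H') = dist_H \<infinity> H H'"
    unfolding eq dist_H_def
    by (rule INF_cong) (auto simp: bip_coupling_eq bip_pair.distortion_infinity[OF pair])
  have nonneg: "0 \<le> distortion p (bip H) (bip H') (bip_coupling H H' q)" if "q \<in> ?C" for p q
  proof -
    obtain \<pi> \<xi> where q: "q = (\<pi>, \<xi>)" by (cases q)
    interpret bip_pair H H' \<pi> \<xi> using that q by (intro pair) simp
    show ?thesis unfolding q bip_coupling_eq distortion_def by (rule Lp_norm_nonneg[OF J_J_prob])
  qed
  show "2 powr (1 / q) * dist_B (ereal q) (bip H) (bip H') = dist_H (ereal q) H H'" if q: "1 \<le> q"
    unfolding eq dist_H_def
    by (subst cINF_mult_left[OF _ ne nonneg], simp, simp)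
       (rule INF_cong, simp, auto simp: bip_coupling_eq bip_pair.distortion_real[OF pair q])
qed

section \<open>Functoriality\<close>

lemma is_category_Hm: "is_category cat_Hm"
  unfolding is_category_def cat_Hm_def expansive_maps_def
  by (auto simp: PiE_iff compose_def extensional_def fun_eq_iff) (meson order_trans)

lemma is_category_Bm: "is_category cat_Bm"
  unfolding is_category_def cat_Bm_def expansive_labeled_maps_def
  by (auto simp: PiE_iff compose_def extensional_def fun_eq_iff labeled_bipartite_network_def bipartite_decomposition_def
      image_subset_iff) (meson order_trans)

lemma bip_functor_m: "is_functor cat_Hm cat_Bm bip bip_map"
  unfolding is_functor_def
proof (intro conjI ballI)
  show "is_category cat_Hm" "is_category cat_Bm" by (rule is_category_Hm is_category_Bm)+
  fix a :: "('a, 'b) hypernetwork" assume "a \<in> Ob cat_Hm"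
  then have a: "measure_hypernetwork a" by (simp add: cat_Hm_def)
  show "bip a \<in> Ob cat_Bm" using bip_labeled_bipartite_network[OF a] by (simp add: cat_Bm_def)
  show "bip_map a a (Id cat_Hm a) = Id cat_Bm (bip a)"
    by (auto simp: bip_map_def cat_Hm_def cat_Bm_def nspace_bip topspace_disjoint_union_topology fun_eq_iff)
  fix b :: "('a, 'b) hypernetwork" assume "b \<in> Ob cat_Hm"
  fix f assume "f \<in> Hom cat_Hm a b"
  then obtain \<phi> \<psi> where f: "f = (\<phi>, \<psi>)" "(\<phi>, \<psi>) \<in> expansive_maps a b" by (cases f) (auto simp: cat_Hm_def)
  show "bip_map a b f \<in> Hom cat_Bm (bip a) (bip b)"
    using f(2) by (auto simp: f(1) bip_map_def cat_Bm_def expansive_labeled_maps_def expansive_maps_def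
        nspace_bip topspace_disjoint_union_topology nleft_bip nright_bip nweight_bip PiE_iff)
  fix c :: "('a, 'b) hypernetwork" assume "c \<in> Ob cat_Hm"
  fix g assume "g \<in> Hom cat_Hm b c"
  then obtain \<phi>' \<psi>' where g: "g = (\<phi>', \<psi>')" by (cases g)
  show "bip_map a c (Comp cat_Hm a b c g f) = Comp cat_Bm (bip a) (bip b) (bip c) (bip_map b c g) (bip_map a b f)"
    using f(2) by (auto simp: f(1) g bip_map_def cat_Bm_def cat_Hm_def expansive_maps_def compose_def
        nspace_bip topspace_disjoint_union_topology fun_eq_iff PiE_iff)
qed

lemma compact_hypernetworkD:
  assumes "compact_hypernetwork H"
  shows "measure_hypernetwork H" "real_coded (hmeas1 H)" "real_coded (hmeas2 H)" "real_coded (nmeas (bip H))"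
proof -
  show H: "measure_hypernetwork H" using assms by (simp add: compact_hypernetwork_def)
  show "real_coded (hmeas1 H)" "real_coded (hmeas2 H)"
    using assms hypernetworkD[OF H]
    by (auto simp: compact_hypernetwork_def measure_hypernetwork_def intro!: compact_polish_real_coded[of "hspace1 H"] compact_polish_real_coded[of "hspace2 H"])
  have "compact_labeled_bipartite_network (bip H)" by (rule bip_compact[OF assms])
  then show "real_coded (nmeas (bip H))"
    by (intro compact_polish_real_coded[of "nspace (bip H)"])
       (auto simp: compact_labeled_bipartite_network_def labeled_bipartite_network_def measure_network_def full_borel_prob_def)
qed

lemma compact_networkD:
  assumes "compact_labeled_bipartite_network N"
  shows "labeled_bipartite_network N" "real_coded (nmeas N)"
  using assms
  by (auto simp: compact_labeled_bipartite_network_def labeled_bipartite_network_def measure_network_def full_borel_prob_def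
      intro!: compact_polish_real_coded[of "nspace N"])

lemma expansive_couplings_comp:
  assumes "compact_hypernetwork a" "compact_hypernetwork b" "compact_hypernetwork c"
    and f: "(\<pi>, \<xi>) \<in> expansive_couplings a b" and g: "(\<pi>', \<xi>') \<in> expansive_couplings b c"
  shows "(coupling_comp (hmeas1 a) (hmeas1 b) (hmeas1 c) \<pi>' \<pi>, coupling_comp (hmeas2 a) (hmeas2 b) (hmeas2 c) \<xi>' \<xi>)
    \<in> expansive_couplings a c"
proof -
  note D = compact_hypernetworkD[OF assms(1)] compact_hypernetworkD[OF assms(2)] compact_hypernetworkD[OF assms(3)]
  have 1: "composable (hmeas1 a) (hmeas1 b) (hmeas1 c) \<pi> \<pi>'" "composable (hmeas2 a) (hmeas2 b) (hmeas2 c) \<xi> \<xi>'"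
    using f g D by (auto simp: composable_def expansive_couplings_def)
  show ?thesis
    using f g composable.comp_coupling[OF 1(1)] composable.comp_coupling[OF 1(2)]
      AE_expansive_comp[OF 1 hypernetworkD(9)[OF D(1)] hypernetworkD(9)[OF D(9)], of "hweight b"]
    by (simp add: expansive_couplings_def)
qed

lemma is_category_Hc: "is_category cat_Hc"
  unfolding is_category_def
proof (intro conjI ballI)
  fix a :: "('a, 'b) hypernetwork" assume "a \<in> Ob cat_Hc"
  then have a: "compact_hypernetwork a" by (simp add: cat_Hc_def)
  note A = compact_hypernetworkD[OF a] hypernetworkD[OF compact_hypernetworkD(1)[OF a]]
  show "Id cat_Hc a \<in> Hom cat_Hc a a"
    using diagonal_coupling[of "hmeas1 a"] diagonal_coupling[of "hmeas2 a"] A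
      AE_expansive_diagonal[of "hmeas1 a" "hmeas2 a" "hweight a"]
    by (auto simp: cat_Hc_def expansive_couplings_def)
  fix b :: "('a, 'b) hypernetwork" assume "b \<in> Ob cat_Hc"
  then have b: "compact_hypernetwork b" by (simp add: cat_Hc_def)
  note B = compact_hypernetworkD[OF b]
  fix f assume "f \<in> Hom cat_Hc a b"
  then obtain \<pi> \<xi> where f: "f = (\<pi>, \<xi>)" "(\<pi>, \<xi>) \<in> expansive_couplings a b" by (cases f) (auto simp: cat_Hc_def)
  then have fc: "\<pi> \<in> couplings (hmeas1 a) (hmeas1 b)" "\<xi> \<in> couplings (hmeas2 a) (hmeas2 b)"
    by (auto simp: expansive_couplings_def)
  show "Comp cat_Hc a a b f (Id cat_Hc a) = f" "Comp cat_Hc a b b (Id cat_Hc b) f = f"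
    using fc A B by (simp_all add: f(1) cat_Hc_def coupling_comp_diagonal_right coupling_comp_diagonal_left)
  fix c :: "('a, 'b) hypernetwork" assume "c \<in> Ob cat_Hc"
  then have c: "compact_hypernetwork c" by (simp add: cat_Hc_def)
  note C = compact_hypernetworkD[OF c]
  fix g assume "g \<in> Hom cat_Hc b c"
  then obtain \<pi>' \<xi>' where g: "g = (\<pi>', \<xi>')" "(\<pi>', \<xi>') \<in> expansive_couplings b c" by (cases g) (auto simp: cat_Hc_def)
  then have gc: "\<pi>' \<in> couplings (hmeas1 b) (hmeas1 c)" "\<xi>' \<in> couplings (hmeas2 b) (hmeas2 c)"
    by (auto simp: expansive_couplings_def)
  show "Comp cat_Hc a b c g f \<in> Hom cat_Hc a c"
    using expansive_couplings_comp[OF a b c f(2) g(2)] by (simp add: f(1) g(1) cat_Hc_def)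
  fix d :: "('a, 'b) hypernetwork" assume "d \<in> Ob cat_Hc"
  then have d: "compact_hypernetwork d" by (simp add: cat_Hc_def)
  note D = compact_hypernetworkD[OF d]
  fix h assume "h \<in> Hom cat_Hc c d"
  then obtain \<pi>'' \<xi>'' where h: "h = (\<pi>'', \<xi>'')" "(\<pi>'', \<xi>'') \<in> expansive_couplings c d" by (cases h) (auto simp: cat_Hc_def)
  then have hc: "\<pi>'' \<in> couplings (hmeas1 c) (hmeas1 d)" "\<xi>'' \<in> couplings (hmeas2 c) (hmeas2 d)"
    by (auto simp: expansive_couplings_def)
  show "Comp cat_Hc a c d h (Comp cat_Hc a b c g f) = Comp cat_Hc a b d (Comp cat_Hc b c d h g) f"
    using coupling_comp_assoc[OF fc(1) gc(1) hc(1)] coupling_comp_assoc[OF fc(2) gc(2) hc(2)] A B C D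
    by (simp add: f(1) g(1) h(1) cat_Hc_def)
qed

lemma expansive_labeled_couplings_comp:
  assumes "compact_labeled_bipartite_network a" "compact_labeled_bipartite_network b" "compact_labeled_bipartite_network c"
    and f: "\<pi> \<in> expansive_labeled_couplings a b" and g: "\<pi>' \<in> expansive_labeled_couplings b c"
  shows "coupling_comp (nmeas a) (nmeas b) (nmeas c) \<pi>' \<pi> \<in> expansive_labeled_couplings a c"
proof -
  note A = compact_networkD[OF assms(1)] and B = compact_networkD[OF assms(2)] and C = compact_networkD[OF assms(3)]
  have f': "\<pi> \<in> couplings (nmeas a) (nmeas b)" "AE z in \<pi>. z \<in> nleft a \<times> nleft b \<union> nright a \<times> nright b"
    using f labeled_couplings_iff[OF A(1) B(1)] by (auto simp: expansive_labeled_couplings_def)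
  have g': "\<pi>' \<in> couplings (nmeas b) (nmeas c)" "AE z in \<pi>'. z \<in> nleft b \<times> nleft c \<union> nright b \<times> nright c"
    using g labeled_couplings_iff[OF B(1) C(1)] by (auto simp: expansive_labeled_couplings_def)
  interpret composable "nmeas a" "nmeas b" "nmeas c" \<pi> \<pi>' by unfold_locales (use f' g' A C in auto)
  have S: "nleft a \<times> nleft c \<union> nright a \<times> nright c \<in> sets (nmeas a \<Otimes>\<^sub>M nmeas c)"
    using labeled_networkD(9,10)[OF A(1)] labeled_networkD(9,10)[OF C(1)] by auto
  have "AE (x, x'') in P. (x, x'') \<in> nleft a \<times> nleft c \<union> nright a \<times> nright c"
  proof (rule AE_comp[where Q="\<lambda>x x'. (x, x') \<in> nleft a \<times> nleft b \<union> nright a \<times> nright b"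
        and Q'="\<lambda>x x'. (x, x') \<in> nleft b \<times> nleft c \<union> nright b \<times> nright c"])
    show "{z \<in> space (nmeas a \<Otimes>\<^sub>M nmeas c). (fst z, snd z) \<in> nleft a \<times> nleft c \<union> nright a \<times> nright c}
      \<in> sets (nmeas a \<Otimes>\<^sub>M nmeas c)"
      unfolding prod.collapse by (rule sets_Collect_mem[OF S])
  qed (use f'(2) g'(2) labeled_networkD(7)[OF B(1)] in \<open>auto simp: case_prod_beta'\<close>)
  then have "P \<in> labeled_couplings a c"
    unfolding labeled_couplings_iff[OF A(1) C(1)] using comp_coupling
    by (simp only: case_prod_beta' prod.collapse)
  moreover have "AE ((w, w''), (z, z'')) in P \<Otimes>\<^sub>M P. nweight a (w, z) \<le> nweight c (w'', z'')"
    using f g by (intro AE_expansive_comp[OF composable_axioms composable_axioms labeled_networkD(11)[OF A(1)]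
        labeled_networkD(11)[OF C(1)], of "nweight b"]) (auto simp: expansive_labeled_couplings_def)
  ultimately show ?thesis by (simp add: expansive_labeled_couplings_def)
qed

text \<open>
  The diagonal meets only the homogeneous blocks.
\<close>

lemma diagonal_labeled:
  assumes N: "labeled_bipartite_network N"
  shows "diagonal_coupling (nmeas N) \<in> expansive_labeled_couplings N N"
proof -
  note D = labeled_networkD[OF N]
  have S: "nleft N \<times> nleft N \<union> nright N \<times> nright N \<in> sets (nmeas N \<Otimes>\<^sub>M nmeas N)"
    using D(9,10) by auto
  have "AE z in diagonal_coupling (nmeas N). z \<in> nleft N \<times> nleft N \<union> nright N \<times> nright N"
    unfolding diagonal_coupling_def
  proof (subst AE_distr_iff)
    show "{z \<in> space (nmeas N \<Otimes>\<^sub>M nmeas N). z \<in> nleft N \<times> nleft N \<union> nright N \<times> nright N} \<in> sets (nmeas N \<Otimes>\<^sub>M nmeas N)"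
      unfolding prod.collapse by (rule sets_Collect_mem[OF S])
    show "AE x in nmeas N. (x, x) \<in> nleft N \<times> nleft N \<union> nright N \<times> nright N"
      using D(3,8) by (intro AE_I2) auto
  qed measurable
  then show ?thesis
    using diagonal_coupling[OF D(1)] AE_expansive_diagonal[OF D(1) D(1) D(11)] labeled_couplings_iff[OF N N]
    by (simp add: expansive_labeled_couplings_def)
qed

lemma is_category_Bc: "is_category cat_Bc"
  unfolding is_category_def
proof (intro conjI ballI)
  fix a :: "'a labeled_network" assume "a \<in> Ob cat_Bc"
  then have a: "compact_labeled_bipartite_network a" by (simp add: cat_Bc_def)
  note A = compact_networkD[OF a]
  show "Id cat_Bc a \<in> Hom cat_Bc a a" using diagonal_labeled[OF A(1)] by (simp add: cat_Bc_def)
  fix b :: "'a labeled_network" assume "b \<in> Ob cat_Bc"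
  then have b: "compact_labeled_bipartite_network b" by (simp add: cat_Bc_def)
  note B = compact_networkD[OF b]
  fix f assume "f \<in> Hom cat_Bc a b"
  then have f: "f \<in> expansive_labeled_couplings a b" by (simp add: cat_Bc_def)
  then have fc: "f \<in> couplings (nmeas a) (nmeas b)" by (simp add: expansive_labeled_couplings_def labeled_couplings_def)
  show "Comp cat_Bc a a b f (Id cat_Bc a) = f" "Comp cat_Bc a b b (Id cat_Bc b) f = f"
    using fc A B by (simp_all add: cat_Bc_def coupling_comp_diagonal_right coupling_comp_diagonal_left)
  fix c :: "'a labeled_network" assume "c \<in> Ob cat_Bc"
  then have c: "compact_labeled_bipartite_network c" by (simp add: cat_Bc_def)
  note C = compact_networkD[OF c]
  fix g assume "g \<in> Hom cat_Bc b c"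
  then have g: "g \<in> expansive_labeled_couplings b c" by (simp add: cat_Bc_def)
  then have gc: "g \<in> couplings (nmeas b) (nmeas c)" by (simp add: expansive_labeled_couplings_def labeled_couplings_def)
  show "Comp cat_Bc a b c g f \<in> Hom cat_Bc a c"
    using expansive_labeled_couplings_comp[OF a b c f g] by (simp add: cat_Bc_def)
  fix d :: "'a labeled_network" assume "d \<in> Ob cat_Bc"
  then have d: "compact_labeled_bipartite_network d" by (simp add: cat_Bc_def)
  fix h assume "h \<in> Hom cat_Bc c d"
  then have hc: "h \<in> couplings (nmeas c) (nmeas d)"
    by (simp add: cat_Bc_def expansive_labeled_couplings_def labeled_couplings_def)
  show "Comp cat_Bc a c d h (Comp cat_Bc a b c g f) = Comp cat_Bc a b d (Comp cat_Bc b c d h g) f"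
    using coupling_comp_assoc[OF fc gc hc] A B C compact_networkD[OF d] by (simp add: cat_Bc_def)
qed

text \<open>
  On morphisms, being expansive is the same condition on both sides by \<open>expansive_iff\<close>; identities
  and composites are compared on rectangles.
\<close>

lemma bip_functor_c: "is_functor cat_Hc cat_Bc bip bip_coupling"
  unfolding is_functor_def
proof (intro conjI ballI)
  show "is_category cat_Hc" "is_category cat_Bc" by (rule is_category_Hc is_category_Bc)+
  fix a :: "('a, 'b) hypernetwork" assume "a \<in> Ob cat_Hc"
  then have a: "compact_hypernetwork a" by (simp add: cat_Hc_def)
  note A = compact_hypernetworkD[OF a]
  show "bip a \<in> Ob cat_Bc" using bip_compact[OF a] by (simp add: cat_Bc_def)
  show "bip_coupling a a (Id cat_Hc a) = Id cat_Bc (bip a)"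
    using sum_coupling_diagonal[OF half_sum_bip(1)[OF A(1)]] by (simp add: cat_Hc_def cat_Bc_def bip_coupling_eq)
  fix b :: "('a, 'b) hypernetwork" assume "b \<in> Ob cat_Hc"
  then have b: "compact_hypernetwork b" by (simp add: cat_Hc_def)
  note B = compact_hypernetworkD[OF b]
  fix f assume "f \<in> Hom cat_Hc a b"
  then obtain \<pi> \<xi> where f: "f = (\<pi>, \<xi>)" "(\<pi>, \<xi>) \<in> expansive_couplings a b" by (cases f) (auto simp: cat_Hc_def)
  then have fc: "\<pi> \<in> couplings (hmeas1 a) (hmeas1 b)" "\<xi> \<in> couplings (hmeas2 a) (hmeas2 b)"
    by (auto simp: expansive_couplings_def)
  interpret bip_pair a b \<pi> \<xi> by unfold_locales (use A B fc in auto)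
  show "bip_coupling a b f \<in> Hom cat_Bc (bip a) (bip b)"
    using expansive_iff f by (simp add: bip_coupling_eq cat_Bc_def)
  fix c :: "('a, 'b) hypernetwork" assume "c \<in> Ob cat_Hc"
  then have c: "compact_hypernetwork c" by (simp add: cat_Hc_def)
  note C = compact_hypernetworkD[OF c]
  fix g assume "g \<in> Hom cat_Hc b c"
  then obtain \<pi>' \<xi>' where g: "g = (\<pi>', \<xi>')" "(\<pi>', \<xi>') \<in> expansive_couplings b c" by (cases g) (auto simp: cat_Hc_def)
  then have gc: "\<pi>' \<in> couplings (hmeas1 b) (hmeas1 c)" "\<xi>' \<in> couplings (hmeas2 b) (hmeas2 c)"
    by (auto simp: expansive_couplings_def)
  have "composable (hmeas1 a) (hmeas1 b) (hmeas1 c) \<pi> \<pi>'" "composable (hmeas2 a) (hmeas2 b) (hmeas2 c) \<xi> \<xi>'"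
    using fc gc A C by (auto simp: composable_def)
  from sum_coupling_comp[OF half_sum_bip(1)[OF A(1)] half_sum_bip(1)[OF B(1)] half_sum_bip(1)[OF C(1)] this A(4) C(4)]
  show "bip_coupling a c (Comp cat_Hc a b c g f) = Comp cat_Bc (bip a) (bip b) (bip c) (bip_coupling b c g) (bip_coupling a b f)"
    by (simp add: f(1) g(1) cat_Hc_def cat_Bc_def bip_coupling_eq)
qed

section \<open>Splitting a labeled bipartite network\<close>

lemma Lp_norm_zero:
  assumes M: "prob_space M" and f: "f \<in> borel_measurable M" "AE x in M. f x = 0"
  shows "Lp_norm p M f = 0"
proof (cases "p = \<infinity>")
  case True
  have "esssup M (\<lambda>x. ereal \<bar>f x\<bar>) = esssup M (\<lambda>x. 0)"
    by (rule esssup_AE_cong) (use f in auto)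
  also have "\<dots> = 0" using prob_space.emeasure_space_1[OF M] by (intro esssup_const) simp
  finally show ?thesis using True by (simp add: Lp_norm_def)
next
  case False
  have "(\<integral>x. \<bar>f x\<bar> powr real_of_ereal p \<partial>M) = (\<integral>x. 0 \<partial>M)"
    by (rule integral_cong_AE) (use f in auto)
  then show ?thesis using False by (simp add: Lp_norm_def)
qed

text \<open>
  The inclusion is an open embedding, so it maps Borel sets to Borel sets.
\<close>

lemma sets_borel_of_open_subtopology:
  assumes L: "openin X L"
  shows "A \<in> sets (borel_of (subtopology X L)) \<longleftrightarrow> A \<subseteq> L \<and> A \<in> sets (borel_of X)"
proof
  have top: "topspace (subtopology X L) = L" using openin_subset[OF L] by auto
  assume A: "A \<in> sets (borel_of (subtopology X L))"
  have "(\<lambda>x. x) ` A \<in> sets (borel_of X)"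
    by (rule open_embedding_image_borel_of[OF _ _ A]) (use L in \<open>auto simp: openin_open_subtopology\<close>)
  then show "A \<subseteq> L \<and> A \<in> sets (borel_of X)"
    using sets.sets_into_space[OF A] unfolding space_borel_of top by simp
next
  have top: "topspace (subtopology X L) = L" using openin_subset[OF L] by auto
  assume A: "A \<subseteq> L \<and> A \<in> sets (borel_of X)"
  have "(\<lambda>x. x) \<in> borel_of (subtopology X L) \<rightarrow>\<^sub>M borel_of X"
  proof (rule measurable_borel_of)
    fix U assume "openin X U"
    then have "openin (subtopology X L) (U \<inter> L)" by (auto simp: openin_subtopology)
    then show "(\<lambda>x. x) -` U \<inter> space (borel_of (subtopology X L)) \<in> sets (borel_of (subtopology X L))"
      unfolding space_borel_of top by (simp add: openin_borel_of)
  qed (use openin_subset[OF L] in \<open>auto simp: space_borel_of\<close>)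
  from measurable_sets[OF this, of A, unfolded space_borel_of top] A show "A \<in> sets (borel_of (subtopology X L))"
    by (simp add: Int_absorb2)
qed

definition conditioned :: "'a measure \<Rightarrow> 'a set \<Rightarrow> 'a measure" where
  "conditioned \<mu> L = restrict_space (uniform_measure \<mu> L) L"

text \<open>
  Conditioning on an open and closed set of measure \<open>1/2\<close> doubles the measure and keeps it fully
  supported, as open subsets of \<open>L\<close> are open in the whole space.
\<close>

lemma conditioned_half:
  assumes \<mu>: "full_borel_prob X \<mu>" and X: "polish X" and L: "openin X L" "openin X (topspace X - L)" and half: "measure \<mu> L = 1/2"
  shows "full_borel_prob (subtopology X L) (conditioned \<mu> L)" "polish (subtopology X L)"
    "topspace (subtopology X L) = L" "A \<in> sets \<mu> \<Longrightarrow> A \<subseteq> L \<Longrightarrow> emeasure (conditioned \<mu> L) A = 2 * emeasure \<mu> A"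
    "sets (conditioned \<mu> L) = {A. A \<subseteq> L \<and> A \<in> sets \<mu>}"
proof -
  interpret prob_space \<mu> using \<mu> by (simp add: full_borel_prob_def)
  have s: "sets \<mu> = sets (borel_of X)" and supp: "measure_support X \<mu> = topspace X"
    using \<mu> by (auto simp: full_borel_prob_def)
  have Ls: "L \<in> sets \<mu>" using L by (simp add: s openin_borel_of)
  have LX: "L \<subseteq> topspace X" using openin_subset[OF L(1)] .
  show top: "topspace (subtopology X L) = L" using LX by auto
  have eL: "emeasure \<mu> L = ennreal (1/2)" using half by (simp only: emeasure_eq_measure)
  show e: "emeasure (conditioned \<mu> L) A = 2 * emeasure \<mu> A" if "A \<in> sets \<mu>" "A \<subseteq> L" for A
  proof -
    have "emeasure (conditioned \<mu> L) A = emeasure \<mu> A / ennreal (1/2)"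
      using that Ls unfolding conditioned_def by (simp add: emeasure_restrict_space Int_absorb1 eL del: ennreal_half)
    also have "\<dots> = 2 * emeasure \<mu> A"
    proof -
      have "ennreal (prob A) / ennreal (1/2) = ennreal (2 * prob A)"
        by (subst divide_ennreal) (simp_all add: mult.commute)
      then show ?thesis unfolding emeasure_eq_measure by (simp add: ennreal_mult)
    qed
    finally show ?thesis .
  qed
  show sets: "sets (conditioned \<mu> L) = {A. A \<subseteq> L \<and> A \<in> sets \<mu>}"
    using Ls unfolding conditioned_def by (auto simp: sets_restrict_space_iff)
  have clo: "closedin X L"
    using L LX by (simp add: closedin_def)
  show "polish (subtopology X L)"
    using X clo by (auto simp: polish_def intro: completely_metrizable_space_closedin second_countable_subtopology)
  show "full_borel_prob (subtopology X L) (conditioned \<mu> L)"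
    unfolding full_borel_prob_def
  proof (intro conjI)
    show "prob_space (conditioned \<mu> L)"
    proof
      have "space (conditioned \<mu> L) = L" using sets.sets_into_space[OF Ls] by (auto simp: conditioned_def space_restrict_space)
      then show "emeasure (conditioned \<mu> L) (space (conditioned \<mu> L)) = 1"
        using e[OF Ls] ennreal_mult[of 2 "1/2"] by (simp add: eL)
    qed
    show "sets (conditioned \<mu> L) = sets (borel_of (subtopology X L))"
      by (auto simp: sets sets_borel_of_open_subtopology[OF L(1)] s)
    show "measure_support (subtopology X L) (conditioned \<mu> L) = topspace (subtopology X L)"
    proof -
      have "emeasure (conditioned \<mu> L) U > 0" if "openin (subtopology X L) U" "x \<in> U" for U x
      proof -
        have U: "openin X U" "U \<subseteq> L" using that L(1) by (auto simp: openin_open_subtopology)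
        then have "x \<in> measure_support X \<mu>" using that openin_subset[OF U(1)] supp by auto
        then have "emeasure \<mu> U > 0" using U that by (auto simp: measure_support_def)
        then show ?thesis using U by (simp add: e s openin_borel_of ennreal_zero_less_mult_iff)
      qed
      then show ?thesis by (auto simp: measure_support_def)
    qed
  qed
qed

definition split_network :: "'a labeled_network \<Rightarrow> ('a, 'a) hypernetwork" where
  "split_network N =
     \<lparr> hspace1 = subtopology (nspace N) (nleft N), hmeas1 = conditioned (nmeas N) (nleft N),
       hspace2 = subtopology (nspace N) (nright N), hmeas2 = conditioned (nmeas N) (nright N),
       hweight = restrict (nweight N) (nleft N \<times> nright N) \<rparr>"

text \<open>
  The folding map from the disjoint union of the two parts back to the network preserves measures,
  labels and weights.  Its graph is therefore a labeled coupling of distortion zero.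
\<close>

lemma split_network:
  assumes N: "labeled_bipartite_network N"
  shows split_network_hypernetwork: "measure_hypernetwork (split_network N)"
    and dist_split_network: "dist_B p (bip (split_network N)) N = 0"
proof -
  note D = labeled_networkD[OF N]
  let ?L = "nleft N" and ?R = "nright N" and ?\<mu> = "nmeas N" and ?H = "split_network N"
  have full: "full_borel_prob (nspace N) ?\<mu>" "polish (nspace N)"
    and half: "measure ?\<mu> ?L = 1/2" "measure ?\<mu> ?R = 1/2"
    and wt: "nweight N \<in> topspace (nspace N) \<times> topspace (nspace N) \<rightarrow>\<^sub>E {0..}"
      "bounded (nweight N ` (topspace (nspace N) \<times> topspace (nspace N)))"
    and w0: "\<And>x y. x \<in> ?L \<Longrightarrow> y \<in> ?L \<Longrightarrow> nweight N (x, y) = 0" "\<And>x y. x \<in> ?R \<Longrightarrow> y \<in> ?R \<Longrightarrow> nweight N (x, y) = 0"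
      "\<And>x y. x \<in> ?L \<Longrightarrow> y \<in> ?R \<Longrightarrow> nweight N (y, x) = nweight N (x, y)"
    using N by (auto simp: labeled_bipartite_network_def measure_network_def bipartite_decomposition_def)
  have compl: "topspace (nspace N) - ?L = ?R" "topspace (nspace N) - ?R = ?L" using D(7,8) by auto
  note CL = conditioned_half[OF full D(5) _ half(1), unfolded compl, OF D(6)]
  note CR = conditioned_half[OF full D(6) _ half(2), unfolded compl, OF D(5)]
  have sel: "hspace1 ?H = subtopology (nspace N) ?L" "hmeas1 ?H = conditioned ?\<mu> ?L"
    "hspace2 ?H = subtopology (nspace N) ?R" "hmeas2 ?H = conditioned ?\<mu> ?R"
    "hweight ?H = restrict (nweight N) (?L \<times> ?R)"
    by (simp_all add: split_network_def)
  have spL: "space (conditioned ?\<mu> ?L) = ?L" "space (conditioned ?\<mu> ?R) = ?R"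
    using CL(1,3) CR(1,3) by (auto simp: full_borel_prob_def space_borel_of dest!: sets_eq_imp_space_eq)
  have cap: "topspace (nspace N) \<inter> ?L = ?L" "topspace (nspace N) \<inter> ?R = ?R" using D(8) by auto
  have sub: "?L \<subseteq> topspace (nspace N)" "?R \<subseteq> topspace (nspace N)" using D(8) by auto
  have inL: "(\<lambda>x. x) \<in> conditioned ?\<mu> ?L \<rightarrow>\<^sub>M ?\<mu>" "(\<lambda>x. x) \<in> conditioned ?\<mu> ?R \<rightarrow>\<^sub>M ?\<mu>"
    using sub D(9,10) by (auto intro!: measurableI simp: spL D(3) CL(5) CR(5))
  show H: "measure_hypernetwork ?H"
    unfolding measure_hypernetwork_def sel CL(3) CR(3)
  proof (intro conjI CL(1,2) CR(1,2))
    show "restrict (nweight N) (?L \<times> ?R) \<in> ?L \<times> ?R \<rightarrow>\<^sub>E {0..}" using wt(1) sub by (auto simp: PiE_iff)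
    show "restrict (nweight N) (?L \<times> ?R) \<in> borel_measurable (conditioned ?\<mu> ?L \<Otimes>\<^sub>M conditioned ?\<mu> ?R)"
    proof -
      note [measurable] = inL D(11)
      have "(\<lambda>z. nweight N (fst z, snd z)) \<in> borel_measurable (conditioned ?\<mu> ?L \<Otimes>\<^sub>M conditioned ?\<mu> ?R)"
        by (rule measurable_compose[OF _ D(11)], rule measurable_Pair)
           (rule measurable_compose[OF measurable_fst inL(1)], rule measurable_compose[OF measurable_snd inL(2)])
      then show ?thesis
        by (rule measurable_cong[THEN iffD1, rotated]) (auto simp: space_pair_measure spL)
    qed
    have "restrict (nweight N) (?L \<times> ?R) ` (?L \<times> ?R) \<subseteq> nweight N ` (topspace (nspace N) \<times> topspace (nspace N))"
      using sub by auto
    then show "bounded (restrict (nweight N) (?L \<times> ?R) ` (?L \<times> ?R))" by (rule bounded_subset[OF wt(2)])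
  qed
  interpret S: half_sum "conditioned ?\<mu> ?L" "conditioned ?\<mu> ?R" "nmeas (bip ?H)"
    using half_sum_bip(1)[OF H] by (simp add: sel)
  have B: "labeled_bipartite_network (bip ?H)" by (rule bip_labeled_bipartite_network[OF H])
  note DB = labeled_networkD[OF B]
  let ?M = "nmeas (bip ?H)"
  define c where "c = case_sum (\<lambda>x. x) (\<lambda>y. y :: 'a)"
  have c: "c \<in> ?M \<rightarrow>\<^sub>M ?\<mu>" unfolding c_def by (rule S.measurable_case_sum[OF inL])
  have dc: "distr ?M ?\<mu> c = ?\<mu>"
  proof (rule measure_eqI)
    fix A assume "A \<in> sets (distr ?M ?\<mu> c)"
    then have A: "A \<in> sets ?\<mu>" by simp
    have v: "Inl -` (c -` A \<inter> space ?M) = A \<inter> ?L" "Inr -` (c -` A \<inter> space ?M) = A \<inter> ?R"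
      by (auto simp: c_def S.space spL)
    have "emeasure (distr ?M ?\<mu> c) A = emeasure ?M (c -` A \<inter> space ?M)" by (rule emeasure_distr[OF c A])
    also have "\<dots> = (2 * emeasure ?\<mu> (A \<inter> ?L) + 2 * emeasure ?\<mu> (A \<inter> ?R)) / 2"
      unfolding S.emeasure[OF measurable_sets[OF c A]] v
        CL(4)[OF sets.Int[OF A D(9)] Int_lower2] CR(4)[OF sets.Int[OF A D(10)] Int_lower2] ..
    also have "\<dots> = emeasure ?\<mu> (A \<inter> ?L) + emeasure ?\<mu> (A \<inter> ?R)"
      unfolding distrib_left[symmetric] by (subst mult.commute, rule ennreal_mult_divide_eq) auto
    also have "\<dots> = emeasure ?\<mu> ((A \<inter> ?L) \<union> (A \<inter> ?R))"
      using A D(7,9,10) by (intro plus_emeasure) auto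
    also have "(A \<inter> ?L) \<union> (A \<inter> ?R) = A"
      using sets.sets_into_space[OF A] D(3,8) by auto
    finally show "emeasure (distr ?M ?\<mu> c) A = emeasure ?\<mu> A" .
  qed simp
  have g: "(\<lambda>z. (z, c z)) \<in> ?M \<rightarrow>\<^sub>M ?M \<Otimes>\<^sub>M ?\<mu>" using c by measurable
  define P where "P = distr ?M (?M \<Otimes>\<^sub>M ?\<mu>) (\<lambda>z. (z, c z))"
  have P_prob: "prob_space P" unfolding P_def by (rule prob_space.prob_space_distr[OF DB(1) g])
  have P: "P \<in> couplings ?M ?\<mu>"
    unfolding couplings_def using P_prob g c dc DB(1)
    by (auto simp: P_def distr_distr o_def distr_id2)
  have lab: "P \<in> labeled_couplings (bip ?H) N"
    unfolding labeled_couplings_iff[OF B N]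
  proof (intro conjI P)
    have "nleft (bip ?H) \<times> ?L \<union> nright (bip ?H) \<times> ?R \<in> sets (?M \<Otimes>\<^sub>M ?\<mu>)" using D(9,10) DB(9,10) by auto
    then show "AE z in P. z \<in> nleft (bip ?H) \<times> ?L \<union> nright (bip ?H) \<times> ?R"
      unfolding P_def
      by (subst AE_distr_iff[OF g sets_Collect_mem])
         (auto intro!: AE_I2 simp: S.space spL c_def nleft_bip nright_bip sel cap)
  qed
  let ?D = "\<lambda>((x, x'), (y, y')). nweight (bip ?H) (x, y) - nweight N (x', y')"
  have D_meas: "?D \<in> borel_measurable ((?M \<Otimes>\<^sub>M ?\<mu>) \<Otimes>\<^sub>M (?M \<Otimes>\<^sub>M ?\<mu>))"
  proof -
    note [measurable] = D(11) DB(11)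
    show ?thesis unfolding case_prod_beta' by measurable
  qed
  have PP: "P \<Otimes>\<^sub>M P = distr (?M \<Otimes>\<^sub>M ?M) ((?M \<Otimes>\<^sub>M ?\<mu>) \<Otimes>\<^sub>M (?M \<Otimes>\<^sub>M ?\<mu>)) (\<lambda>(u, v). ((u, c u), (v, c v)))"
    unfolding P_def by (rule pair_measure_distr[OF g g]) (fold P_def, rule prob_space_imp_sigma_finite[OF P_prob])
  have "AE z in P \<Otimes>\<^sub>M P. ?D z = 0"
    unfolding PP
  proof (subst AE_distr_iff)
    show "(\<lambda>(u, v). ((u, c u), (v, c v))) \<in> ?M \<Otimes>\<^sub>M ?M \<rightarrow>\<^sub>M (?M \<Otimes>\<^sub>M ?\<mu>) \<Otimes>\<^sub>M (?M \<Otimes>\<^sub>M ?\<mu>)"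
      using c by measurable
    show "{x \<in> space ((?M \<Otimes>\<^sub>M ?\<mu>) \<Otimes>\<^sub>M (?M \<Otimes>\<^sub>M ?\<mu>)). ?D x = 0} \<in> sets ((?M \<Otimes>\<^sub>M ?\<mu>) \<Otimes>\<^sub>M (?M \<Otimes>\<^sub>M ?\<mu>))"
      using D_meas by measurable
    show "AE x in ?M \<Otimes>\<^sub>M ?M. ?D (case x of (u, v) \<Rightarrow> ((u, c u), (v, c v))) = 0"
      by (auto intro!: AE_I2 w0(3)[symmetric] simp: space_pair_measure S.space spL c_def nweight_bip sel cap w0(1,2))
  qed
  moreover have "?D \<in> borel_measurable (P \<Otimes>\<^sub>M P)" using D_meas by (simp add: PP)
  ultimately have dist: "distortion p (bip ?H) N P = 0"
    unfolding distortion_def using prob_space_pair[OF P_prob P_prob] by (intro Lp_norm_zero)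
  have nonneg: "0 \<le> distortion p (bip ?H) N Q" if "Q \<in> labeled_couplings (bip ?H) N" for Q
    using that couplingsD(1)[of Q] prob_space_pair[of Q Q]
    by (auto simp: distortion_def labeled_couplings_def intro!: Lp_norm_nonneg)
  show "dist_B p (bip ?H) N = 0"
  proof (rule antisym)
    have "dist_B p (bip ?H) N \<le> distortion p (bip ?H) N P"
      unfolding dist_B_def by (rule cINF_lower[OF _ lab]) (use nonneg in \<open>auto intro!: bdd_belowI\<close>)
    then show "dist_B p (bip ?H) N \<le> 0" by (simp add: dist)
    show "0 \<le> dist_B p (bip ?H) N" unfolding dist_B_def using lab nonneg by (intro cINF_greatest) auto
  qed
qed

theorem theorem10:
  shows
    "is_functor (cat_Hm :: (('a, 'b) hypernetwork, _) category)
                (cat_Bm :: (('a + 'b) labeled_network, _) category) bip bip_map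
     \<and> is_functor (cat_Hc :: (('a, 'b) hypernetwork, _) category)
                (cat_Bc :: (('a + 'b) labeled_network, _) category) bip bip_coupling
     \<and> (\<forall>(H :: ('a, 'b) hypernetwork) (H' :: ('c, 'd) hypernetwork).
          measure_hypernetwork H \<and> measure_hypernetwork H' \<longrightarrow>
            (\<forall>p::real. 1 \<le> p \<longrightarrow>
               2 powr (1 / p) * dist_B (ereal p) (bip H) (bip H') = dist_H (ereal p) H H')
            \<and> dist_B \<infinity> (bip H) (bip H') = dist_H \<infinity> H H')
     \<and> (\<forall>N :: 'e labeled_network. labeled_bipartite_network N \<longrightarrow>
          (\<exists>H :: ('e, 'e) hypernetwork. measure_hypernetwork H \<and>
             (\<forall>p::ereal. 1 \<le> p \<longrightarrow> dist_B p (bip H) N = 0)))"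
  using bip_functor_m bip_functor_c dist_bip_real dist_bip_infinity split_network_hypernetwork dist_split_network
  by blast

end
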